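(* Let $k$ be an algebraically closed field of characteristic zero and let $q\in k^*$ be a root of unity of odd order $N>1$. The lazy cohomology group $\mathrm{H}^2_{\ell}(u_q(sl(2))^* )$ is trivial.
   Context: **The Hopf algebra $u_q(sl(2))^*$.** $\mathcal O(\mathrm{SL}_q(2))$ is the $k$-algebra generated by $x_{11},x_{12},x_{21},x_{22}$ with relations $x_{11}x_{12}=qx_{12}x_{11}$, $x_{11}x_{21}=qx_{21}x_{11}$, $x_{12}x_{22}=qx_{22}x_{12}$, $x_{21}x_{22}=qx_{22}x_{21}$, $x_{12}x_{21}=x_{21}x_{12}$, $x_{11}x_{22}-x_{22}x_{11}=(q-q^{-1})x_{12}x_{21}$, $x_{11}x_{22}-qx_{12}x_{21}=1$, with $\Delta(x_{ij})=\sum_m x_{im}\otimes x_{mj}$ and $\varepsilon(x_{ij})=\delta_{ij}$. $u_q(sl(2))^*$ (the coordinate algebra of the Frobenius-Lusztig kernel of $\mathrm{SL}(2)$, dual to $u_q(sl(2))$) is identified with the quotient Hopf algebra of $\mathcal O(\mathrm{SL}_q(2))$ by the ideal generated by $x_{ij}^N-\delta_{ij}$, $1\le i,j\le 2$. **Lazy cohomology.** Let $H$ be a Hopf algebra over $k$. A cocycle on $H$ is a convolution-invertible linear map $\sigma:H\otimes H\to k$ with $\sigma(x,1)=\sigma(1,x)=\varepsilon(x)$ and $\sigma(x_{(1)},y_{(1)})\sigma(x_{(2)}y_{(2)},z)=\sigma(y_{(1)},z_{(1)})\sigma(x,y_{(2)}z_{(2)})$ for all $x,y,z\in H$. It is lazy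 if $\sigma(x_{(1)},y_{(1)})x_{(2)}y_{(2)}=\sigma(x_{(2)},y_{(2)})x_{(1)}y_{(1)}$ for all $x,y\in H$. Lazy cocycles form a group under convolution. $\mathrm{H}^2_\ell(H)$ is the quotient of this group by the central subgroup of elements $\partial(\mu)$, $\partial(\mu)(x,y)=\mu(x_{(1)})\mu(y_{(1)})\mu^{-1}(x_{(2)}y_{(2)})$, where $\mu:H\to k$ is a convolution-invertible linear map with $\mu(1)=1$ and $\mu(x_{(1)})x_{(2)}=\mu(x_{(2)})x_{(1)}$ for all $x\in H$. Equivalently, $\mathrm{H}^2_\ell(H)$ is isomorphic to the group of isomorphism classes of $H$-bi-Galois objects that are isomorphic to $H$ as $H$-$H$-bicomodules. *)

theory Defs
  imports
    "HOL-Library.Poly_Mapping"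
    "HOL-Computational_Algebra.Polynomial"
    "HOL-Algebra.Algebra"
begin

section \<open>Tensor products of vector spaces\<close>

text \<open>
  The ground field is a type \<open>'k\<close>; vector spaces over it are carried by \<open>module\<close> records.
  The free vector space on \<open>'a \<times> 'b\<close> is \<open>'a \<times> 'b \<Rightarrow>\<^sub>0 'k\<close>, and \<open>V \<otimes> W\<close> is its part supported on
  \<open>carrier V \<times> carrier W\<close>, modulo the bilinearity relations. A tensor is thus a coset, that is
  a set of formal sums of pairs.
\<close>

definition bilinear_rels ::
  "('k::field, 'a, 'm) module_scheme \<Rightarrow> ('k, 'b, 'n) module_scheme \<Rightarrow> ('a \<times> 'b \<Rightarrow>\<^sub>0 'k) set"
where
  "bilinear_rels V W =
    {Poly_Mapping.single (v \<oplus>\<^bsub>V\<^esub> v', w) 1 - Poly_Mapping.single (v, w) 1 - Poly_Mapping.single (v', w) 1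
       | v v' w. v \<in> carrier V \<and> v' \<in> carrier V \<and> w \<in> carrier W} \<union>
    {Poly_Mapping.single (v, w \<oplus>\<^bsub>W\<^esub> w') 1 - Poly_Mapping.single (v, w) 1 - Poly_Mapping.single (v, w') 1
       | v w w'. v \<in> carrier V \<and> w \<in> carrier W \<and> w' \<in> carrier W} \<union>
    {Poly_Mapping.single (c \<odot>\<^bsub>V\<^esub> v, w) 1 - Poly_Mapping.single (v, w) c
       | c v w. v \<in> carrier V \<and> w \<in> carrier W} \<union>
    {Poly_Mapping.single (v, c \<odot>\<^bsub>W\<^esub> w) 1 - Poly_Mapping.single (v, w) c
       | c v w. v \<in> carrier V \<and> w \<in> carrier W}"

definition tensor_class ::
  "('k::field, 'a, 'm) module_scheme \<Rightarrow> ('k, 'b, 'n) module_scheme \<Rightarrow>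
    ('a \<times> 'b \<Rightarrow>\<^sub>0 'k) \<Rightarrow> ('a \<times> 'b \<Rightarrow>\<^sub>0 'k) set"
where
  "tensor_class V W t =
    {s. Poly_Mapping.keys s \<subseteq> carrier V \<times> carrier W \<and>
        s - t \<in> module.span (\<lambda>c. Poly_Mapping.map ((*) c)) (bilinear_rels V W)}"

text \<open>
  \<open>tensor_form T f\<close> and \<open>tensor_lift M T f\<close> are the values at the tensor \<open>T\<close> of the linear maps
  into \<open>'k\<close> and into \<open>M\<close> induced by a bilinear \<open>f\<close>. Bilinearity makes the value independent of
  the formal sum representing \<open>T\<close>, and \<open>the_elem\<close> picks this common value. For \<open>T = \<Delta>(x)\<close> these
  are the Sweedler sums \<open>f(x\<^sub>(\<^sub>1\<^sub>), x\<^sub>(\<^sub>2\<^sub>))\<close>.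
\<close>

definition tensor_form :: "('a \<times> 'b \<Rightarrow>\<^sub>0 'k::field) set \<Rightarrow> ('a \<Rightarrow> 'b \<Rightarrow> 'k) \<Rightarrow> 'k" where
  "tensor_form T f =
    the_elem ((\<lambda>t. \<Sum>p\<in>Poly_Mapping.keys t. Poly_Mapping.lookup t p * f (fst p) (snd p)) ` T)"

definition tensor_lift ::
  "('k::field, 'c, 'm) module_scheme \<Rightarrow> ('a \<times> 'b \<Rightarrow>\<^sub>0 'k) set \<Rightarrow> ('a \<Rightarrow> 'b \<Rightarrow> 'c) \<Rightarrow> 'c"
where
  "tensor_lift M T f =
    the_elem ((\<lambda>t. \<Oplus>\<^bsub>M\<^esub>p\<in>Poly_Mapping.keys t. Poly_Mapping.lookup t p \<odot>\<^bsub>M\<^esub> f (fst p) (snd p)) ` T)"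

definition tensor_map ::
  "('k::field, 'c, 'm) module_scheme \<Rightarrow> ('k, 'd, 'n) module_scheme \<Rightarrow>
    ('a \<Rightarrow> 'c) \<Rightarrow> ('b \<Rightarrow> 'd) \<Rightarrow> ('a \<times> 'b \<Rightarrow>\<^sub>0 'k) set \<Rightarrow> ('c \<times> 'd \<Rightarrow>\<^sub>0 'k) set"
where
  "tensor_map V W f g T =
    the_elem ((\<lambda>t. tensor_class V W
      (\<Sum>p\<in>Poly_Mapping.keys t. Poly_Mapping.single (f (fst p), g (snd p)) (Poly_Mapping.lookup t p))) ` T)"


section \<open>Bialgebra structures and their quotients\<close>

text \<open>
  An antipode is unique when it exists, and none of the notions below refers to it, so it is not
  recorded.
\<close>

record (overloaded) ('k::zero, 'a) bialgebra = "('k, 'a) module" +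
  comult :: "'a \<Rightarrow> ('a \<times> 'a \<Rightarrow>\<^sub>0 'k) set"
  counit :: "'a \<Rightarrow> 'k"

definition quot_module :: "('k::field, 'a, 'm) module_scheme \<Rightarrow> 'a set \<Rightarrow> ('k, 'a set) module" where
  "quot_module H I =
    \<lparr>carrier = carrier (H Quot I), mult = monoid.mult (H Quot I), one = \<one>\<^bsub>H Quot I\<^esub>,
     ring.zero = \<zero>\<^bsub>H Quot I\<^esub>, add = ring.add (H Quot I),
     smult = (\<lambda>c A. \<Union>x\<in>A. I +>\<^bsub>H\<^esub> (c \<odot>\<^bsub>H\<^esub> x))\<rparr>"

text \<open>
  For a biideal \<open>I\<close> the structure maps of \<open>H / I\<close> are the induced ones: with \<open>\<pi> : H \<rightarrow> H / I\<close>,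
  the coset of \<open>x\<close> is sent to \<open>(\<pi> \<otimes> \<pi>)(\<Delta>(x))\<close> and to \<open>\<epsilon>(x)\<close>, which do not depend on \<open>x\<close>.
\<close>

definition quot_bialgebra ::
  "('k::field, 'a, 'm) bialgebra_scheme \<Rightarrow> 'a set \<Rightarrow> ('k, 'a set) bialgebra"
where
  "quot_bialgebra H I = (let Q = quot_module H I; \<pi> = (\<lambda>x. I +>\<^bsub>H\<^esub> x) in
    \<lparr>carrier = carrier Q, mult = monoid.mult Q, one = \<one>\<^bsub>Q\<^esub>, ring.zero = \<zero>\<^bsub>Q\<^esub>, add = ring.add Q,
     smult = smult Q,
     comult = (\<lambda>A. the_elem ((\<lambda>x. tensor_map Q Q \<pi> \<pi> (comult H x)) ` A)),
     counit = (\<lambda>A. the_elem (counit H ` A))\<rparr>)"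


section \<open>The free bialgebra on a $2 \times 2$ matrix of generators\<close>

text \<open>
  Multiplication of finitely supported functions is convolution over an additively written index
  monoid. Over the free monoid, whose operation is concatenation, this gives the free algebra.
\<close>

datatype 'g free_monoid = Word (letters: "'g list")

instantiation free_monoid :: (type) monoid_add
begin

definition zero_free_monoid :: "'a free_monoid" where
  "0 = Word []"

definition plus_free_monoid :: "'a free_monoid \<Rightarrow> 'a free_monoid \<Rightarrow> 'a free_monoid" where
  "u + v = Word (letters u @ letters v)"

instance
  by standard (simp_all add: zero_free_monoid_def plus_free_monoid_def)

end

datatype idx = I1 | I2

type_synonym 'k mat_free = "(idx \<times> idx) free_monoid \<Rightarrow>\<^sub>0 'k"

definition gen :: "idx \<Rightarrow> idx \<Rightarrow> 'k::field mat_free" where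
  "gen i j = Poly_Mapping.single (Word [(i, j)]) 1"

definition scal :: "'k::field \<Rightarrow> 'k mat_free" where
  "scal c = Poly_Mapping.single 0 c"

definition mat_free_module :: "('k::field, 'k mat_free) module" where
  "mat_free_module =
    \<lparr>carrier = UNIV, mult = (*), one = 1, ring.zero = 0, add = (+), smult = (\<lambda>c a. scal c * a)\<rparr>"

text \<open>
  The comultiplication is the algebra map with \<open>x\<^sub>i\<^sub>j \<mapsto> \<Sum>\<^sub>m x\<^sub>i\<^sub>m \<otimes> x\<^sub>m\<^sub>j\<close>, and the counit the algebra map
  with \<open>x\<^sub>i\<^sub>j \<mapsto> \<delta>\<^sub>i\<^sub>j\<close>. The product in the tensor square, \<open>(a \<otimes> b) (c \<otimes> d) = ac \<otimes> bd\<close>, is written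
  on formal sums.
\<close>

definition tensor_mult ::
  "('a::times \<times> 'b::times \<Rightarrow>\<^sub>0 'k::field) \<Rightarrow> ('a \<times> 'b \<Rightarrow>\<^sub>0 'k) \<Rightarrow> ('a \<times> 'b \<Rightarrow>\<^sub>0 'k)"
where
  "tensor_mult s t = (\<Sum>p\<in>Poly_Mapping.keys s. \<Sum>r\<in>Poly_Mapping.keys t.
     Poly_Mapping.single (fst p * fst r, snd p * snd r) (Poly_Mapping.lookup s p * Poly_Mapping.lookup t r))"

definition comult_gen :: "idx \<Rightarrow> idx \<Rightarrow> ('k::field mat_free \<times> 'k mat_free \<Rightarrow>\<^sub>0 'k)" where
  "comult_gen i j = (\<Sum>m\<in>{I1, I2}. Poly_Mapping.single (gen i m, gen m j) 1)"

primrec comult_word :: "(idx \<times> idx) list \<Rightarrow> ('k::field mat_free \<times> 'k mat_free \<Rightarrow>\<^sub>0 'k)" where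
  "comult_word [] = Poly_Mapping.single (1, 1) 1"
| "comult_word (g # w) = tensor_mult (comult_gen (fst g) (snd g)) (comult_word w)"

primrec counit_word :: "(idx \<times> idx) list \<Rightarrow> 'k::field" where
  "counit_word [] = 1"
| "counit_word (g # w) = (if fst g = snd g then 1 else 0) * counit_word w"

definition mat_free_bialgebra :: "('k::field, 'k mat_free) bialgebra" where
  "mat_free_bialgebra =
    \<lparr>carrier = UNIV, mult = (*), one = 1, ring.zero = 0, add = (+), smult = (\<lambda>c a. scal c * a),
     comult = (\<lambda>a. tensor_class mat_free_module mat_free_module
       (\<Sum>w\<in>Poly_Mapping.keys a. Poly_Mapping.map ((*) (Poly_Mapping.lookup a w)) (comult_word (letters w)))),
     counit = (\<lambda>a. \<Sum>w\<in>Poly_Mapping.keys a. Poly_Mapping.lookup a w * counit_word (letters w))\<rparr>"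


section \<open>$\mathcal{O}(\mathrm{SL}_q(2))$ and $u_q(sl(2))^*$\<close>

definition SLq2_rels :: "'k::field \<Rightarrow> 'k mat_free set" where
  "SLq2_rels q = (let a = gen I1 I1; b = gen I1 I2; c = gen I2 I1; d = gen I2 I2 in
    {a * b - scal q * (b * a),
     a * c - scal q * (c * a),
     b * d - scal q * (d * b),
     c * d - scal q * (d * c),
     b * c - c * b,
     a * d - d * a - scal (q - inverse q) * (b * c),
     a * d - scal q * (b * c) - 1})"

definition O_SLq2 :: "'k::field \<Rightarrow> ('k, 'k mat_free set) bialgebra" where
  "O_SLq2 q = quot_bialgebra mat_free_bialgebra (Idl\<^bsub>mat_free_bialgebra\<^esub> (SLq2_rels q))"

definition SLq2_gen :: "'k::field \<Rightarrow> idx \<Rightarrow> idx \<Rightarrow> 'k mat_free set" where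
  "SLq2_gen q i j =
    (Idl\<^bsub>mat_free_bialgebra\<^esub> (SLq2_rels q)) +>\<^bsub>mat_free_bialgebra\<^esub> (gen i j)"

definition frobenius_rels :: "'k::field \<Rightarrow> nat \<Rightarrow> 'k mat_free set set" where
  "frobenius_rels q N =
    {SLq2_gen q i j [^]\<^bsub>O_SLq2 q\<^esub> N
       \<ominus>\<^bsub>O_SLq2 q\<^esub> (if i = j then \<one>\<^bsub>O_SLq2 q\<^esub> else \<zero>\<^bsub>O_SLq2 q\<^esub>) | i j. True}"

definition uq_sl2_dual :: "'k::field \<Rightarrow> nat \<Rightarrow> ('k, 'k mat_free set set) bialgebra" where
  "uq_sl2_dual q N = quot_bialgebra (O_SLq2 q) (Idl\<^bsub>O_SLq2 q\<^esub> (frobenius_rels q N))"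


section \<open>Lazy cohomology\<close>

text \<open>
  A linear map \<open>H \<otimes> H \<rightarrow> k\<close> is given as a bilinear form on \<open>H \<times> H\<close>. Forms are extensional on the
  carrier, so that equality of HOL functions is equality of forms.
\<close>

definition linear_forms :: "('k::field, 'a, 'm) module_scheme \<Rightarrow> ('a \<Rightarrow> 'k) set" where
  "linear_forms H = {\<mu> \<in> extensional (carrier H).
     (\<forall>x\<in>carrier H. \<forall>y\<in>carrier H. \<mu> (x \<oplus>\<^bsub>H\<^esub> y) = \<mu> x + \<mu> y) \<and>
     (\<forall>c. \<forall>x\<in>carrier H. \<mu> (c \<odot>\<^bsub>H\<^esub> x) = c * \<mu> x)}"

definition bilinear_forms :: "('k::field, 'a, 'm) module_scheme \<Rightarrow> ('a \<times> 'a \<Rightarrow> 'k) set" where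
  "bilinear_forms H = {\<sigma> \<in> extensional (carrier H \<times> carrier H).
     (\<forall>x\<in>carrier H. \<forall>y\<in>carrier H. \<forall>z\<in>carrier H.
        \<sigma> (x \<oplus>\<^bsub>H\<^esub> y, z) = \<sigma> (x, z) + \<sigma> (y, z) \<and> \<sigma> (z, x \<oplus>\<^bsub>H\<^esub> y) = \<sigma> (z, x) + \<sigma> (z, y)) \<and>
     (\<forall>c. \<forall>x\<in>carrier H. \<forall>y\<in>carrier H.
        \<sigma> (c \<odot>\<^bsub>H\<^esub> x, y) = c * \<sigma> (x, y) \<and> \<sigma> (x, c \<odot>\<^bsub>H\<^esub> y) = c * \<sigma> (x, y))}"

definition conv1 ::
  "('k::field, 'a, 'm) bialgebra_scheme \<Rightarrow> ('a \<Rightarrow> 'k) \<Rightarrow> ('a \<Rightarrow> 'k) \<Rightarrow> ('a \<Rightarrow> 'k)"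
where
  "conv1 H \<mu> \<nu> = (\<lambda>x\<in>carrier H. tensor_form (comult H x) (\<lambda>x1 x2. \<mu> x1 * \<nu> x2))"

definition unit1 :: "('k::field, 'a, 'm) bialgebra_scheme \<Rightarrow> ('a \<Rightarrow> 'k)" where
  "unit1 H = (\<lambda>x\<in>carrier H. counit H x)"

definition is_conv_inverse1 ::
  "('k::field, 'a, 'm) bialgebra_scheme \<Rightarrow> ('a \<Rightarrow> 'k) \<Rightarrow> ('a \<Rightarrow> 'k) \<Rightarrow> bool"
where
  "is_conv_inverse1 H \<mu> \<nu> \<longleftrightarrow>
    \<nu> \<in> linear_forms H \<and> conv1 H \<mu> \<nu> = unit1 H \<and> conv1 H \<nu> \<mu> = unit1 H"

definition conv_inverse1 :: "('k::field, 'a, 'm) bialgebra_scheme \<Rightarrow> ('a \<Rightarrow> 'k) \<Rightarrow> ('a \<Rightarrow> 'k)" where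
  "conv_inverse1 H \<mu> = (THE \<nu>. is_conv_inverse1 H \<mu> \<nu>)"

definition conv2 ::
  "('k::field, 'a, 'm) bialgebra_scheme \<Rightarrow> ('a \<times> 'a \<Rightarrow> 'k) \<Rightarrow> ('a \<times> 'a \<Rightarrow> 'k) \<Rightarrow> ('a \<times> 'a \<Rightarrow> 'k)"
where
  "conv2 H \<sigma> \<tau> = (\<lambda>(x, y)\<in>carrier H \<times> carrier H.
     tensor_form (comult H x) (\<lambda>x1 x2. tensor_form (comult H y) (\<lambda>y1 y2.
       \<sigma> (x1, y1) * \<tau> (x2, y2))))"

definition unit2 :: "('k::field, 'a, 'm) bialgebra_scheme \<Rightarrow> ('a \<times> 'a \<Rightarrow> 'k)" where
  "unit2 H = (\<lambda>(x, y)\<in>carrier H \<times> carrier H. counit H x * counit H y)"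

definition conv_invertible2 :: "('k::field, 'a, 'm) bialgebra_scheme \<Rightarrow> ('a \<times> 'a \<Rightarrow> 'k) \<Rightarrow> bool" where
  "conv_invertible2 H \<sigma> \<longleftrightarrow>
    (\<exists>\<tau>\<in>bilinear_forms H. conv2 H \<sigma> \<tau> = unit2 H \<and> conv2 H \<tau> \<sigma> = unit2 H)"

definition cocycles :: "('k::field, 'a, 'm) bialgebra_scheme \<Rightarrow> ('a \<times> 'a \<Rightarrow> 'k) set" where
  "cocycles H = {\<sigma> \<in> bilinear_forms H.
     conv_invertible2 H \<sigma> \<and>
     (\<forall>x\<in>carrier H. \<sigma> (x, \<one>\<^bsub>H\<^esub>) = counit H x \<and> \<sigma> (\<one>\<^bsub>H\<^esub>, x) = counit H x) \<and>
     (\<forall>x\<in>carrier H. \<forall>y\<in>carrier H. \<forall>z\<in>carrier H.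
        tensor_form (comult H x) (\<lambda>x1 x2. tensor_form (comult H y) (\<lambda>y1 y2.
          \<sigma> (x1, y1) * \<sigma> (x2 \<otimes>\<^bsub>H\<^esub> y2, z))) =
        tensor_form (comult H y) (\<lambda>y1 y2. tensor_form (comult H z) (\<lambda>z1 z2.
          \<sigma> (y1, z1) * \<sigma> (x, y2 \<otimes>\<^bsub>H\<^esub> z2))))}"

definition lazy_cocycles :: "('k::field, 'a, 'm) bialgebra_scheme \<Rightarrow> ('a \<times> 'a \<Rightarrow> 'k) set" where
  "lazy_cocycles H = {\<sigma> \<in> cocycles H.
     \<forall>x\<in>carrier H. \<forall>y\<in>carrier H.
       tensor_lift H (comult H x) (\<lambda>x1 x2. tensor_lift H (comult H y) (\<lambda>y1 y2.
         \<sigma> (x1, y1) \<odot>\<^bsub>H\<^esub> (x2 \<otimes>\<^bsub>H\<^esub> y2))) =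
       tensor_lift H (comult H x) (\<lambda>x1 x2. tensor_lift H (comult H y) (\<lambda>y1 y2.
         \<sigma> (x2, y2) \<odot>\<^bsub>H\<^esub> (x1 \<otimes>\<^bsub>H\<^esub> y1)))}"

definition lazy_cocycle_group ::
  "('k::field, 'a, 'm) bialgebra_scheme \<Rightarrow> ('a \<times> 'a \<Rightarrow> 'k) monoid"
where
  "lazy_cocycle_group H = \<lparr>carrier = lazy_cocycles H, mult = conv2 H, one = unit2 H\<rparr>"

definition lazy_functionals :: "('k::field, 'a, 'm) bialgebra_scheme \<Rightarrow> ('a \<Rightarrow> 'k) set" where
  "lazy_functionals H = {\<mu> \<in> linear_forms H.
     (\<exists>\<nu>. is_conv_inverse1 H \<mu> \<nu>) \<and> \<mu> \<one>\<^bsub>H\<^esub> = 1 \<and>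
     (\<forall>x\<in>carrier H.
        tensor_lift H (comult H x) (\<lambda>x1 x2. \<mu> x1 \<odot>\<^bsub>H\<^esub> x2) =
        tensor_lift H (comult H x) (\<lambda>x1 x2. \<mu> x2 \<odot>\<^bsub>H\<^esub> x1))}"

definition coboundary ::
  "('k::field, 'a, 'm) bialgebra_scheme \<Rightarrow> ('a \<Rightarrow> 'k) \<Rightarrow> ('a \<times> 'a \<Rightarrow> 'k)"
where
  "coboundary H \<mu> = (\<lambda>(x, y)\<in>carrier H \<times> carrier H.
     tensor_form (comult H x) (\<lambda>x1 x2. tensor_form (comult H y) (\<lambda>y1 y2.
       \<mu> x1 * \<mu> y1 * conv_inverse1 H \<mu> (x2 \<otimes>\<^bsub>H\<^esub> y2))))"

definition lazy_cohomology ::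
  "('k::field, 'a, 'm) bialgebra_scheme \<Rightarrow> ('a \<times> 'a \<Rightarrow> 'k) set monoid"
where
  "lazy_cohomology H = lazy_cocycle_group H Mod (coboundary H ` lazy_functionals H)"

end

theory Submission
  imports Defs
begin

text \<open>
  Write \<open>H\<close> for the dual of \<open>u\<^sub>q(sl(2))\<close>. It is a quotient of the free algebra \<open>F\<close> on the \<open>x\<^sub>i\<^sub>j\<close>, and \<open>F\<close>
  is a matrix coalgebra on words: functionals on \<open>F\<close> are sequences of matrices and convolution is the
  product of matrices. Functionals on \<open>H\<close> are those that vanish on the ideal of relations. A
  convolution-invertible functional \<open>\<mu>\<close> on \<open>H\<close> with \<open>\<mu>(1) = 1\<close> is lazy iff it is central, that is,
  commutes with all functionals on \<open>H\<close>, and a cocycle is lazy iff it commutes with the pullbacks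
  of all functionals on \<open>H\<close> along the multiplication.

  Let \<open>s\<close> be a lazy cocycle on \<open>H\<close>. Lifted to \<open>F\<close> it is a coboundary: the algebra map
  from \<open>F\<close> to \<open>F\<close> with the product twisted by \<open>s\<close> that fixes the generators is given by a functional
  \<open>m\<close> with \<open>m(x y) = \<Sum> m(x\<^sub>1) m(y\<^sub>1) s(x\<^sub>2, y\<^sub>2)\<close> (\<open>trivialiser_multiplicative\<close>). This \<open>m\<close> is
  convolution-invertible because \<open>s\<close> is, and it commutes with all functionals on \<open>H\<close> because \<open>s\<close> is
  lazy (\<open>trivialiser_central\<close>). Thus \<open>s\<close> is the coboundary of the inverse of \<open>m\<close>, and the whole question
  is whether \<open>m\<close> and its inverse vanish on the relations of \<open>H\<close>. One may multiply the value of
  \<open>m\<close> at each word of length \<open>n\<close> by \<open>c\<^sup>n\<close>, and that of the inverse by \<open>c\<^sup>-\<^sup>n\<close>, which does not change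
  the coboundary. By \<open>annih_of_multiplicative\<close>, the question is decided by the values of \<open>m * f\<close> at
  the defining relations, for \<open>f\<close> a functional on \<open>H\<close>.

  For the quadratic relations, let \<open>V\<close> be the two-dimensional comodule. The matrix of \<open>m\<close> on \<open>V \<otimes> V\<close>
  commutes with \<open>K\<close>, \<open>E\<close>, \<open>F\<close> in \<open>u\<^sub>q(sl(2))\<close>, so it is a scalar on the quantum symmetric square and
  another scalar on the quantum determinant (\<open>central_degree2\<close>). Choosing \<open>c\<close> as a suitable square
  root makes the latter equal to \<open>1\<close>, and then the quadratic relations hold
  (\<open>central_annih_SLq2\<close>).

  For the relations on \<open>N\<close>-th powers, the \<open>q\<close>-binomial theorem shows that the \<open>x\<^sub>i\<^sub>j\<^sup>N\<close> span a \<open>2 \<times> 2\<close> matrix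
  coalgebra in \<open>O(SL\<^sub>q(2))\<close>, on which \<open>m\<close> is a \<open>2 \<times> 2\<close> matrix. Commuting with \<open>E\<close> and \<open>F\<close> forces this matrix
  to be a scalar (\<open>central_power\<close>): its off-diagonal entries vanish, and its diagonal entries are
  the values of \<open>m\<close> at \<open>x\<^sub>1\<^sub>1\<^sup>N\<^sup>-\<^sup>2\<close> and \<open>x\<^sub>2\<^sub>2\<^sup>N\<^sup>-\<^sup>2\<close>, which agree because \<open>m\<close> is a scalar on the simple
  comodule of dimension \<open>N - 1\<close>. As the determinant of the \<open>x\<^sub>i\<^sub>j\<^sup>N\<close> is one, the scalar is \<open>1\<close> or \<open>-1\<close>
  (\<open>central_power_square\<close>), and since \<open>N\<close> is odd a change of the sign of \<open>c\<close> makes it \<open>1\<close>. The inverse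
  of \<open>m\<close> descends in the same way, with the inverse of \<open>s\<close> in place of \<open>s\<close>.

  Conversely, coboundaries of lazy functionals are lazy cocycles, and \<open>\<partial>\<close> is multiplicative on lazy
  functionals. So the lazy cocycles form a group that equals its subgroup of coboundaries. The
  passage between \<open>H\<close> and words rests on two facts: a tensor is determined by its values on
  bilinear forms (\<open>in_tensor_class\<close>), and the description of an algebra by the functionals that vanish
  on its relations passes to quotients (\<open>presentation.quotient\<close>).
\<close>

section \<open>Convolution over finite decompositions\<close>

definition conv :: "('a \<Rightarrow> ('a \<times> 'a) set) \<Rightarrow> ('a \<Rightarrow> 'k::comm_semiring_1) \<Rightarrow> ('a \<Rightarrow> 'k) \<Rightarrow> 'a \<Rightarrow> 'k" where
  "conv s f g x = (\<Sum>(u, v)\<in>s x. f u * g v)"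

text \<open>
  A finite category seen through its arrows: \<open>(u, v) \<in> s x\<close> says that \<open>x\<close> is the composite of \<open>u\<close> and
  \<open>v\<close>, and \<open>e\<close> tells identities from the other arrows. The coalgebras below have bases on which the
  comultiplication is a sum of pairs of basis elements without coefficients, with \<open>(u, v)\<close> occurring
  in \<open>\<Delta>(x)\<close> for a single \<open>x\<close>. Their dual algebras are the convolution algebras of such categories.
\<close>

locale decomposition =
  fixes s :: "'a \<Rightarrow> ('a \<times> 'a) set" and e :: "'a \<Rightarrow> 'k::comm_semiring_1"
  assumes fin: "finite (s x)"
    and det: "(u, v) \<in> s x \<Longrightarrow> (u, v) \<in> s y \<Longrightarrow> x = y"
    and assoc: "(\<exists>u. (u1, u2) \<in> s u \<and> (u, v) \<in> s x) \<longleftrightarrow> (\<exists>w. (u2, v) \<in> s w \<and> (u1, w) \<in> s x)"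
    and unitl: "\<exists>l. (l, x) \<in> s x \<and> e l = 1 \<and> (\<forall>u v. (u, v) \<in> s x \<longrightarrow> (u, v) \<noteq> (l, x) \<longrightarrow> e u = 0)"
    and unitr: "\<exists>r. (x, r) \<in> s x \<and> e r = 1 \<and> (\<forall>u v. (u, v) \<in> s x \<longrightarrow> (u, v) \<noteq> (x, r) \<longrightarrow> e v = 0)"
begin

lemma conv_assoc: "conv s (conv s f g) h = conv s f (conv s g h)"
  for f g h :: "'a \<Rightarrow> 'c::comm_semiring_1"
proof
  fix x
  define P where "P = (SIGMA p:s x. s (fst p))"
  define Q where "Q = (SIGMA p:s x. s (snd p))"
  \<comment> \<open>both iterated sums run over the factorisations of \<open>x\<close> into three; \<open>i\<close> and \<open>j\<close> rebracket them\<close>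
  define i :: "('a \<times> 'a) \<times> ('a \<times> 'a) \<Rightarrow> ('a \<times> 'a) \<times> ('a \<times> 'a)" where "i = (\<lambda>(p, r). ((fst r, THE w. (snd r, snd p) \<in> s w), (snd r, snd p)))"
  define j :: "('a \<times> 'a) \<times> ('a \<times> 'a) \<Rightarrow> ('a \<times> 'a) \<times> ('a \<times> 'a)" where "j = (\<lambda>(p, r). ((THE w. (fst p, fst r) \<in> s w, snd r), (fst p, fst r)))"
  have the: "(THE w. (a, b) \<in> s w) = w" if "(a, b) \<in> s w" for a b w
    using that det by blast
  have "conv s (conv s f g) h x = (\<Sum>((u, v), (u1, u2))\<in>P. f u1 * g u2 * h v)"
    unfolding conv_def P_def by (subst sum.Sigma[symmetric])
      (auto simp: fin case_prod_beta sum_distrib_right intro!: sum.cong)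
  also have "\<dots> = (\<Sum>((u, v), (v1, v2))\<in>Q. f u * g v1 * h v2)"
  proof (rule sum.reindex_bij_witness[of _ j i])
    fix a assume "a \<in> P"
    then obtain u v u1 u2 where a: "a = ((u, v), (u1, u2))" "(u, v) \<in> s x" "(u1, u2) \<in> s u"
      unfolding P_def by (cases a) auto
    then obtain w where w: "(u2, v) \<in> s w" "(u1, w) \<in> s x" using assoc by blast
    have ia: "i a = ((u1, w), (u2, v))" unfolding i_def a using the[OF w(1)] by simp
    show "i a \<in> Q" unfolding ia Q_def using w by auto
    show "j (i a) = a" unfolding ia unfolding j_def a using the[OF a(3)] by simp
    show "(\<lambda>((u, v), (v1, v2)). f u * g v1 * h v2) (i a) =
        (\<lambda>((u, v), (u1, u2)). f u1 * g u2 * h v) a"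
      unfolding ia unfolding a by simp
  next
    fix a assume "a \<in> Q"
    then obtain u w u2 v where a: "a = ((u, w), (u2, v))" "(u, w) \<in> s x" "(u2, v) \<in> s w"
      unfolding Q_def by (cases a) auto
    then obtain y where w: "(u, u2) \<in> s y" "(y, v) \<in> s x" using assoc by blast
    have ia: "j a = ((y, v), (u, u2))" unfolding j_def a using the[OF w(1)] by simp
    show "j a \<in> P" unfolding ia P_def using w by auto
    show "i (j a) = a" unfolding ia unfolding i_def a using the[OF a(3)] by simp
  qed
  also have "\<dots> = conv s f (conv s g h) x"
    unfolding conv_def Q_def by (subst sum.Sigma[symmetric])
      (auto simp: fin case_prod_beta sum_distrib_left mult.assoc intro!: sum.cong)
  finally show "conv s (conv s f g) h x = conv s f (conv s g h) x" .
qed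

lemma conv_unit_left [simp]: "conv s e f = f"
proof
  fix x
  obtain l where l: "(l, x) \<in> s x" "e l = 1" "\<And>u v. (u, v) \<in> s x \<Longrightarrow> (u, v) \<noteq> (l, x) \<Longrightarrow> e u = 0"
    using unitl[of x] by auto
  have "conv s e f x = (\<Sum>(u, v)\<in>{(l, x)}. e u * f v)"
    unfolding conv_def by (rule sum.mono_neutral_right) (use l fin in \<open>auto, fastforce+\<close>)
  then show "conv s e f x = f x" using l by simp
qed

lemma conv_unit_right [simp]: "conv s f e = f"
proof
  fix x
  obtain r where r: "(x, r) \<in> s x" "e r = 1" "\<And>u v. (u, v) \<in> s x \<Longrightarrow> (u, v) \<noteq> (x, r) \<Longrightarrow> e v = 0"
    using unitr[of x] by auto
  have "conv s f e x = (\<Sum>(u, v)\<in>{(x, r)}. f u * e v)"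
    unfolding conv_def by (rule sum.mono_neutral_right) (use r fin in \<open>auto, fastforce+\<close>)
  then show "conv s f e x = f x" using r by simp
qed

lemma inverse_unique:
  assumes "conv s g f = e" "conv s f h = e"
  shows "g = h"
  by (metis assms conv_assoc conv_unit_left conv_unit_right)

lemma commute_inverse:
  assumes "conv s f g = conv s g f" "conv s h f = e" "conv s f h = e"
  shows "conv s h g = conv s g h"
  by (metis assms conv_assoc conv_unit_left conv_unit_right)

end

lemma conv_sum_right: "conv s f (\<lambda>v. \<Sum>i\<in>A. g i v) x = (\<Sum>i\<in>A. conv s f (g i) x)"
  unfolding conv_def case_prod_beta sum_distrib_left by (rule sum.swap)

lemma conv_sum_left: "conv s (\<lambda>v. \<Sum>i\<in>A. g i v) f x = (\<Sum>i\<in>A. conv s (g i) f x)"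
  unfolding conv_def case_prod_beta sum_distrib_right by (rule sum.swap)

lemma conv_cmult_right: "conv s f (\<lambda>v. c * g v) x = c * conv s f g x"
  unfolding conv_def case_prod_beta sum_distrib_left by (simp add: mult_ac)

lemma conv_cmult_left: "conv s (\<lambda>v. c * f v) g x = c * conv s f g x"
  unfolding conv_def case_prod_beta sum_distrib_left by (simp add: mult_ac)

lemma conv_add_right: "conv s f (\<lambda>v. g v + h v) x = conv s f g x + conv s f h x"
  unfolding conv_def by (simp add: case_prod_beta distrib_left sum.distrib)

lemma conv_add_left: "conv s (\<lambda>v. g v + h v) f x = conv s g f x + conv s h f x"
  unfolding conv_def by (simp add: case_prod_beta distrib_right sum.distrib)

lemma conv_zero [simp]: "conv s f (\<lambda>v. 0) x = 0" "conv s (\<lambda>v. 0) f x = 0"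
  unfolding conv_def by simp_all

text \<open>
  The product of two such categories; its convolution algebra is the dual of the tensor product of
  the two coalgebras.
\<close>

definition pspl :: "('a \<Rightarrow> ('a \<times> 'a) set) \<Rightarrow> ('b \<Rightarrow> ('b \<times> 'b) set) \<Rightarrow>
    'a \<times> 'b \<Rightarrow> (('a \<times> 'b) \<times> ('a \<times> 'b)) set" where
  "pspl s t z = (\<lambda>((u, v), (u', v')). ((u, u'), (v, v'))) ` (s (fst z) \<times> t (snd z))"

definition tens :: "('a \<Rightarrow> 'k::comm_semiring_1) \<Rightarrow> ('b \<Rightarrow> 'k) \<Rightarrow> 'a \<times> 'b \<Rightarrow> 'k" where
  "tens f g z = f (fst z) * g (snd z)"

lemma tens_Pair [simp]: "tens f g (x, y) = f x * g y"
  by (simp add: tens_def)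

lemma in_pspl: "((u, u'), (v, v')) \<in> pspl s t (x, y) \<longleftrightarrow> (u, v) \<in> s x \<and> (u', v') \<in> t y"
  unfolding pspl_def by force

lemma conv_pspl:
  "conv (pspl s t) f g (x, y) = (\<Sum>(u, v)\<in>s x. \<Sum>(u', v')\<in>t y. f (u, u') * g (v, v'))"
proof -
  have inj: "inj_on (\<lambda>((u, v), (u', v')). ((u, u'), (v, v'))) A" for A :: "(('x \<times> 'x) \<times> 'y \<times> 'y) set"
    by (auto simp: inj_on_def)
  show ?thesis
    unfolding conv_def pspl_def
    by (subst sum.reindex[OF inj]) (simp add: sum.cartesian_product case_prod_beta)
qed

lemma conv_tens: "conv (pspl s t) (tens f g) (tens f' g') = tens (conv s f f') (conv t g g')"
proof (rule ext, clarify)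
  fix x y
  show "conv (pspl s t) (tens f g) (tens f' g') (x, y) = tens (conv s f f') (conv t g g') (x, y)"
    unfolding conv_pspl by (simp add: conv_def sum_product case_prod_beta mult_ac)
qed

text \<open>
  Convolution with a pure tensor can be carried out one variable at a time. In this way a property of
  functionals in one variable passes to forms in two variables.
\<close>

lemma conv_pspl_slices:
  "conv (pspl s t) (tens f f') h (x, y) = (\<Sum>(u', v')\<in>t y. f' u' * conv s f (\<lambda>x. h (x, v')) x)"
  "conv (pspl s t) (tens f f') h (x, y) = (\<Sum>(u, v)\<in>s x. f u * conv t f' (\<lambda>y. h (v, y)) y)"
  subgoal unfolding conv_pspl unfolding conv_def
    unfolding case_prod_beta by (subst sum.swap) (simp add: sum_distrib_left mult_ac)
  subgoal unfolding conv_pspl unfolding conv_def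
    by (simp add: sum_distrib_left case_prod_beta mult_ac)
  done

lemma conv_pspl_slices':
  "conv (pspl s t) h (tens f f') (x, y) = (\<Sum>(u', v')\<in>t y. conv s (\<lambda>x. h (x, u')) f x * f' v')"
  "conv (pspl s t) h (tens f f') (x, y) = (\<Sum>(u, v)\<in>s x. conv t (\<lambda>y. h (u, y)) f' y * f v)"
  subgoal unfolding conv_pspl unfolding conv_def
    unfolding case_prod_beta by (subst sum.swap) (simp add: sum_distrib_right sum_distrib_left mult_ac)
  subgoal unfolding conv_pspl unfolding conv_def
    by (simp add: sum_distrib_right sum_distrib_left case_prod_beta mult_ac)
  done

lemma decomposition_pspl:
  fixes s :: "'a \<Rightarrow> ('a \<times> 'a) set" and t :: "'b \<Rightarrow> ('b \<times> 'b) set"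
    and e :: "'a \<Rightarrow> 'k::comm_semiring_1" and e' :: "'b \<Rightarrow> 'k"
  assumes "decomposition s e" "decomposition t e'"
  shows "decomposition (pspl s t) (tens e e')"
proof -
  interpret S: decomposition s e by fact
  interpret T: decomposition t e' by fact
  show ?thesis
  proof
    fix z show "finite (pspl s t z)" unfolding pspl_def using S.fin T.fin by blast
  next
    fix u v x y assume "(u, v) \<in> pspl s t x" "(u, v) \<in> pspl s t y"
    then show "x = y"
      by (cases u; cases v; cases x; cases y) (auto simp: in_pspl dest: S.det T.det)
  next
    fix u1 u2 v x :: "'a \<times> 'b"
    obtain a1 b1 a2 b2 c d x1 x2 where "u1 = (a1, b1)" "u2 = (a2, b2)" "v = (c, d)" "x = (x1, x2)"
      by (metis surj_pair)
    then show "(\<exists>u. (u1, u2) \<in> pspl s t u \<and> (u, v) \<in> pspl s t x) =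
        (\<exists>w. (u2, v) \<in> pspl s t w \<and> (u1, w) \<in> pspl s t x)"
      using S.assoc[of a1 a2 c x1] T.assoc[of b1 b2 d x2] by (auto simp: in_pspl)
  next
    fix x :: "'a \<times> 'b" obtain x1 x2 where x: "x = (x1, x2)" by (metis surj_pair)
    obtain l where l: "(l, x1) \<in> s x1" "e l = 1"
      "\<And>u v. (u, v) \<in> s x1 \<Longrightarrow> (u, v) \<noteq> (l, x1) \<Longrightarrow> e u = 0" using S.unitl by metis
    obtain m where m: "(m, x2) \<in> t x2" "e' m = 1"
      "\<And>u v. (u, v) \<in> t x2 \<Longrightarrow> (u, v) \<noteq> (m, x2) \<Longrightarrow> e' u = 0" using T.unitl by metis
    show "\<exists>l. (l, x) \<in> pspl s t x \<and> tens e e' l = 1 \<and>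
        (\<forall>u v. (u, v) \<in> pspl s t x \<longrightarrow> (u, v) \<noteq> (l, x) \<longrightarrow> tens e e' u = 0)"
      unfolding x by (rule exI[of _ "(l, m)"]) (use l m in \<open>fastforce simp: in_pspl\<close>)
  next
    fix x :: "'a \<times> 'b" obtain x1 x2 where x: "x = (x1, x2)" by (metis surj_pair)
    obtain l where l: "(x1, l) \<in> s x1" "e l = 1"
      "\<And>u v. (u, v) \<in> s x1 \<Longrightarrow> (u, v) \<noteq> (x1, l) \<Longrightarrow> e v = 0" using S.unitr by metis
    obtain m where m: "(x2, m) \<in> t x2" "e' m = 1"
      "\<And>u v. (u, v) \<in> t x2 \<Longrightarrow> (u, v) \<noteq> (x2, m) \<Longrightarrow> e' v = 0" using T.unitr by metis
    show "\<exists>l. (x, l) \<in> pspl s t x \<and> tens e e' l = 1 \<and>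
        (\<forall>u v. (u, v) \<in> pspl s t x \<longrightarrow> (u, v) \<noteq> (x, l) \<longrightarrow> tens e e' v = 0)"
      unfolding x by (rule exI[of _ "(l, m)"]) (use l m in \<open>fastforce simp: in_pspl\<close>)
  qed
qed

section \<open>The coalgebra of words in matrix entries\<close>

type_synonym word = "(idx \<times> idx) list"

lemma UNIV_idx: "(UNIV :: idx set) = {I1, I2}"
  using idx.exhaust by blast

lemma finite_idx [simp]: "finite (A :: idx set)"
  by (rule finite_subset[OF subset_UNIV]) (simp add: UNIV_idx)

lemma sum_idx: "(\<Sum>l\<in>UNIV. f l) = f I1 + f I2"
  by (simp add: UNIV_idx)

text \<open>
  A word of length \<open>n\<close> is a pair of index lists \<open>I\<close>, \<open>J\<close> of length \<open>n\<close>, and its comultiplication is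
  \<open>\<Delta>(x\<^sub>I\<^sub>J) = \<Sum>\<^sub>M x\<^sub>I\<^sub>M \<otimes> x\<^sub>M\<^sub>J\<close>. A functional on the free algebra is thus a sequence of matrices of
  sizes \<open>2\<^sup>n\<close>, and convolution is the product of matrices.
\<close>

fun wspl :: "word \<Rightarrow> (word \<times> word) set" where
  "wspl [] = {([], [])}"
| "wspl ((i, j) # w) = (\<lambda>(l, u, v). ((i, l) # u, (l, j) # v)) ` (UNIV \<times> wspl w)"

abbreviation wcounit :: "word \<Rightarrow> 'k::field" where
  "wcounit \<equiv> counit_word"

lemma sum_wspl_Cons:
  "(\<Sum>(u, v)\<in>wspl ((i, j) # w). f u v) = (\<Sum>l\<in>UNIV. \<Sum>(u, v)\<in>wspl w. f ((i, l) # u) ((l, j) # v))"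
proof -
  have inj: "inj_on (\<lambda>(l, u, v). ((i, l) # u, (l, j) # v)) A" for A
    by (auto simp: inj_on_def)
  show ?thesis
    unfolding wspl.simps by (subst sum.reindex[OF inj]) (simp add: sum.cartesian_product case_prod_beta)
qed

lemma sum_wspl_Cons_pair:
  "(\<Sum>p\<in>wspl ((i, j) # w). b p) = (\<Sum>l\<in>UNIV. \<Sum>p\<in>wspl w. b ((i, l) # fst p, (l, j) # snd p))"
  using sum_wspl_Cons[of "\<lambda>u v. b (u, v)" i j w] by (simp add: case_prod_beta)

lemma wspl_length: "(u, v) \<in> wspl w \<Longrightarrow> length u = length w \<and> length v = length w"
  by (induction w arbitrary: u v rule: wspl.induct) auto

lemma finite_wspl: "finite (wspl w)"
  by (induction w rule: wspl.induct) auto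

lemma decomposition_wspl: "decomposition wspl wcounit"
proof
  fix x show "finite (wspl x)" by (rule finite_wspl)
next
  fix u v x y
  show "(u, v) \<in> wspl x \<Longrightarrow> (u, v) \<in> wspl y \<Longrightarrow> x = y"
  proof (induction x arbitrary: u v y rule: wspl.induct)
    case 1 then show ?case by (cases y) (auto dest: wspl_length)
  next
    case (2 i j w)
    then show ?case by (cases y) (auto dest: wspl_length)
  qed
next
  fix u1 u2 v x
  show "(\<exists>u. (u1, u2) \<in> wspl u \<and> (u, v) \<in> wspl x) = (\<exists>w. (u2, v) \<in> wspl w \<and> (u1, w) \<in> wspl x)"
  proof (induction x arbitrary: u1 u2 v rule: wspl.induct)
    case 1 then show ?case by auto
  next
    case (2 i j w)
    show ?case
    proof
      assume "\<exists>u. (u1, u2) \<in> wspl u \<and> (u, v) \<in> wspl ((i, j) # w)"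
      then obtain l u' v' where *: "(u1, u2) \<in> wspl ((i, l) # u')" "v = (l, j) # v'" "(u', v') \<in> wspl w"
        by auto
      then obtain m p r where **: "u1 = (i, m) # p" "u2 = (m, l) # r" "(p, r) \<in> wspl u'" by auto
      then obtain w' where "(r, v') \<in> wspl w'" "(p, w') \<in> wspl w" using 2[of p r v'] * by blast
      then have "(u2, v) \<in> wspl ((m, j) # w') \<and> (u1, (m, j) # w') \<in> wspl ((i, j) # w)"
        using * ** by force
      then show "\<exists>w'. (u2, v) \<in> wspl w' \<and> (u1, w') \<in> wspl ((i, j) # w)" by blast
    next
      assume "\<exists>w'. (u2, v) \<in> wspl w' \<and> (u1, w') \<in> wspl ((i, j) # w)"
      then obtain m p w' where *: "(u2, v) \<in> wspl ((m, j) # w')" "u1 = (i, m) # p" "(p, w') \<in> wspl w"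
        by auto
      then obtain l r v' where **: "u2 = (m, l) # r" "v = (l, j) # v'" "(r, v') \<in> wspl w'" by auto
      then obtain u' where "(p, r) \<in> wspl u'" "(u', v') \<in> wspl w" using 2[of p r v'] * by blast
      then have "(u1, u2) \<in> wspl ((i, l) # u') \<and> ((i, l) # u', v) \<in> wspl ((i, j) # w)"
        using * ** by force
      then show "\<exists>u. (u1, u2) \<in> wspl u \<and> (u, v) \<in> wspl ((i, j) # w)" by blast
    qed
  qed
next
  fix x
  show "\<exists>l. (l, x) \<in> wspl x \<and> wcounit l = (1::'k::field) \<and>
    (\<forall>u v. (u, v) \<in> wspl x \<longrightarrow> (u, v) \<noteq> (l, x) \<longrightarrow> wcounit u = (0::'k))"
  proof (induction x rule: wspl.induct)
    case (2 i j w)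
    then obtain l where "(l, w) \<in> wspl w" "wcounit l = (1::'k)"
      "\<forall>u v. (u, v) \<in> wspl w \<longrightarrow> (u, v) \<noteq> (l, w) \<longrightarrow> wcounit u = (0::'k)" by blast
    then show ?case by (intro exI[of _ "(i, i) # l"]) force
  qed auto
next
  fix x
  show "\<exists>r. (x, r) \<in> wspl x \<and> wcounit r = (1::'k::field) \<and>
    (\<forall>u v. (u, v) \<in> wspl x \<longrightarrow> (u, v) \<noteq> (x, r) \<longrightarrow> wcounit v = (0::'k))"
  proof (induction x rule: wspl.induct)
    case (2 i j w)
    then obtain r where "(w, r) \<in> wspl w" "wcounit r = (1::'k)"
      "\<forall>u v. (u, v) \<in> wspl w \<longrightarrow> (u, v) \<noteq> (w, r) \<longrightarrow> wcounit v = (0::'k)" by blast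
    then show ?case by (intro exI[of _ "(j, j) # r"]) force
  qed auto
qed

interpretation W1: decomposition wspl "wcounit :: word \<Rightarrow> 'k::field"
  by (rule decomposition_wspl)

abbreviation wspl2 where "wspl2 \<equiv> pspl wspl wspl"

interpretation W2: decomposition wspl2 "tens wcounit wcounit :: word \<times> word \<Rightarrow> 'k::field"
  by (intro decomposition_pspl decomposition_wspl)

lemma sum_wspl_append:
  "(\<Sum>(u, v)\<in>wspl (x @ y). f u v) = (\<Sum>(u, v)\<in>wspl x. \<Sum>(u', v')\<in>wspl y. f (u @ u') (v @ v'))"
proof (induction x arbitrary: f rule: wspl.induct)
  case (2 i j w)
  show ?case unfolding append_Cons sum_wspl_Cons 2 by simp
qed simp

definition pullback :: "(word \<Rightarrow> 'k) \<Rightarrow> word \<times> word \<Rightarrow> 'k" where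
  "pullback f z = f (fst z @ snd z)"

lemma pullback_Pair [simp]: "pullback f (x, y) = f (x @ y)"
  by (simp add: pullback_def)

lemma conv_pullback: "conv wspl2 (pullback f) (pullback g) = pullback (conv wspl f g)"
  by (rule ext, clarify) (simp add: conv_pspl, simp add: conv_def sum_wspl_append)

lemma wcounit_append [simp]: "wcounit (u @ v) = wcounit u * (wcounit v :: 'k::field)"
  by (induction u) auto

lemma wcounit_replicate: "wcounit (replicate n (i, j)) = (if i = j \<or> n = 0 then 1 else 0)"
  by (induction n) auto

lemma pullback_wcounit [simp]: "pullback wcounit = tens wcounit (wcounit :: word \<Rightarrow> 'k::field)"
  by (rule ext) (auto simp: pullback_def tens_def)

lemma conv_Nil [simp]: "conv wspl f g [] = f [] * g []"
  by (simp add: conv_def)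

lemma conv_Cons:
  "conv wspl f g ((i, j) # w) = (\<Sum>l\<in>UNIV. conv wspl (\<lambda>u. f ((i, l) # u)) (\<lambda>v. g ((l, j) # v)) w)"
  unfolding conv_def sum_wspl_Cons by simp

lemma conv_cong_length:
  assumes "\<And>u. length u = length w \<Longrightarrow> f u = f' u" "\<And>v. length v = length w \<Longrightarrow> g v = g' v"
  shows "conv wspl f g w = conv wspl f' g' w"
  unfolding conv_def
  by (rule sum.cong) (use assms wspl_length in \<open>auto split: prod.splits\<close>)

text \<open>
  A functional that vanishes on all words of length \<open>n\<close> but \<open>x\<^sub>p\<^sub>j\<^sup>n\<close> picks out one term of
  \<open>\<Delta>(x\<^sub>i\<^sub>j\<^sup>n)\<close>, namely \<open>x\<^sub>i\<^sub>p\<^sup>n \<otimes> x\<^sub>p\<^sub>j\<^sup>n\<close>.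
\<close>

lemma conv_pick:
  "conv wspl f (\<lambda>v. if v = replicate n (p, j) then 1 else 0) (replicate n (i, j)) = f (replicate n (i, p))"
proof (induction n arbitrary: f)
  case (Suc n)
  have "conv wspl f (\<lambda>v. if v = replicate (Suc n) (p, j) then 1 else 0) (replicate (Suc n) (i, j)) =
     (\<Sum>l\<in>UNIV. if l = p then conv wspl (\<lambda>u. f ((i, l) # u)) (\<lambda>v. if v = replicate n (p, j) then 1 else 0) (replicate n (i, j)) else 0)"
    unfolding replicate_Suc conv_Cons by (intro sum.cong refl) auto
  then show ?case using Suc.IH[of "\<lambda>u. f ((i, p) # u)"] by simp
qed simp

lemma conv_pick_left:
  "conv wspl (\<lambda>v. if v = replicate n (i, p) then 1 else 0) f (replicate n (i, j)) = f (replicate n (p, j))"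
proof (induction n arbitrary: f)
  case (Suc n)
  have "conv wspl (\<lambda>v. if v = replicate (Suc n) (i, p) then 1 else 0) f (replicate (Suc n) (i, j)) =
     (\<Sum>l\<in>UNIV. if l = p then conv wspl (\<lambda>v. if v = replicate n (i, p) then 1 else 0) (\<lambda>u. f ((l, j) # u)) (replicate n (i, j)) else 0)"
    unfolding replicate_Suc conv_Cons by (intro sum.cong refl) auto
  then show ?case using Suc.IH[of "\<lambda>u. f ((p, j) # u)"] by simp
qed simp

section \<open>Linear functionals and the ideals they annihilate\<close>

text \<open>
  The pairing of formal linear combinations with functions on their basis. It serves for the free
  algebra as well as for the formal sums of pairs that represent tensors.
\<close>

definition lin :: "('x \<Rightarrow>\<^sub>0 'k::field) \<Rightarrow> ('x \<Rightarrow> 'k) \<Rightarrow> 'k" where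
  "lin t f = (\<Sum>p\<in>Poly_Mapping.keys t. Poly_Mapping.lookup t p * f p)"

lemma lin_superset:
  assumes "finite A" "Poly_Mapping.keys t \<subseteq> A"
  shows "lin t f = (\<Sum>p\<in>A. Poly_Mapping.lookup t p * f p)"
  unfolding lin_def by (rule sum.mono_neutral_left) (use assms in \<open>auto simp: in_keys_iff\<close>)

lemma lin_0 [simp]: "lin 0 f = 0"
  by (simp add: lin_def)

lemma lin_single [simp]: "lin (Poly_Mapping.single p c) f = c * f p"
  by (simp add: lin_def)

lemma lin_add [simp]: "lin (s + t) f = lin s f + lin t f"
  by (subst (1 2 3) lin_superset[of "Poly_Mapping.keys s \<union> Poly_Mapping.keys t"])
    (use keys_add[of s t] in \<open>auto simp: lookup_add sum.distrib distrib_right\<close>)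

lemma lin_uminus [simp]: "lin (- s) f = - lin s f"
  using lin_add[of s "- s" f] by (simp add: eq_neg_iff_add_eq_0 add.commute)

lemma lin_diff [simp]: "lin (s - t) f = lin s f - lin t f"
  using lin_add[of s "- t" f] by simp

lemma lin_sum: "lin (\<Sum>i\<in>A. s i) f = (\<Sum>i\<in>A. lin (s i) f)"
  by (induction A rule: infinite_finite_induct) auto

lemma lin_scale [simp]: "lin (Poly_Mapping.map ((*) c) t) f = c * lin t f"
proof -
  have "lin (Poly_Mapping.map ((*) c) t) f =
      (\<Sum>p\<in>Poly_Mapping.keys t. Poly_Mapping.lookup (Poly_Mapping.map ((*) c) t) p * f p)"
    by (rule lin_superset) (auto simp: in_keys_iff Poly_Mapping.map.rep_eq when_def)
  also have "\<dots> = (\<Sum>p\<in>Poly_Mapping.keys t. c * (Poly_Mapping.lookup t p * f p))"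
    by (rule sum.cong) (auto simp: Poly_Mapping.map.rep_eq when_def in_keys_iff mult.assoc)
  finally show ?thesis by (simp add: lin_def sum_distrib_left)
qed

lemma lin_fun_add: "lin t (\<lambda>p. f p + g p) = lin t f + lin t g"
  by (simp add: lin_def sum.distrib distrib_left)

lemma lin_fun_cmult: "lin t (\<lambda>p. c * f p) = c * lin t f"
  unfolding lin_def sum_distrib_left by (rule sum.cong) (auto simp: mult_ac)

lemma lin_fun_mult_right: "lin t (\<lambda>p. f p * c) = lin t f * c"
  unfolding lin_def sum_distrib_right by (rule sum.cong) (auto simp: mult_ac)

lemma lin_fun_sum: "lin t (\<lambda>p. \<Sum>i\<in>A. f i p) = (\<Sum>i\<in>A. lin t (f i))"
  unfolding lin_def sum_distrib_left by (rule sum.swap)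

lemma sum_ev: "(\<Sum>(u, v)\<in>A. lin t (f u v)) = lin t (\<lambda>w. \<Sum>(u, v)\<in>A. f u v w)"
  by (simp add: case_prod_beta lin_fun_sum)

lemma lin_swap: "lin s (\<lambda>p. lin t (\<lambda>r. f p r)) = lin t (\<lambda>r. lin s (\<lambda>p. f p r))"
  unfolding lin_def sum_distrib_left
  by (subst sum.swap) (simp add: mult.left_commute)

lemma lin_cong: "(\<And>p. p \<in> Poly_Mapping.keys t \<Longrightarrow> f p = g p) \<Longrightarrow> lin t f = lin t g"
  by (simp add: lin_def)

lemma poly_mapping_decompose: "t = (\<Sum>p\<in>Poly_Mapping.keys t. Poly_Mapping.single p (Poly_Mapping.lookup t p))"
  by (rule poly_mapping_eqI) (auto simp: lookup_sum lookup_single when_def in_keys_iff)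

abbreviation ev :: "'k::field mat_free \<Rightarrow> (word \<Rightarrow> 'k) \<Rightarrow> 'k" where
  "ev x f \<equiv> lin x (\<lambda>w. f (letters w))"

definition wd :: "word \<Rightarrow> 'k::field mat_free" where
  "wd w = Poly_Mapping.single (Word w) 1"

lemma lin_wd [simp]: "lin (wd w) f = f (Word w)"
  by (simp add: wd_def)

lemma wd_mult [simp]: "wd u * wd v = wd (u @ v)"
  by (simp add: wd_def mult_single plus_free_monoid_def)

lemma one_eq_wd: "1 = wd []"
  by (simp add: wd_def zero_free_monoid_def[symmetric])

lemma gen_eq_wd: "gen i j = wd [(i, j)]"
  by (simp add: wd_def gen_def)

lemma wd_decompose: "x = (\<Sum>w\<in>Poly_Mapping.keys x. scal (Poly_Mapping.lookup x w) * wd (letters w))"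
  by (subst poly_mapping_decompose) (simp add: scal_def wd_def mult_single)

lemma lin_scal_mult [simp]: "lin (scal c * x) f = c * lin x f"
  by (simp add: scal_def mult_map_scale_conv_mult[symmetric])

lemma ev_mult: "ev (x * y) f = ev x (\<lambda>u. ev y (\<lambda>v. f (u @ v)))"
proof -
  have *: "x * y = (\<Sum>u\<in>Poly_Mapping.keys x. \<Sum>v\<in>Poly_Mapping.keys y.
      Poly_Mapping.single (u + v) (Poly_Mapping.lookup x u * Poly_Mapping.lookup y v))"
    by (subst poly_mapping_decompose[of x], subst poly_mapping_decompose[of y])
      (simp add: sum_product mult_single)
  show ?thesis unfolding *
    by (simp add: lin_sum plus_free_monoid_def) (simp add: lin_def sum_distrib_left mult_ac)
qed

lemma lin_one [simp]: "lin (1 :: 'k::field mat_free) f = f (Word [])"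
  by (simp add: one_eq_wd)

lemma lookup_scale [simp]: "Poly_Mapping.lookup (Poly_Mapping.map ((*) c) x) k = c * Poly_Mapping.lookup x k"
  for c :: "'k::semiring_0"
  by (simp add: Poly_Mapping.map.rep_eq when_def)

lemma scal_commute: "y * scal c = scal c * y"
proof -
  let ?t = "\<lambda>w. Poly_Mapping.single w (Poly_Mapping.lookup y w)"
  have y: "y = sum ?t (Poly_Mapping.keys y)" by (rule poly_mapping_decompose)
  have "y * scal c = sum ?t (Poly_Mapping.keys y) * scal c"
    by (rule arg_cong[OF y])
  also have "\<dots> = scal c * sum ?t (Poly_Mapping.keys y)"
    unfolding sum_distrib_left sum_distrib_right by (simp add: scal_def mult_single mult.commute)
  also have "\<dots> = scal c * y"
    by (rule arg_cong[OF y[symmetric]])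
  finally show ?thesis .
qed

lemma scale_eq_scal: "Poly_Mapping.map ((*) c) x = scal c * x"
  by (simp add: scal_def mult_map_scale_conv_mult)

lemma linear_eq_ev:
  assumes "\<And>x y. g (x + y) = g x + g y" "\<And>c x. g (scal c * x) = c * (g x :: 'k::field)"
  shows "g x = ev x (\<lambda>w. g (wd w))"
proof -
  have g0: "g 0 = 0" using assms(2)[of 0 0] by simp
  have s: "g (\<Sum>i\<in>A. h i) = (\<Sum>i\<in>A. g (h i))" for A and h :: "_ \<Rightarrow> 'k mat_free"
    by (induction A rule: infinite_finite_induct) (simp_all add: g0 assms(1))
  have "g x = g (\<Sum>w\<in>Poly_Mapping.keys x. scal (Poly_Mapping.lookup x w) * wd (letters w))"
    by (subst wd_decompose) (rule refl)
  then show ?thesis unfolding s assms(2) lin_def .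
qed

lemma ev_sandwich: "ev (wd u * x * wd v) f = ev x (\<lambda>w. f (u @ w @ v))"
  using ev_mult[of "wd u * x" "wd v" f] ev_mult[of "wd u" x "\<lambda>w. f (w @ v)"] by simp

text \<open>
  The linear functionals that vanish on the two-sided ideal generated by \<open>S\<close>, in other words the
  functionals on the quotient by this ideal, given by their values on words. The bilinear analogue
  \<open>annih2\<close> consists of the forms on the quotient.
\<close>

definition annih :: "'k::field mat_free set \<Rightarrow> (word \<Rightarrow> 'k) \<Rightarrow> bool" where
  "annih S f \<longleftrightarrow> (\<forall>r\<in>S. \<forall>u v. ev r (\<lambda>w. f (u @ w @ v)) = 0)"

definition annih2 :: "'k::field mat_free set \<Rightarrow> (word \<times> word \<Rightarrow> 'k) \<Rightarrow> bool" where
  "annih2 S b \<longleftrightarrow> (\<forall>y. annih S (\<lambda>x. b (x, y))) \<and> (\<forall>x. annih S (\<lambda>y. b (x, y)))"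

lemma annih_Un: "annih (S \<union> T) f \<longleftrightarrow> annih S f \<and> annih T f"
  by (auto simp: annih_def)

lemma annih_mono: "annih T f \<Longrightarrow> S \<subseteq> T \<Longrightarrow> annih S f"
  by (auto simp: annih_def)

lemma annih2_mono: "annih2 T f \<Longrightarrow> S \<subseteq> T \<Longrightarrow> annih2 S f"
  using annih_mono unfolding annih2_def by blast

lemma annihD: "annih S f \<Longrightarrow> r \<in> S \<Longrightarrow> ev r (\<lambda>w. f (u @ w @ v)) = 0"
  by (auto simp: annih_def)

lemma annihD0: "annih S f \<Longrightarrow> r \<in> S \<Longrightarrow> ev r f = 0"
  using annihD[of S f r "[]" "[]"] by simp

lemma annih_translate: "annih S f \<Longrightarrow> annih S (\<lambda>w. f (x @ w @ y))"
  unfolding annih_def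
proof (intro ballI allI)
  fix r u v assume *: "\<forall>r\<in>S. \<forall>u v. ev r (\<lambda>w. f (u @ w @ v)) = 0" "r \<in> S"
  show "ev r (\<lambda>w. f (x @ (u @ w @ v) @ y)) = 0"
    using *(1)[rule_format, OF *(2), of "x @ u" "v @ y"] by simp
qed

lemma annih_append_left: "annih S f \<Longrightarrow> annih S (\<lambda>w. f (x @ w))"
  using annih_translate[of S f x "[]"] by simp

lemma annih_append_right: "annih S f \<Longrightarrow> annih S (\<lambda>w. f (w @ y))"
  using annih_translate[of S f "[]" y] by simp

lemma annih_Cons: "annih S f \<Longrightarrow> annih S (\<lambda>w. f (g # w))"
  using annih_translate[of S f "[g]" "[]"] by simp

lemma annih_sum: "(\<And>i. i \<in> A \<Longrightarrow> annih S (f i)) \<Longrightarrow> annih S (\<lambda>w. \<Sum>i\<in>A. f i w)"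
  by (auto simp: annih_def lin_fun_sum)

lemma annih_sum_prod:
  assumes "\<And>a b. (a, b) \<in> A \<Longrightarrow> annih S (f a b)"
  shows "annih S (\<lambda>w. \<Sum>(a, b)\<in>A. f a b w)"
  using annih_sum[of A S "\<lambda>p. f (fst p) (snd p)"] assms by (auto simp: case_prod_beta)

lemma annih_cmult: "annih S f \<Longrightarrow> annih S (\<lambda>w. c * f w)"
  by (auto simp: annih_def lin_fun_cmult)

lemma annih_mult_right: "annih S f \<Longrightarrow> annih S (\<lambda>w. f w * c)"
  by (auto simp: annih_def lin_fun_mult_right)

lemma annih_linear:
  assumes "\<And>x y. g (x + y) = g x + g y" "\<And>c x. g (scal c * x) = c * (g x :: 'k::field)"
    and "\<And>r u v. r \<in> S \<Longrightarrow> g (wd u * r * wd v) = 0"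
  shows "annih S (\<lambda>w. g (wd w))"
proof -
  have "ev x (\<lambda>w. g (wd (u @ w @ v))) = g (wd u * x * wd v)" for u x v
    using ev_sandwich[of u x v "\<lambda>w. g (wd w)"] linear_eq_ev[of g "wd u * x * wd v", OF assms(1,2)] by simp
  then show ?thesis unfolding annih_def by (simp add: assms(3))
qed

lemma annih2_slice: "annih2 S b \<Longrightarrow> annih S (\<lambda>x. b (x, y))" "annih2 S b \<Longrightarrow> annih S (\<lambda>y. b (x, y))"
  by (auto simp: annih2_def)

lemma annih2_translate: "annih2 S b \<Longrightarrow> annih2 S (\<lambda>(x, y). b (u @ x @ v, u' @ y @ v'))"
  unfolding annih2_def
  using annih_translate[of S "\<lambda>x. b (x, _)" u v] annih_translate[of S "\<lambda>y. b (_, y)" u' v'] by auto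

lemma annih2_tens: "annih S f \<Longrightarrow> annih S g \<Longrightarrow> annih2 S (tens f g)"
  by (auto simp: annih2_def annih_cmult annih_mult_right)

lemma annih2_pullback: "annih S f \<Longrightarrow> annih2 S (pullback f)"
  by (auto simp: annih2_def annih_append_left annih_append_right)

text \<open>
  The dual form of \<open>\<Delta>(I) \<subseteq> I \<otimes> F + F \<otimes> I\<close> and \<open>\<epsilon>(I) = 0\<close>, where \<open>I\<close> is the ideal generated by \<open>S\<close>
  in the free algebra \<open>F\<close>. Since tensors are tested against bilinear forms throughout, this is the
  form in which the property is both checked and used.
\<close>

definition coideal :: "'k::field mat_free set \<Rightarrow> bool" where
  "coideal S \<longleftrightarrow> (\<forall>b. annih2 S b \<longrightarrow> annih S (\<lambda>w. \<Sum>p\<in>wspl w. b p)) \<and> annih S wcounit"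

lemma coidealD: "coideal S \<Longrightarrow> annih2 S b \<Longrightarrow> annih S (\<lambda>w. \<Sum>p\<in>wspl w. b p)"
  by (auto simp: coideal_def)

lemma coideal_counit: "coideal S \<Longrightarrow> annih S wcounit"
  by (auto simp: coideal_def)

text \<open>
  As \<open>\<Delta>(u r v) = \<Delta>(u) \<Delta>(r) \<Delta>(v)\<close>, evaluating a form on the quotient at \<open>\<Delta>(u r v)\<close> is a sum of
  evaluations at \<open>\<Delta>(r)\<close> of translates of that form, which are again forms on the quotient.
\<close>

lemma annih_comult_on_generators:
  assumes "\<And>r b. r \<in> T \<Longrightarrow> annih2 S b \<Longrightarrow> ev r (\<lambda>w. \<Sum>p\<in>wspl w. b p) = 0"
    and "annih2 S b"
  shows "annih T (\<lambda>w. \<Sum>p\<in>wspl w. b p)"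
  unfolding annih_def
proof (intro ballI allI)
  fix r u v assume r: "r \<in> T"
  have *: "(\<Sum>p\<in>wspl (u @ w @ v). b p) = (\<Sum>(u1, u2)\<in>wspl u. \<Sum>(v1, v2)\<in>wspl v.
      \<Sum>p\<in>wspl w. (\<lambda>(x, y). b (u1 @ x @ v1, u2 @ y @ v2)) p)" for w
  proof -
    have "(\<Sum>p\<in>wspl (u @ w @ v). b p) = (\<Sum>(x, y)\<in>wspl (u @ w @ v). b (x, y))"
      by simp
    also have "\<dots> = (\<Sum>(u1, u2)\<in>wspl u. \<Sum>(x, y)\<in>wspl w. \<Sum>(v1, v2)\<in>wspl v. b (u1 @ x @ v1, u2 @ y @ v2))"
      by (simp only: sum_wspl_append)
    also have "\<dots> = (\<Sum>(u1, u2)\<in>wspl u. \<Sum>(v1, v2)\<in>wspl v. \<Sum>(x, y)\<in>wspl w. b (u1 @ x @ v1, u2 @ y @ v2))"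
      unfolding case_prod_beta by (subst (2) sum.swap) simp
    finally show ?thesis .
  qed
  show "ev r (\<lambda>w. \<Sum>p\<in>wspl (u @ w @ v). b p) = 0"
    unfolding * case_prod_beta lin_fun_sum
    by (intro sum.neutral ballI)
      (rule assms(1)[OF r annih2_translate[OF assms(2)], unfolded case_prod_beta])
qed

lemma annih_conv: "coideal S \<Longrightarrow> annih S f \<Longrightarrow> annih S g \<Longrightarrow> annih S (conv wspl f g)"
  using coidealD[OF _ annih2_tens[of S f g]] by (simp add: conv_def[abs_def] tens_def case_prod_beta)

lemma annih2_conv:
  assumes "coideal S" "annih2 S a" "annih2 S b"
  shows "annih2 S (conv wspl2 a b)"
  unfolding annih2_def
proof (intro conjI allI)
  fix y
  have "annih S (\<lambda>x. \<Sum>(u', v')\<in>wspl y. conv wspl (\<lambda>u. a (u, u')) (\<lambda>v. b (v, v')) x)"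
    by (intro annih_sum_prod annih_conv assms annih2_slice)
  also have "(\<lambda>x. \<Sum>(u', v')\<in>wspl y. conv wspl (\<lambda>u. a (u, u')) (\<lambda>v. b (v, v')) x) =
      (\<lambda>x. conv wspl2 a b (x, y))"
    unfolding conv_pspl by (rule ext) (simp add: conv_def case_prod_beta, rule sum.swap)
  finally show "annih S (\<lambda>x. conv wspl2 a b (x, y))" .
next
  fix x
  have "annih S (\<lambda>y. \<Sum>(u, v)\<in>wspl x. conv wspl (\<lambda>u'. a (u, u')) (\<lambda>v'. b (v, v')) y)"
    by (intro annih_sum_prod annih_conv assms annih2_slice)
  also have "(\<lambda>y. \<Sum>(u, v)\<in>wspl x. conv wspl (\<lambda>u'. a (u, u')) (\<lambda>v'. b (v, v')) y) =
      (\<lambda>y. conv wspl2 a b (x, y))"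
    unfolding conv_pspl by (rule ext) (simp add: conv_def case_prod_beta)
  finally show "annih S (\<lambda>y. conv wspl2 a b (x, y))" .
qed

text \<open>
  The device by which functionals descend to quotients. If \<open>m(x y) = m(x\<^sub>1) m(y\<^sub>1) s(x\<^sub>2, y\<^sub>2)\<close>, then
  \<open>m(u r v) = \<Sum> m(u\<^sub>1) m(v\<^sub>1) (m * f)(r)\<close> with \<open>f(y) = \<Sum> s(y\<^sub>1, v\<^sub>2) s(u\<^sub>2, y\<^sub>2 v\<^sub>3)\<close>. Here \<open>f\<close> is a
  functional on the quotient by \<open>S\<close>, because \<open>s\<close> is a form on it. So \<open>m * f\<close> has to be
  evaluated only at the relations themselves.
\<close>

lemma annih_of_multiplicative:
  assumes m: "pullback m = conv wspl2 (tens m m) s" and s: "annih2 S s" and S: "coideal S"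
    and T: "\<And>f r. annih S f \<Longrightarrow> r \<in> T \<Longrightarrow> ev r (conv wspl m f) = 0"
  shows "annih T m"
  unfolding annih_def
proof (intro ballI allI)
  fix r u v assume r: "r \<in> T"
  define f where "f = (\<lambda>u v y. conv wspl2 s (\<lambda>(y, v). s (u, y @ v)) (y, v))"
  have "annih2 S (\<lambda>(y, v). s (x, y @ v))" for x
    using annih2_pullback[OF annih2_slice(2)[OF s], of x] by (simp add: pullback_def[abs_def] case_prod_beta')
  then have f: "annih S (f x y)" for x y
    unfolding f_def by (intro annih2_slice annih2_conv[OF S] s)
  have "m (u @ w @ v) = (\<Sum>(u1, u2)\<in>wspl u. m u1 * (\<Sum>(v1, v2)\<in>wspl v. m v1 * conv wspl m (f u2 v2) w))" for w
  proof -
    have "m (u @ w @ v) = conv wspl2 (tens m m) s (u, w @ v)"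
      using m by (metis pullback_Pair)
    also have "\<dots> = (\<Sum>(u1, u2)\<in>wspl u. m u1 * conv wspl m (\<lambda>y. s (u2, y)) (w @ v))"
      by (rule conv_pspl_slices)
    also have "(\<lambda>u2. conv wspl m (\<lambda>y. s (u2, y)) (w @ v)) = (\<lambda>u2. \<Sum>(v1, v2)\<in>wspl v. m v1 * conv wspl m (f u2 v2) w)"
    proof
      fix x
      have "conv wspl m (\<lambda>y. s (x, y)) (w @ v) = conv wspl2 (conv wspl2 (tens m m) s) (pullback (\<lambda>y. s (x, y))) (w, v)"
        unfolding m[symmetric] conv_pullback by simp
      also have "\<dots> = conv wspl2 (tens m m) (conv wspl2 s (\<lambda>(y, v). s (x, y @ v))) (w, v)"
        unfolding W2.conv_assoc by (simp add: pullback_def[abs_def] case_prod_beta')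
      also have "\<dots> = (\<Sum>(v1, v2)\<in>wspl v. m v1 * conv wspl m (f x v2) w)"
        unfolding f_def by (rule conv_pspl_slices)
      finally show "conv wspl m (\<lambda>y. s (x, y)) (w @ v) = (\<Sum>(v1, v2)\<in>wspl v. m v1 * conv wspl m (f x v2) w)" .
    qed
    finally show ?thesis by (simp add: fun_eq_iff)
  qed
  then show "ev r (\<lambda>w. m (u @ w @ v)) = 0"
    using T[OF f r] by (simp add: case_prod_beta lin_fun_sum lin_fun_cmult)
qed

section \<open>Quantum matrix relations\<close>

abbreviation "xa \<equiv> (I1, I1)"
abbreviation "xb \<equiv> (I1, I2)"
abbreviation "xc \<equiv> (I2, I1)"
abbreviation "xd \<equiv> (I2, I2)"

lemma annih_SLq2_iff:
  "annih (SLq2_rels q) f \<longleftrightarrow> (\<forall>u v.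
     f (u @ [xa, xb] @ v) = q * f (u @ [xb, xa] @ v) \<and>
     f (u @ [xa, xc] @ v) = q * f (u @ [xc, xa] @ v) \<and>
     f (u @ [xb, xd] @ v) = q * f (u @ [xd, xb] @ v) \<and>
     f (u @ [xc, xd] @ v) = q * f (u @ [xd, xc] @ v) \<and>
     f (u @ [xb, xc] @ v) = f (u @ [xc, xb] @ v) \<and>
     f (u @ [xa, xd] @ v) = f (u @ [xd, xa] @ v) + (q - inverse q) * f (u @ [xb, xc] @ v) \<and>
     f (u @ [xa, xd] @ v) = q * f (u @ [xb, xc] @ v) + f (u @ v))"
  unfolding annih_def SLq2_rels_def Let_def gen_eq_wd
  by (auto simp: algebra_simps)

lemma SLq2_at:
  assumes "annih (SLq2_rels q) f" "q \<noteq> 0"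
  shows "f (u @ [xb, xa] @ v) = inverse q * f (u @ [xa, xb] @ v)"
    "f (u @ [xc, xa] @ v) = inverse q * f (u @ [xa, xc] @ v)"
    "f (u @ [xd, xb] @ v) = inverse q * f (u @ [xb, xd] @ v)"
    "f (u @ [xd, xc] @ v) = inverse q * f (u @ [xc, xd] @ v)"
    "f (u @ [xc, xb] @ v) = f (u @ [xb, xc] @ v)"
    "f (u @ [xa, xd] @ v) = q * f (u @ [xb, xc] @ v) + f (u @ v)"
    "f (u @ [xd, xa] @ v) = inverse q * f (u @ [xb, xc] @ v) + f (u @ v)"
proof -
  have "f (u @ [xa, xd] @ v) = f (u @ [xd, xa] @ v) + (q - inverse q) * f (u @ [xb, xc] @ v)"
    "f (u @ [xa, xd] @ v) = q * f (u @ [xb, xc] @ v) + f (u @ v)"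
    using assms(1)[unfolded annih_SLq2_iff, rule_format, of u v] by blast+
  then show "f (u @ [xd, xa] @ v) = inverse q * f (u @ [xb, xc] @ v) + f (u @ v)"
    by (simp add: algebra_simps)
qed (use assms(1)[unfolded annih_SLq2_iff, rule_format, of u v] assms(2) in auto)

lemmas SLq2_at0 = SLq2_at[where u = "[]" and v = "[]", simplified]

text \<open>
  For each relation \<open>r\<close> the terms of \<open>\<Delta>(r)\<close> are brought to normal order in both
  factors, where they cancel.
\<close>

lemma annih_SLq2_comult:
  assumes "q \<noteq> 0" "r \<in> SLq2_rels q" "annih2 (SLq2_rels q) b"
  shows "ev r (\<lambda>w. \<Sum>p\<in>wspl w. b p) = 0"
proof -
  note 1 = SLq2_at0[OF annih2_slice(1)[OF assms(3)] assms(1)]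
  note 2 = SLq2_at0[OF annih2_slice(2)[OF assms(3)] assms(1)]
  show ?thesis
    using assms(2) assms(1)
    unfolding SLq2_rels_def Let_def gen_eq_wd
    by (elim insertE emptyE; hypsubst) (simp_all add: sum_wspl_Cons_pair sum_idx 1 2 field_simps del: wspl.simps(2))
qed

lemma coideal_SLq2:
  assumes "q \<noteq> 0"
  shows "coideal (SLq2_rels q)"
  unfolding coideal_def
proof (intro conjI allI impI)
  show "annih (SLq2_rels q) wcounit"
    by (simp add: annih_SLq2_iff algebra_simps)
qed (rule annih_comult_on_generators[OF annih_SLq2_comult[OF assms]])

definition pow_rels :: "nat \<Rightarrow> 'k::field mat_free set" where
  "pow_rels N = {gen i j ^ N - (if i = j then 1 else 0) | i j. True}"

lemma gen_power: "gen i j ^ n = wd (replicate n (i, j))"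
  by (induction n) (simp_all add: gen_eq_wd one_eq_wd)

lemma annih_pow_iff:
  "annih (pow_rels N) f \<longleftrightarrow>
     (\<forall>u v i j. f (u @ replicate N (i, j) @ v) = (if i = j then f (u @ v) else 0))"
  unfolding annih_def pow_rels_def gen_power by (fastforce split: if_splits)

section \<open>Powers of generators and Gaussian binomial coefficients\<close>

lemma commute_power:
  assumes "\<And>u v. f (u @ [g, h] @ v) = c * f (u @ [h, g] @ v)"
  shows "f (u @ g # replicate k h @ v) = (c::'k::field) ^ k * f (u @ replicate k h @ g # v)"
proof (induction k arbitrary: u)
  case (Suc k)
  show ?case using assms[of u "replicate k h @ v"] Suc[of "u @ [h]"] by simp
qed simp

text \<open>
  Gaussian binomial coefficients, by the Pascal rule.
\<close>

fun qbin :: "'k::comm_ring_1 \<Rightarrow> nat \<Rightarrow> nat \<Rightarrow> 'k" where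
  "qbin Q n 0 = 1"
| "qbin Q 0 (Suc k) = 0"
| "qbin Q (Suc n) (Suc k) = qbin Q n k + Q ^ Suc k * qbin Q n (Suc k)"

lemma qbin_gt: "n < k \<Longrightarrow> qbin Q n k = 0"
  by (induction Q n k rule: qbin.induct) auto

text \<open>
  The ratio of neighbouring coefficients. At a primitive \<open>n\<close>-th root of unity the right-hand side
  vanishes for \<open>k = 0\<close> and the factor on the left does not as long as \<open>k + 1 < n\<close>, so that all
  coefficients but the two outer ones vanish.
\<close>

lemma qbin_ratio: "k \<le> n \<Longrightarrow> (1 - Q ^ Suc k) * qbin Q n (Suc k) = (1 - Q ^ (n - k)) * qbin Q n k"
proof (induction n arbitrary: k)
  case (Suc n)
  show ?case
  proof (cases "k = Suc n")
    case False
    then have k: "k \<le> n" using Suc by simp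
    have "(1 - Q ^ Suc k) * qbin Q (Suc n) (Suc k) =
        (1 - Q ^ Suc k) * qbin Q n k + Q ^ Suc k * ((1 - Q ^ Suc k) * qbin Q n (Suc k))"
      by (simp add: algebra_simps)
    also have "\<dots> = (1 - Q ^ Suc k) * qbin Q n k + Q ^ Suc k * ((1 - Q ^ (n - k)) * qbin Q n k)"
      using Suc.IH[OF k] by simp
    also have "\<dots> = (1 - Q ^ (Suc k + (n - k))) * qbin Q n k"
      by (simp only: power_add) (simp add: algebra_simps)
    also have "Suc k + (n - k) = Suc n" using k by simp
    finally have L: "(1 - Q ^ Suc k) * qbin Q (Suc n) (Suc k) = (1 - Q ^ Suc n) * qbin Q n k" .
    show ?thesis
    proof (cases k)
      case 0 then show ?thesis using L by simp
    next
      case (Suc j)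
      have "(1 - Q ^ (n - j)) * qbin Q (Suc n) (Suc j) =
        (1 - Q ^ (n - j)) * qbin Q n j + Q ^ Suc j * (1 - Q ^ (n - j)) * qbin Q n (Suc j)"
        by (simp add: algebra_simps)
      also have "\<dots> = (1 - Q ^ Suc j) * qbin Q n (Suc j) + Q ^ Suc j * (1 - Q ^ (n - j)) * qbin Q n (Suc j)"
        using Suc.IH[of j] k Suc by simp
      also have "\<dots> = (1 - Q ^ (Suc j + (n - j))) * qbin Q n (Suc j)"
        by (simp only: power_add) (simp add: algebra_simps)
      also have "Suc j + (n - j) = Suc n" using k Suc by simp
      finally show ?thesis using L Suc by simp
    qed
  qed (simp add: qbin_gt)
qed simp

lemma qbin_diag: "qbin Q n n = 1"
  by (induction n) (auto simp: qbin_gt)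

lemma qbin_root_of_unity:
  assumes "Q ^ N = (1::'k::field)" "\<And>m. 0 < m \<Longrightarrow> m < N \<Longrightarrow> Q ^ m \<noteq> 1" "0 < k" "k < N"
  shows "qbin Q N k = 0"
  using assms(3,4)
proof (induction k)
  case (Suc k)
  have "(1 - Q ^ Suc k) * qbin Q N (Suc k) = (1 - Q ^ (N - k)) * qbin Q N k"
    using Suc by (intro qbin_ratio) simp
  also have "\<dots> = 0" using Suc assms(1) by (cases "k = 0") auto
  finally show ?case using assms(2)[of "Suc k"] Suc by simp
qed simp

lemma sum_qbin_root_of_unity:
  assumes "Q ^ N = (1::'k::field)" "\<And>m. 0 < m \<Longrightarrow> m < N \<Longrightarrow> Q ^ m \<noteq> 1" "N > 0"
  shows "(\<Sum>k\<le>N. qbin Q N k * h k) = h 0 + h N"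
proof -
  have "(\<Sum>k\<le>N. qbin Q N k * h k) = (\<Sum>k\<in>{0, N}. qbin Q N k * h k)"
    by (rule sum.mono_neutral_right) (use qbin_root_of_unity[OF assms(1,2)] assms(3) in auto)
  then show ?thesis using assms(3) by (simp add: qbin_diag)
qed

lemma sum_atMost_Suc_pascal:
  "(\<Sum>k\<le>Suc n. qbin Q (Suc n) k * h k) =
   (\<Sum>k\<le>n. qbin Q n k * (h (Suc k) + Q ^ k * h k))" for Q :: "'k::field"
proof -
  have "(\<Sum>k\<le>Suc n. qbin Q (Suc n) k * h k) =
      h 0 + (\<Sum>k\<le>n. (qbin Q n k + Q ^ Suc k * qbin Q n (Suc k)) * h (Suc k))"
    by (subst sum.atMost_Suc_shift) simp
  also have "\<dots> = (\<Sum>k\<le>n. qbin Q n k * h (Suc k)) +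
      (h 0 + (\<Sum>k\<le>n. Q ^ Suc k * qbin Q n (Suc k) * h (Suc k)))"
    by (simp add: algebra_simps sum.distrib)
  also have "h 0 + (\<Sum>k\<le>n. Q ^ Suc k * qbin Q n (Suc k) * h (Suc k)) =
      (\<Sum>k\<le>Suc n. Q ^ k * qbin Q n k * h k)"
    using sum.atMost_Suc_shift[of "\<lambda>k. Q ^ k * qbin Q n k * h k" n] by simp
  also have "\<dots> = (\<Sum>k\<le>n. Q ^ k * qbin Q n k * h k)" by (simp add: qbin_gt)
  finally show ?thesis by (simp add: algebra_simps sum.distrib)
qed

lemma SLq2_row_column:
  assumes "annih (SLq2_rels q) f" "q \<noteq> 0"
  shows "f (u @ [(i, I2), (i, I1)] @ v) = inverse q * f (u @ [(i, I1), (i, I2)] @ v)"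
    "f (u @ [(I2, j), (I1, j)] @ v) = inverse q * f (u @ [(I1, j), (I2, j)] @ v)"
  by (cases i; use SLq2_at[OF assms, of u v] in simp) (cases j; use SLq2_at[OF assms, of u v] in simp)

text \<open>
  The \<open>q\<close>-binomial theorem: \<open>\<Delta>(x\<^sub>i\<^sub>j) = A + B\<close> with \<open>A = x\<^sub>i\<^sub>1 \<otimes> x\<^sub>1\<^sub>j\<close> and \<open>B = x\<^sub>i\<^sub>2 \<otimes> x\<^sub>2\<^sub>j\<close>, and
  modulo the relations \<open>B A = q\<^sup>-\<^sup>2 A B\<close>, with one factor \<open>q\<^sup>-\<^sup>1\<close> from each tensor factor.
\<close>

lemma wspl_power:
  assumes "annih2 (SLq2_rels q) b" "q \<noteq> 0"
  shows "(\<Sum>p\<in>wspl (replicate n (i, j)). b p) = (\<Sum>k\<le>n. qbin (inverse q ^ 2) n k *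
    b (replicate k (i, I1) @ replicate (n - k) (i, I2), replicate k (I1, j) @ replicate (n - k) (I2, j)))"
  using assms(1)
proof (induction n arbitrary: b)
  case (Suc n)
  let ?h = "\<lambda>k. b (replicate k (i, I1) @ replicate (Suc n - k) (i, I2), replicate k (I1, j) @ replicate (Suc n - k) (I2, j))"
  have cons: "annih2 (SLq2_rels q) (\<lambda>(x, y). b (g # x, h # y))" for g h
    using annih2_translate[OF Suc.prems, of "[g]" "[]" "[h]" "[]"] by simp
  have move: "b ((i, I2) # replicate k (i, I1) @ replicate (n - k) (i, I2), (I2, j) # replicate k (I1, j) @ replicate (n - k) (I2, j))
      = (inverse q ^ 2) ^ k * ?h k" if "k \<le> n" for k
    using commute_power[of "\<lambda>x. b (x, (I2, j) # replicate k (I1, j) @ replicate (n - k) (I2, j))" "(i, I2)" "(i, I1)"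
        "inverse q" "[]" k "replicate (n - k) (i, I2)",
        OF SLq2_row_column(1)[OF annih2_slice(1)[OF Suc.prems] assms(2)]]
      commute_power[of "\<lambda>y. b (replicate k (i, I1) @ (i, I2) # replicate (n - k) (i, I2), y)" "(I2, j)" "(I1, j)"
        "inverse q" "[]" k "replicate (n - k) (I2, j)",
        OF SLq2_row_column(2)[OF annih2_slice(2)[OF Suc.prems] assms(2)]] that
    by (simp add: Suc_diff_le power_mult_distrib power2_eq_square)
  have "(\<Sum>p\<in>wspl (replicate (Suc n) (i, j)). b p) = (\<Sum>(x, y)\<in>wspl ((i, j) # replicate n (i, j)). b (x, y))"
    by simp
  also have "\<dots> = (\<Sum>l\<in>UNIV. \<Sum>p\<in>wspl (replicate n (i, j)). (\<lambda>(x, y). b ((i, l) # x, (l, j) # y)) p)"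
    unfolding sum_wspl_Cons by simp
  also have "\<dots> = (\<Sum>k\<le>n. qbin (inverse q ^ 2) n k * (?h (Suc k) + (inverse q ^ 2) ^ k * ?h k))"
    unfolding Suc.IH[OF cons] sum_idx
    by (simp add: sum.distrib[symmetric] distrib_left move)
  also have "\<dots> = (\<Sum>k\<le>Suc n. qbin (inverse q ^ 2) (Suc n) k * ?h k)"
    by (rule sum_atMost_Suc_pascal[symmetric])
  finally show ?case .
qed simp

text \<open>
  Modulo the relations \<open>x\<^sub>1\<^sub>1 x\<^sub>2\<^sub>2 = 1 + q x\<^sub>1\<^sub>2 x\<^sub>2\<^sub>1\<close>, and \<open>x\<^sub>1\<^sub>1\<close> moves past \<open>x\<^sub>1\<^sub>2 x\<^sub>2\<^sub>1\<close> with a factor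
  \<open>q\<^sup>2\<close>. Hence \<open>x\<^sub>1\<^sub>1\<^sup>n x\<^sub>2\<^sub>2\<^sup>n\<close> is the product of the \<open>1 + q\<^sup>2\<^sup>k\<^sup>+\<^sup>1 x\<^sub>1\<^sub>2 x\<^sub>2\<^sub>1\<close> over \<open>k < n\<close>; the sum is
  its expansion.
\<close>

lemma ad_power:
  assumes "annih (SLq2_rels q) f" "q \<noteq> 0"
  shows "f (replicate n xa @ replicate n xd) =
    (\<Sum>k\<le>n. qbin (q ^ 2) n k * (q ^ (k * k) * f (replicate k xb @ replicate k xc)))"
  using assms(1)
proof (induction n arbitrary: f)
  case (Suc n)
  have ab: "f (u @ [xa, xb] @ v) = q * f (u @ [xb, xa] @ v)" for u v
    using SLq2_at(1)[OF Suc.prems assms(2)] assms(2) by simp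
  have ac: "f (u @ [xa, xc] @ v) = q * f (u @ [xc, xa] @ v)" for u v
    using SLq2_at(2)[OF Suc.prems assms(2)] assms(2) by simp
  have cb: "f (u @ [xc, xb] @ v) = 1 * f (u @ [xb, xc] @ v)" for u v
    using SLq2_at(5)[OF Suc.prems assms(2)] by simp
  have bc: "f (u @ [xb, xc] @ v) = 1 * f (u @ [xc, xb] @ v)" for u v
    using SLq2_at(5)[OF Suc.prems assms(2)] by simp
  have step: "f (xa # (replicate k xb @ replicate k xc) @ [xd]) =
      q ^ (2 * k) * (f (replicate k xb @ replicate k xc) +
        q * f (replicate (Suc k) xb @ replicate (Suc k) xc))" for k
  proof -
    have "f (xa # (replicate k xb @ replicate k xc) @ [xd]) = q ^ k * f (replicate k xb @ xa # replicate k xc @ [xd])"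
      using commute_power[of f xa xb q "[]" k, OF ab] by simp
    also have "\<dots> = q ^ (2 * k) * f ((replicate k xb @ replicate k xc) @ [xa, xd] @ [])"
      using commute_power[of f xa xc q "replicate k xb" k "[xd]", OF ac] by (simp add: mult_2 power_add)
    also have "f ((replicate k xb @ replicate k xc) @ [xa, xd] @ []) =
        q * f (replicate k xb @ replicate k xc @ [xb, xc]) + f (replicate k xb @ replicate k xc)"
      using SLq2_at(6)[OF Suc.prems assms(2), of "replicate k xb @ replicate k xc" "[]"] by simp
    also have "f (replicate k xb @ replicate k xc @ [xb, xc]) = f (replicate (Suc k) xb @ replicate (Suc k) xc)"
      using commute_power[of f xb xc 1 "replicate k xb" k "[xc]", OF bc]
      by (simp add: replicate_append_same replicate_app_Cons_same)
    finally show ?thesis by (simp add: algebra_simps)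
  qed
  have "f (replicate (Suc n) xa @ replicate (Suc n) xd) =
      f (xa # (replicate n xa @ replicate n xd) @ [xd])"
    by (simp add: replicate_append_same)
  also have "\<dots> = (\<Sum>k\<le>n. qbin (q ^ 2) n k * (q ^ (k * k) * f (xa # (replicate k xb @ replicate k xc) @ [xd])))"
    using Suc.IH[of "\<lambda>w. f (xa # w @ [xd])"] annih_translate[OF Suc.prems, of "[xa]" "[xd]"] by simp
  also have "\<dots> = (\<Sum>k\<le>n. qbin (q ^ 2) n k *
      (q ^ (Suc k * Suc k) * f (replicate (Suc k) xb @ replicate (Suc k) xc) +
       (q ^ 2) ^ k * (q ^ (k * k) * f (replicate k xb @ replicate k xc))))"
    unfolding step by (intro sum.cong refl) (simp add: algebra_simps power_add power_mult[symmetric] mult_2 mult_2_right)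
  also have "\<dots> = (\<Sum>k\<le>Suc n. qbin (q ^ 2) (Suc n) k * (q ^ (k * k) * f (replicate k xb @ replicate k xc)))"
    by (rule sum_atMost_Suc_pascal[symmetric])
  finally show ?case .
qed simp

section \<open>Functionals on the quotient at a root of unity\<close>

locale root_of_unity =
  fixes q :: "'k::field" and N :: nat
  assumes N: "N > 1" and oddN: "odd N" and qN: "q ^ N = 1"
    and prim: "\<And>m. 0 < m \<Longrightarrow> m < N \<Longrightarrow> q ^ m \<noteq> 1"
begin

lemma q0 [simp]: "q \<noteq> 0"
  using qN N by (metis power_0_left not_one_less_zero zero_neq_one)

lemma q_power_eq_1: "q ^ n = 1 \<longleftrightarrow> N dvd n"
proof
  assume "q ^ n = 1"
  moreover have "q ^ n = (q ^ N) ^ (n div N) * q ^ (n mod N)"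
    by (simp only: power_mult[symmetric] power_add[symmetric]) simp
  ultimately have "q ^ (n mod N) = 1" by (simp add: qN)
  then show "N dvd n" using prim[of "n mod N"] N by fastforce
qed (auto simp: power_mult qN elim!: dvdE)

lemma q2_primitive: "(q ^ 2) ^ N = 1" "0 < m \<Longrightarrow> m < N \<Longrightarrow> (q ^ 2) ^ m \<noteq> 1"
proof -
  show "(q ^ 2) ^ N = 1" by (metis power_commutes power_mult qN power_one mult.commute)
  show "(q ^ 2) ^ m \<noteq> 1" if "0 < m" "m < N"
  proof
    assume "(q ^ 2) ^ m = 1"
    then have "N dvd 2 * m" using q_power_eq_1[of "2 * m"] by (simp add: power_mult)
    then have "N dvd m" using oddN by (simp add: coprime_dvd_mult_right_iff)
    then show False using that by (auto dest: dvd_imp_le)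
  qed
qed

lemma iq2_primitive: "(inverse q ^ 2) ^ N = 1" "0 < m \<Longrightarrow> m < N \<Longrightarrow> (inverse q ^ 2) ^ m \<noteq> 1"
  using q2_primitive by (simp_all add: power_inverse)

lemma q2_neq_1: "q * q \<noteq> 1"
  using q2_primitive(2)[of 1] N by (simp add: power2_eq_square)

lemma N3: "N \<ge> 3"
  using N oddN by (cases "N = 2") auto

lemma q4_neq_1: "q * (q * (q * q)) \<noteq> 1"
  using q2_primitive(2)[of 2] N3 by (simp add: power2_eq_square mult_ac)

text \<open>
  At the root of unity only the outer terms survive: the powers \<open>x\<^sub>i\<^sub>j\<^sup>N\<close> again span a matrix
  coalgebra. This is the comultiplicativity of the quantum Frobenius map.
\<close>

lemma wspl_power_N:
  assumes "annih2 (SLq2_rels q) b"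
  shows "(\<Sum>p\<in>wspl (replicate N (i, j)). b p) = (\<Sum>l\<in>UNIV. b (replicate N (i, l), replicate N (l, j)))"
  unfolding wspl_power[OF assms q0] using sum_qbin_root_of_unity[OF iq2_primitive] N
  by (subst sum_qbin_root_of_unity[OF iq2_primitive]) (simp_all add: sum_idx add.commute)

text \<open>
  Of the \<open>q\<close>-binomial expansion only the outer terms are left, so that the determinant of the matrix of
  the powers \<open>x\<^sub>i\<^sub>j\<^sup>N\<close> is one.
\<close>

lemma ad_power_N:
  assumes "annih (SLq2_rels q) f"
  shows "f (replicate N xa @ replicate N xd) = f [] + f (replicate N xb @ replicate N xc)"
  unfolding ad_power[OF assms q0] using N
  by (subst sum_qbin_root_of_unity[OF q2_primitive]) (simp_all add: power_mult qN)

definition rels where "rels = SLq2_rels q \<union> pow_rels N"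

lemma annih_rels: "annih rels f \<longleftrightarrow> annih (SLq2_rels q) f \<and> annih (pow_rels N) f"
  by (simp add: rels_def annih_Un)

lemma annih_relsD: "annih rels f \<Longrightarrow> annih (SLq2_rels q) f"
  by (simp add: annih_rels)

lemma annih_rels_pow: "annih rels f \<Longrightarrow> f (u @ replicate N (i, j) @ v) = (if i = j then f (u @ v) else 0)"
  unfolding annih_rels annih_pow_iff by blast

lemma annih_rels_pow0: "annih rels f \<Longrightarrow> f (replicate N (i, j)) = (if i = j then f [] else 0)"
  using annih_rels_pow[of f "[]" i j "[]"] by simp

lemma coideal_rels: "coideal rels"
  unfolding coideal_def
proof (intro conjI allI impI)
  show "annih rels wcounit"
    using N by (auto simp: annih_rels annih_SLq2_iff annih_pow_iff wcounit_replicate algebra_simps)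
next
  fix b assume b: "annih2 rels b"
  show "annih rels (\<lambda>w. \<Sum>p\<in>wspl w. b p)"
  proof (rule annih_comult_on_generators[OF _ b])
    fix r and b :: "word \<times> word \<Rightarrow> 'k" assume r: "r \<in> rels" and b: "annih2 rels b"
    have b2: "annih2 (SLq2_rels q) b" by (rule annih2_mono[OF b]) (simp add: rels_def)
    from r consider "r \<in> SLq2_rels q" | i j where "r = gen i j ^ N - (if i = j then 1 else 0)"
      by (auto simp: rels_def pow_rels_def)
    then show "ev r (\<lambda>w. \<Sum>p\<in>wspl w. b p) = 0"
    proof cases
      case 1
      then show ?thesis using annih_SLq2_comult[OF q0 _ b2] by blast
    next
      case 2
      show ?thesis unfolding 2 gen_power
        using annih_rels_pow0[OF annih2_slice(1)[OF b]] annih_rels_pow0[OF annih2_slice(2)[OF b]]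
        by (simp add: wspl_power_N[OF b2] sum_idx) (metis idx.exhaust)
    qed
  qed
qed

text \<open>
  The eigenvalues of the group-like element \<open>K\<close> of \<open>u\<^sub>q(sl(2))\<close> on the two-dimensional comodule;
  \<open>weight\<close> below is \<open>K\<close> itself, as a character of the quotient.
\<close>

definition eigen :: "idx \<Rightarrow> 'k" where
  "eigen i = (if i = I1 then q else inverse q)"

lemma kap0 [simp]: "eigen i \<noteq> 0"
  by (simp add: eigen_def)

fun weight :: "word \<Rightarrow> 'k" where
  "weight [] = 1"
| "weight ((i, j) # w) = (if i = j then eigen i * weight w else 0)"

lemma weight_append: "weight (u @ v) = weight u * weight v"
  by (induction u rule: weight.induct) auto

lemma weight_replicate: "weight (replicate n (i, j)) = (if i = j \<or> n = 0 then eigen i ^ n else 0)"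
  by (induction n) auto

lemma eigen_N: "eigen i ^ N = 1"
  by (simp add: eigen_def qN power_inverse)

lemma annih_weight: "annih rels weight"
  using N by (auto simp: annih_rels annih_SLq2_iff annih_pow_iff weight_append weight_replicate eigen_N)
    (simp_all add: eigen_def)

text \<open>
  A representation of the free algebra on sequences: the off-diagonal generator \<open>g\<close> shifts, the other
  one acts by zero, and the diagonal generators act by powers of the eigenvalues of \<open>K\<close>. It
  factors through the quotient of \<open>O(SL\<^sub>q(2))\<close> by the other off-diagonal generator, which is the
  coordinate algebra of a Borel subgroup.
\<close>

fun act :: "idx \<times> idx \<Rightarrow> idx \<times> idx \<Rightarrow> (nat \<Rightarrow> 'k) \<Rightarrow> nat \<Rightarrow> 'k" where
  "act g (i, j) f n = (if i = j then eigen i ^ n * f n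
     else if (i, j) = g then (case n of 0 \<Rightarrow> 0 | Suc m \<Rightarrow> f m) else 0)"

definition acts :: "idx \<times> idx \<Rightarrow> word \<Rightarrow> (nat \<Rightarrow> 'k) \<Rightarrow> nat \<Rightarrow> 'k" where
  "acts g w f = foldr (act g) w f"

lemma acts_simps [simp]:
  "acts g [] f = f" "acts g (h # w) f = act g h (acts g w f)"
  "acts g (u @ v) f = acts g u (acts g v f)"
  by (auto simp: acts_def)

lemma acts_linear:
  "acts g w (\<lambda>n. f n + f' n) n = acts g w f n + acts g w f' n"
  "acts g w (\<lambda>n. c * f n) n = c * acts g w f n"
  "acts g w (\<lambda>n. 0) n = 0"
  by (induction w arbitrary: n) (auto simp: algebra_simps split: nat.splits)

text \<open>
  The \<open>N\<close>-th power of a shift is not zero, but its values vanish below \<open>N\<close>. Words preserve the sequences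
  that vanish below \<open>N\<close>, so that the relation \<open>g\<^sup>N = 0\<close> holds modulo these sequences.
\<close>

lemma acts_vanish: "(\<And>m. m < N \<Longrightarrow> f m = 0) \<Longrightarrow> n < N \<Longrightarrow> acts g w f n = 0"
  by (induction w arbitrary: n) (auto split: nat.splits)

lemma acts_power:
  "acts g (replicate k (i, j)) f n = (if i = j then eigen i ^ (k * n) * f n
     else if (i, j) = g then (if n < k then 0 else f (n - k)) else if k = 0 then f n else 0)"
  by (induction k arbitrary: n) (auto simp: power_add power_mult algebra_simps split: nat.splits)

lemma annih_acts:
  assumes "fst g \<noteq> snd g" "n < N"
  shows "annih rels (\<lambda>w. acts g w f n)"
  unfolding annih_rels
proof
  have g: "g = xb \<or> g = xc" using assms(1) by (cases g) (metis fst_conv idx.exhaust snd_conv)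
  have "act g xa (act g xb h) = (\<lambda>n. q * act g xb (act g xa h) n)"
    "act g xa (act g xc h) = (\<lambda>n. q * act g xc (act g xa h) n)"
    "act g xb (act g xd h) = (\<lambda>n. q * act g xd (act g xb h) n)"
    "act g xc (act g xd h) = (\<lambda>n. q * act g xd (act g xc h) n)"
    "act g xb (act g xc h) = (\<lambda>n. 0)" "act g xc (act g xb h) = (\<lambda>n. 0)"
    "act g xa (act g xd h) = h" "act g xd (act g xa h) = h" for h
    using g by (auto simp: eigen_def power_inverse split: nat.splits)
  then show "annih (SLq2_rels q) (\<lambda>w. acts g w f n)"
    unfolding annih_SLq2_iff by (simp add: acts_linear del: act.simps)
  show "annih (pow_rels N) (\<lambda>w. acts g w f n)"
    unfolding annih_pow_iff
  proof (intro allI)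
    fix u v i j
    show "acts g (u @ replicate N (i, j) @ v) f n = (if i = j then acts g (u @ v) f n else 0)"
    proof (cases "i = j")
      case True
      have "acts g (replicate N (i, j)) h = h" for h
        using True by (intro ext) (simp add: acts_power power_mult eigen_N)
      then show ?thesis using True by simp
    next
      case False
      have "acts g u (acts g (replicate N (i, j)) (acts g v f)) n = 0"
        by (rule acts_vanish[OF _ assms(2)]) (use False N in \<open>auto simp: acts_power\<close>)
      then show ?thesis using False by simp
    qed
  qed
qed

text \<open>
  The matrix coefficients from the basis vector \<open>0\<close> to the basis vector \<open>n\<close>. For \<open>n < N\<close> these are, up
  to non-zero factors, the powers \<open>E\<^sup>n\<close> and \<open>F\<^sup>n\<close> in \<open>u\<^sub>q(sl(2))\<close>, as functionals on its dual. For
  \<open>n = 1\<close> one obtains \<open>E\<close> and \<open>F\<close>, which are skew derivations with respect to \<open>K\<close> and \<open>\<epsilon>\<close>.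
\<close>

definition divpow :: "idx \<Rightarrow> idx \<Rightarrow> nat \<Rightarrow> word \<Rightarrow> 'k" where
  "divpow p r n w = acts (p, r) w (\<lambda>j. if j = 0 then 1 else 0) n"

lemma annih_divpow: "p \<noteq> r \<Longrightarrow> n < N \<Longrightarrow> annih rels (divpow p r n)"
  using annih_acts[of "(p, r)" n] by (simp add: divpow_def[abs_def])

lemma divpow_0: "p \<noteq> r \<Longrightarrow> divpow p r 0 w = wcounit w"
  by (induction w) (auto simp: divpow_def)

lemma divpow_Cons:
  "divpow p r n ((i, j) # w) = (if i = j then eigen i ^ n * divpow p r n w
    else if (i, j) = (p, r) then (case n of 0 \<Rightarrow> 0 | Suc m \<Rightarrow> divpow p r m w) else 0)"
  by (cases n) (simp_all add: divpow_def)

lemma divpow_Nil: "divpow p r n [] = (if n = 0 then 1 else 0)"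
  by (simp add: divpow_def)

abbreviation "skew p r \<equiv> divpow p r (Suc 0)"

lemma annih_skew: "p \<noteq> r \<Longrightarrow> annih rels (skew p r)"
  using annih_divpow[of p r "Suc 0"] N by simp

lemma skew_Cons: "p \<noteq> r \<Longrightarrow> skew p r ((i, j) # w) =
    (if i = p \<and> j = r then wcounit w else 0) + (if i = j then eigen i * skew p r w else 0)"
  by (auto simp: divpow_Cons divpow_0)

text \<open>
  Convolution with a skew derivation is a twisted derivation, here split off at the first letter.
\<close>

lemma conv_skew_left:
  assumes "p \<noteq> r"
  shows "conv wspl (skew p r) f ((i, j) # w) =
    (if i = p then f ((r, j) # w) else 0) + eigen i * conv wspl (skew p r) (\<lambda>v. f ((i, j) # v)) w"
proof -
  have "conv wspl (skew p r) f ((i, j) # w) = (\<Sum>l\<in>UNIV.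
     (if i = p \<and> l = r then f ((l, j) # w) else 0) +
     (if i = l then eigen i * conv wspl (skew p r) (\<lambda>v. f ((l, j) # v)) w else 0))"
    unfolding conv_Cons skew_Cons[OF assms]
    by (intro sum.cong refl) (auto simp: conv_add_left conv_cmult_left)
  also have "\<dots> = (if i = p then f ((r, j) # w) else 0) + eigen i * conv wspl (skew p r) (\<lambda>v. f ((i, j) # v)) w"
    using assms by (cases i; cases p; cases r) (simp_all add: sum_idx)
  finally show ?thesis .
qed

lemma conv_skew_right:
  assumes "p \<noteq> r"
  shows "conv wspl f (skew p r) ((i, j) # w) =
    (if j = r then f ((i, p) # w) else 0) + eigen j * conv wspl (\<lambda>v. f ((i, j) # v)) (skew p r) w"
proof -
  have "conv wspl f (skew p r) ((i, j) # w) = (\<Sum>l\<in>UNIV.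
     (if l = p \<and> j = r then f ((i, l) # w) else 0) +
     (if l = j then eigen j * conv wspl (\<lambda>v. f ((i, l) # v)) (skew p r) w else 0))"
    unfolding conv_Cons skew_Cons[OF assms]
    by (intro sum.cong refl) (auto simp: conv_add_right conv_cmult_right)
  also have "\<dots> = (if j = r then f ((i, p) # w) else 0) + eigen j * conv wspl (\<lambda>v. f ((i, j) # v)) (skew p r) w"
    using assms by (cases j; cases p; cases r) (simp_all add: sum_idx)
  finally show ?thesis .
qed

lemma conv_weight_left:
  "conv wspl weight f ((i, j) # w) = eigen i * conv wspl weight (\<lambda>v. f ((i, j) # v)) w"
  unfolding conv_Cons by (cases i) (simp_all add: sum_idx conv_cmult_left)

lemma conv_weight_right:
  "conv wspl f weight ((i, j) # w) = eigen j * conv wspl (\<lambda>v. f ((i, j) # v)) weight w"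
  unfolding conv_Cons by (cases j) (simp_all add: sum_idx conv_cmult_right)

section \<open>Central functionals\<close>

text \<open>
  The laziness condition on a functional: convolution with \<open>m\<close> commutes with all functionals on the
  quotient. A functional on the quotient with this property is a central element of \<open>u\<^sub>q(sl(2))\<close>; but
  \<open>m\<close> is at first defined on the free algebra only.
\<close>

definition central :: "(word \<Rightarrow> 'k) \<Rightarrow> bool" where
  "central m \<longleftrightarrow> (\<forall>f. annih rels f \<longrightarrow> conv wspl m f = conv wspl f m)"

lemma centralD: "central m \<Longrightarrow> annih rels f \<Longrightarrow> conv wspl m f = conv wspl f m"
  by (simp add: central_def)

lemma central_skew:
  assumes "central m" "p \<noteq> r"
  shows "conv wspl m (skew p r) w = conv wspl (skew p r) m w"
  using centralD[OF assms(1) annih_skew[OF assms(2)]] by simp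

lemma central_weight: "central m \<Longrightarrow> conv wspl m weight w = conv wspl weight m w"
  using centralD[OF _ annih_weight] by simp

text \<open>
  The matrix of \<open>m\<close> on \<open>V \<otimes> V\<close>, with \<open>V\<close> the two-dimensional comodule, commutes with \<open>K\<close>, \<open>E\<close> and
  \<open>F\<close>. From \<open>K\<close> it is block diagonal, because \<open>q\<^sup>2\<close>, \<open>1\<close>, \<open>q\<^sup>-\<^sup>2\<close> are distinct. From \<open>E\<close> and \<open>F\<close> it acts
  by one scalar on the quantum symmetric square and preserves the complementary line of the
  quantum determinant.
\<close>

lemma central_degree2:
  assumes "central m"
  shows "m [xa, xb] = 0" "m [xb, xa] = 0" "m [xb, xb] = 0" "m [xa, xc] = 0" "m [xb, xd] = 0"
    "m [xc, xa] = 0" "m [xd, xb] = 0" "m [xc, xc] = 0" "m [xc, xd] = 0" "m [xd, xc] = 0"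
    "m [xc, xb] = m [xb, xc]" "m [xa, xd] = m [xa, xa] - inverse q * m [xb, xc]"
    "m [xd, xa] = m [xa, xa] - q * m [xb, xc]" "m [xd, xd] = m [xa, xa]"
proof -
  have K: "eigen i * eigen k * m [(i, j), (k, l)] = eigen j * eigen l * m [(i, j), (k, l)]" for i j k l
    using central_weight[OF assms, of "[(i, j), (k, l)]"]
    by (simp add: conv_weight_left conv_weight_right mult.assoc) metis
  show "m [xa, xb] = 0" "m [xb, xa] = 0" "m [xb, xb] = 0" "m [xa, xc] = 0" "m [xb, xd] = 0"
    "m [xc, xa] = 0" "m [xd, xb] = 0" "m [xc, xc] = 0" "m [xc, xd] = 0" "m [xd, xc] = 0"
    using K[of I1 I1 I1 I2] K[of I1 I1 I2 I1] K[of I1 I1 I2 I2] K[of I1 I2 I1 I1] K[of I1 I2 I2 I2]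
      K[of I2 I1 I1 I1] K[of I2 I2 I1 I2] K[of I2 I2 I1 I1] K[of I2 I2 I1 I2]
      K[of I2 I1 I2 I2] K[of I2 I2 I2 I1] K[of I1 I2 I1 I2] K[of I2 I1 I2 I1] K[of I1 I2 I1 I1]
      q2_neq_1 q4_neq_1
    by (auto simp: eigen_def field_simps)
  note E = central_skew[OF assms idx.distinct(1)]
  note F = central_skew[OF assms idx.distinct(2)]
  note s = conv_skew_left conv_skew_right divpow_Nil eigen_def
  have 1: "q * m [xa, xa] = q * m [xa, xd] + m [xc, xb]"
    using E[of "[xa, xb]"] by (simp add: s)
  have 2: "m [xa, xa] = q * m [xb, xc] + m [xd, xa]"
    using E[of "[xb, xa]"] by (simp add: s)
  have 3: "q * m [xa, xa] = q * m [xa, xd] + m [xb, xc]"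
    using F[of "[xa, xc]"] by (simp add: s add.commute)
  show "m [xc, xb] = m [xb, xc]" using 1 3 by simp
  show ad: "m [xa, xd] = m [xa, xa] - inverse q * m [xb, xc]" using 3 by (simp add: field_simps)
  show "m [xd, xa] = m [xa, xa] - q * m [xb, xc]" using 2 by (simp add: field_simps)
  show "m [xd, xd] = m [xa, xa]"
    using E[of "[xb, xd]"] ad by (simp add: s)
qed

text \<open>
  The eigenvalue of a central functional on the line of the quantum determinant in \<open>V \<otimes> V\<close>.
\<close>

definition qdet :: "(word \<Rightarrow> 'k) \<Rightarrow> 'k" where
  "qdet m = m [xa, xd] - q * m [xb, xc]"

lemma qdet_conv:
  assumes "central f" "central g"
  shows "qdet (conv wspl f g) = qdet f * qdet g"
  unfolding qdet_def conv_Cons sum_idx conv_Nil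
  by (simp add: central_degree2[OF assms(1)] central_degree2[OF assms(2)] field_simps)

lemma qdet_wcounit: "qdet wcounit = 1"
  by (simp add: qdet_def)

text \<open>
  If \<open>m\<close> acts by \<open>1\<close> on the line of the quantum determinant and by \<open>c\<close> on the symmetric square, then
  its matrix is \<open>c + (1 - c) P\<close> with \<open>P\<close> the projection onto that line. Multiplication by \<open>P\<close> maps a
  functional \<open>f\<close> to \<open>f(1) P\<close>, and both \<open>f\<close> and \<open>f(1) P\<close> satisfy the quadratic relations.
\<close>

lemma central_conv_quadratic:
  assumes m: "central m" "qdet m = 1" "m [] = 1" and f: "annih (SLq2_rels q) f" and r: "r \<in> SLq2_rels q"
  shows "ev r (conv wspl m f) = 0"
proof -
  have aa: "m [xa, xa] = 1 + (q + inverse q) * m [xb, xc]"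
    using m(2) unfolding qdet_def central_degree2[OF m(1)] by (simp add: algebra_simps)
  note f2 = SLq2_at0[OF f q0]
  obtain p where p: "inverse q = p" "p * q = 1" using left_inverse[OF q0] by blast
  have pq: "p * (q * z) = z" "q * (p * z) = z" "q * p = 1" for z
    using p(2) by (metis mult.assoc mult.commute mult_1)+
  have "\<forall>r\<in>SLq2_rels q. ev r (conv wspl m f) = 0"
    unfolding SLq2_rels_def Let_def gen_eq_wd ball_simps
    by (simp add: conv_Cons sum_idx central_degree2[OF m(1)] f2 m(3) aa p) (simp add: algebra_simps p pq)
  then show ?thesis using r by blast
qed

lemma central_annih_SLq2:
  assumes "pullback m = conv wspl2 (tens m m) s" "annih2 rels s" "central m" "qdet m = 1" "m [] = 1"
  shows "annih (SLq2_rels q) m"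
  by (rule annih_of_multiplicative[OF assms(1,2) coideal_rels])
    (blast intro: central_conv_quadratic assms annih_relsD)

lemma conv_power_N:
  assumes "annih (SLq2_rels q) f" "annih (SLq2_rels q) g"
  shows "conv wspl f g (replicate N (i, j)) = (\<Sum>l\<in>UNIV. f (replicate N (i, l)) * g (replicate N (l, j)))"
  using wspl_power_N[OF annih2_tens[OF assms], of i j]
  by (simp add: conv_def tens_def case_prod_beta)

lemma conv_skew_right_power:
  "p \<noteq> r \<Longrightarrow> j \<noteq> r \<Longrightarrow> conv wspl f (skew p r) (replicate n (i, j)) = 0"
  by (induction n arbitrary: f) (auto simp: conv_skew_right divpow_Nil)

lemma conv_skew_left_power:
  "p \<noteq> r \<Longrightarrow> i \<noteq> p \<Longrightarrow> conv wspl (skew p r) f (replicate n (i, j)) = 0"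
  by (induction n arbitrary: f) (auto simp: conv_skew_left divpow_Nil)

lemma SLq2_swap_rows:
  assumes "annih (SLq2_rels q) f" "p \<noteq> r"
  shows "f (u @ [(p, j), (r, j)] @ v) = eigen p * f (u @ [(r, j), (p, j)] @ v)"
  using assms(2) SLq2_at[OF assms(1) q0, of u v]
  by (cases p; cases r; cases j) (simp_all add: eigen_def)

text \<open>
  The twisted Leibniz rule produces \<open>n + 1\<close> terms, each with \<open>x\<^sub>r\<^sub>j\<close> in another place. Moving it to the
  front turns them into a geometric series.
\<close>

lemma conv_skew_left_power_diag:
  assumes "p \<noteq> r" "annih (SLq2_rels q) f"
  shows "conv wspl (skew p r) f (replicate (Suc n) (p, j)) =
    (\<Sum>k\<le>n. (eigen p ^ 2) ^ k) * f ((r, j) # replicate n (p, j))"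
  using assms(2)
proof (induction n arbitrary: f)
  case 0
  then show ?case using assms(1) by (simp add: conv_skew_left divpow_Nil)
next
  case (Suc n)
  have "conv wspl (skew p r) f (replicate (Suc (Suc n)) (p, j)) =
      f ((r, j) # replicate (Suc n) (p, j)) + eigen p * conv wspl (skew p r) (\<lambda>v. f ((p, j) # v)) (replicate (Suc n) (p, j))"
    using assms(1) by (subst replicate_Suc) (simp add: conv_skew_left del: replicate_Suc)
  also have "\<dots> = f ((r, j) # replicate (Suc n) (p, j)) + eigen p * ((\<Sum>k\<le>n. (eigen p ^ 2) ^ k) *
      f ((p, j) # (r, j) # replicate n (p, j)))"
    using Suc.IH[OF annih_Cons[OF Suc.prems]] by simp
  also have "f ((p, j) # (r, j) # replicate n (p, j)) = eigen p * f ((r, j) # replicate (Suc n) (p, j))"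
    using SLq2_swap_rows[OF Suc.prems assms(1), of "[]"] by simp
  also have "f ((r, j) # replicate (Suc n) (p, j)) + eigen p * ((\<Sum>k\<le>n. (eigen p ^ 2) ^ k) *
      (eigen p * f ((r, j) # replicate (Suc n) (p, j)))) =
      (\<Sum>k\<le>Suc n. (eigen p ^ 2) ^ k) * f ((r, j) # replicate (Suc n) (p, j))"
    by (subst sum.atMost_Suc_shift) (simp add: algebra_simps power2_eq_square sum_distrib_left)
  finally show ?case .
qed

lemma geometric_eigen: "(\<Sum>k\<le>N - 2. (eigen p ^ 2) ^ k) = - inverse (eigen p ^ 2)"
proof -
  have k: "(eigen p ^ 2) ^ N = 1" "eigen p ^ 2 \<noteq> 1"
    using q2_primitive(1) iq2_primitive(1) q2_primitive(2)[of 1] iq2_primitive(2)[of 1] N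
    by (auto simp: eigen_def simp del: power_inverse)
  have "(1 - eigen p ^ 2) * (\<Sum>k\<le>N - 2. (eigen p ^ 2) ^ k) = 1 - (eigen p ^ 2) ^ Suc (N - 2)"
    by (rule sum_gp_basic)
  also have "(eigen p ^ 2) ^ Suc (N - 2) = inverse (eigen p ^ 2)"
    using k(1) N by (intro inverse_unique[symmetric]) (simp add: power_Suc[symmetric] Suc_diff_Suc numeral_2_eq_2 del: power_Suc)
  also have "1 - inverse (eigen p ^ 2) = (1 - eigen p ^ 2) * - inverse (eigen p ^ 2)"
    by (simp add: field_simps)
  finally show ?thesis using k(2) by (metis mult_left_cancel right_minus_eq)
qed

text \<open>
  With \<open>E\<close> or \<open>F\<close> on the right, the word \<open>x\<^sub>i\<^sub>i x\<^sub>i\<^sub>p\<^sup>N\<^sup>-\<^sup>1\<close> yields \<open>m(x\<^sub>i\<^sub>p\<^sup>N)\<close>. With it on the left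
  it yields zero, because no letter of the word lies in the row on which the skew derivation
  acts.
\<close>

lemma central_power_offdiag:
  assumes m: "central m" and "i \<noteq> p"
  shows "m (replicate N (i, p)) = 0"
proof -
  obtain n where n: "N = Suc n" using N by (cases N) auto
  have "m (replicate N (i, p)) = conv wspl m (skew p i) ((i, i) # replicate n (i, p))"
    using assms(2) by (simp add: n conv_skew_right conv_skew_right_power)
  also have "\<dots> = conv wspl (skew p i) m ((i, i) # replicate n (i, p))"
    by (rule central_skew[OF m]) (use assms(2) in simp)
  also have "\<dots> = 0"
    using assms(2) by (simp add: conv_skew_left conv_skew_left_power)
  finally show ?thesis .
qed

text \<open>
  On the right the skew derivation maps \<open>x\<^sub>p\<^sub>r x\<^sub>p\<^sub>p\<^sup>N\<^sup>-\<^sup>1\<close> to \<open>x\<^sub>p\<^sub>p\<^sup>N\<close>. On the left it maps it, modulo the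
  relations, to a multiple of the quantum determinant times \<open>x\<^sub>p\<^sub>p\<^sup>N\<^sup>-\<^sup>2\<close>, since the geometric series
  has \<open>N - 1\<close> terms. Behind this is that the comodule of homogeneous polynomials of degree
  \<open>N\<close> is a non-split extension of a simple comodule of dimension \<open>N - 1\<close> by two trivial ones.
\<close>

lemma central_power_diag:
  assumes m: "central m" "annih (SLq2_rels q) m"
  shows "m (replicate N (p, p)) = m (replicate (N - 2) (p, p))"
proof -
  obtain r where r: "p \<noteq> r" by (cases p) auto
  define n where "n = N - 2"
  have n: "N = Suc (Suc n)" using N by (simp add: n_def)
  let ?w = "replicate n (p, p)"
  have "m (replicate N (p, p)) = conv wspl m (skew p r) ((p, r) # replicate (Suc n) (p, p))"
    using r by (simp add: conv_skew_right conv_skew_right_power n del: replicate_Suc) simp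
  also have "\<dots> = conv wspl (skew p r) m ((p, r) # replicate (Suc n) (p, p))"
    by (rule central_skew[OF m(1) r])
  also have "\<dots> = m ((r, r) # replicate (Suc n) (p, p)) +
      eigen p * ((\<Sum>k\<le>n. (eigen p ^ 2) ^ k) * m ((p, r) # (r, p) # ?w))"
    using r conv_skew_left_power_diag[OF r annih_Cons[OF m(2)], of "(p, r)" n p]
    by (simp add: conv_skew_left del: replicate_Suc)
  also have "\<dots> = m ((r, r) # (p, p) # ?w) - inverse (eigen p) * m ((p, r) # (r, p) # ?w)"
    using geometric_eigen[of p] by (simp add: n_def power2_eq_square)
  also have "\<dots> = m ?w"
    using r SLq2_at[OF m(2) q0, of "[]" ?w] by (cases p; cases r) (simp_all add: eigen_def)
  finally show ?thesis by (simp add: n_def)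
qed

text \<open>
  A word of length at most \<open>n\<close> reaches the basis vector \<open>n\<close> only by shifting at every letter.
\<close>

lemma divpow_length:
  assumes "p \<noteq> r" "length w \<le> n"
  shows "divpow p r n w = (if w = replicate n (p, r) then 1 else 0)"
  using assms(2)
proof (induction w arbitrary: n)
  case (Cons g w)
  obtain i j where g: "g = (i, j)" by force
  obtain n' where n': "n = Suc n'" using Cons.prems by (cases n) auto
  have "w \<noteq> replicate n (p, r)" using Cons.prems by auto
  then show ?case using Cons assms(1) by (auto simp: g n' divpow_Cons)
qed (simp add: divpow_Nil)

text \<open>
  A central functional acts by one scalar on a simple comodule. Concretely, a multiple of \<open>F\<^sup>n\<close>
  connects the highest with the lowest weight vector: evaluated at \<open>x\<^sub>2\<^sub>1\<^sup>n\<close>, its two convolutions with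
  \<open>m\<close> are the two sides.
\<close>

lemma central_highest_eq_lowest:
  assumes m: "central m" and "n < N"
  shows "m (replicate n xa) = m (replicate n xd)"
proof -
  let ?w = "replicate n xc"
  have G: "divpow I2 I1 n v = (if v = replicate n xc then 1 else 0)" if "length v = length ?w" for v
    using divpow_length[of I2 I1 v n] that by simp
  have "conv wspl m (divpow I2 I1 n) ?w = m (replicate n xd)"
    by (subst conv_cong_length[OF refl G]) (auto simp: conv_pick)
  moreover have "conv wspl (divpow I2 I1 n) m ?w = m (replicate n xa)"
    by (subst conv_cong_length[OF G refl]) (auto simp: conv_pick_left)
  ultimately show ?thesis using centralD[OF m annih_divpow[of I2 I1 n]] assms(2) by simp
qed

text \<open>
  On the matrix coalgebra of the \<open>N\<close>-th powers, a central functional that respects the quadratic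
  relations is a scalar matrix.
\<close>

lemma central_power:
  assumes "central m" "annih (SLq2_rels q) m"
  shows "m (replicate N (i, j)) = (if i = j then m (replicate N xa) else 0)"
  using central_power_offdiag[OF assms(1), of i j] central_power_diag[OF assms, of i]
    central_power_diag[OF assms, of I1] central_highest_eq_lowest[OF assms(1), of "N - 2"] N
  by (cases i) auto

text \<open>
  On the \<open>N\<close>-th powers convolution is the product of \<open>2 \<times> 2\<close> matrices, and the matrix of \<open>m\<close> is the
  identity as soon as one of its diagonal entries is one. So \<open>m * f\<close> satisfies the same relations
  as \<open>f\<close>.
\<close>

lemma central_annih_rels:
  assumes m: "pullback m = conv wspl2 (tens m m) s" "annih2 rels s" "central m" "qdet m = 1" "m [] = 1"
    and 1: "m (replicate N xa) = 1"
  shows "annih rels m"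
proof -
  have q: "annih (SLq2_rels q) m" by (rule central_annih_SLq2[OF m])
  have "annih (pow_rels N) m"
  proof (rule annih_of_multiplicative[OF m(1,2) coideal_rels])
    fix f and r :: "'k mat_free" assume f: "annih rels f" and r: "r \<in> pow_rels N"
    then obtain i j where r: "r = gen i j ^ N - (if i = j then 1 else 0)" by (auto simp: pow_rels_def)
    have m_power: "m (replicate N (i, j)) = (if i = j then 1 else 0)" for i j
      using central_power[OF m(3) q, of i j] 1 by simp
    show "ev r (conv wspl m f) = 0"
      unfolding r gen_power using m_power annih_rels_pow0[OF f] m(5)
      by (cases i; cases j) (simp_all add: conv_power_N[OF q annih_relsD[OF f]] sum_idx)
  qed
  then show ?thesis using q by (simp add: annih_rels)
qed

text \<open>
  The matrix of \<open>m\<close> on the \<open>N\<close>-th powers is a scalar matrix, and \<open>m\<close> is multiplicative on products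
  that start with an \<open>N\<close>-th power. So the determinant relation for these powers says that the square
  of the scalar is one.
\<close>

lemma central_power_square:
  assumes m: "pullback m = conv wspl2 (tens m m) s" "annih2 rels s" "central m" "qdet m = 1" "m [] = 1"
    and s: "\<And>v. s ([], v) = wcounit v"
  shows "m (replicate N xa) ^ 2 = 1"
proof -
  have q: "annih (SLq2_rels q) m" by (rule central_annih_SLq2[OF m])
  have *: "m (replicate N (i, j) @ v) = m (replicate N (i, j)) * m v" for i j v
  proof -
    have "m (replicate N (i, j) @ v) = conv wspl2 (tens m m) s (replicate N (i, j), v)"
      using m(1) by (metis pullback_Pair)
    also have "\<dots> = (\<Sum>(v1, v2)\<in>wspl v. m v1 * conv wspl m (\<lambda>x. s (x, v2)) (replicate N (i, j)))"
      by (rule conv_pspl_slices)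
    also have "(\<lambda>v2. conv wspl m (\<lambda>x. s (x, v2)) (replicate N (i, j))) = (\<lambda>v2. m (replicate N (i, j)) * wcounit v2)"
      using annih_rels_pow0[OF annih2_slice(1)[OF m(2)]] s
      by (cases j) (simp_all add: conv_power_N[OF q annih_relsD[OF annih2_slice(1)[OF m(2)]]] sum_idx)
    also have "(\<Sum>(v1, v2)\<in>wspl v. m v1 * (m (replicate N (i, j)) * wcounit v2)) = m (replicate N (i, j)) * conv wspl m wcounit v"
      unfolding conv_def sum_distrib_left by (simp add: case_prod_beta mult_ac)
    finally show ?thesis by simp
  qed
  show ?thesis
    using ad_power_N[OF q] m(5) central_power[OF m(3) q, of I2 I2] central_power[OF m(3) q, of I1 I2]
    by (simp add: * power2_eq_square)
qed

end

section \<open>Trivialising a lazy cocycle\<close>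

text \<open>
  The composite with the endomorphism of the free algebra that multiplies all generators by \<open>c\<close>.
\<close>

definition rescale :: "'k::field \<Rightarrow> (word \<Rightarrow> 'k) \<Rightarrow> word \<Rightarrow> 'k" where
  "rescale c f w = c ^ length w * f w"

lemma conv_rescale: "conv wspl (rescale c f) (rescale d g) = rescale (c * d) (conv wspl f g)"
proof
  fix w
  show "conv wspl (rescale c f) (rescale d g) w = rescale (c * d) (conv wspl f g) w"
    unfolding conv_def rescale_def sum_distrib_left
    by (rule sum.cong) (auto dest!: wspl_length simp: power_mult_distrib mult_ac)
qed

lemma rescale_1 [simp]: "rescale 1 f = f"
  by (auto simp: rescale_def)

lemma multiplicative_rescale:
  assumes "pullback m = conv wspl2 (tens m m) s"
  shows "pullback (rescale c m) = conv wspl2 (tens (rescale c m) (rescale c m)) s"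
proof (rule ext, clarify)
  fix x y
  have "pullback (rescale c m) (x, y) = c ^ (length x + length y) * conv wspl2 (tens m m) s (x, y)"
    using fun_cong[OF assms, of "(x, y)"] by (simp add: rescale_def)
  also have "\<dots> = conv wspl2 (tens (rescale c m) (rescale c m)) s (x, y)"
    unfolding conv_pspl sum_distrib_left case_prod_beta
    by (intro sum.cong refl) (auto dest!: wspl_length simp: power_add rescale_def)
  finally show "pullback (rescale c m) (x, y) = conv wspl2 (tens (rescale c m) (rescale c m)) s (x, y)" .
qed

text \<open>
  For a cocycle \<open>s\<close> the product \<open>x \<cdot> y = \<Sum> s(x\<^sub>1, y\<^sub>1) x\<^sub>2 y\<^sub>2\<close> on the free algebra is associative. The
  algebra map into it that fixes the generators is colinear, hence of the form
  \<open>x \<mapsto> \<Sum> m(x\<^sub>1) x\<^sub>2\<close>. The recursion computes \<open>m\<close> from the product with the first letter; the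
  argument \<open>n\<close> is the length of the word. The inverse \<open>trivialiser_inv\<close> of \<open>m\<close> is computed from the
  inverse \<open>t\<close> of \<open>s\<close> in the opposite order, as for a product of matrices.
\<close>

primrec trivialiser_rec :: "(word \<times> word \<Rightarrow> 'k::field) \<Rightarrow> nat \<Rightarrow> word \<Rightarrow> 'k" where
  "trivialiser_rec s 0 w = 1"
| "trivialiser_rec s (Suc n) w = conv wspl (trivialiser_rec s n) (\<lambda>v. s ([hd w], v)) (tl w)"

definition trivialiser :: "(word \<times> word \<Rightarrow> 'k::field) \<Rightarrow> word \<Rightarrow> 'k" where
  "trivialiser s w = trivialiser_rec s (length w) w"

primrec trivialiser_inv_rec :: "(word \<times> word \<Rightarrow> 'k::field) \<Rightarrow> nat \<Rightarrow> word \<Rightarrow> 'k" where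
  "trivialiser_inv_rec t 0 w = 1"
| "trivialiser_inv_rec t (Suc n) w = conv wspl (\<lambda>u. t ([hd w], u)) (trivialiser_inv_rec t n) (tl w)"

definition trivialiser_inv :: "(word \<times> word \<Rightarrow> 'k::field) \<Rightarrow> word \<Rightarrow> 'k" where
  "trivialiser_inv t w = trivialiser_inv_rec t (length w) w"

lemma trivialiser_Nil [simp]: "trivialiser s [] = 1" and trivialiser_inv_Nil [simp]: "trivialiser_inv t [] = 1"
  by (simp_all add: trivialiser_def trivialiser_inv_def)

lemma trivialiser_Cons: "trivialiser s (g # w) = conv wspl (trivialiser s) (\<lambda>v. s ([g], v)) w"
  unfolding trivialiser_def by simp (rule conv_cong_length; simp)

lemma trivialiser_inv_Cons: "trivialiser_inv t (g # w) = conv wspl (\<lambda>u. t ([g], u)) (trivialiser_inv t) w"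
  unfolding trivialiser_inv_def by simp (rule conv_cong_length; simp)

text \<open>
  In matrices, with \<open>M\<^sub>n\<close> and \<open>S\<^sub>1\<^sub>,\<^sub>n\<close>, \<open>T\<^sub>1\<^sub>,\<^sub>n\<close> for the values on words: \<open>M\<^sub>n\<^sub>+\<^sub>1 = (1 \<otimes> M\<^sub>n) S\<^sub>1\<^sub>,\<^sub>n\<close>, and the
  candidate for the inverse is \<open>T\<^sub>1\<^sub>,\<^sub>n (1 \<otimes> M\<^sub>n\<^sup>-\<^sup>1)\<close>.
\<close>

lemma trivialiser_right_inverse:
  assumes st: "conv wspl2 s t = tens wcounit wcounit"
  shows "conv wspl (trivialiser s) (trivialiser_inv t) = wcounit"
proof
  fix w show "conv wspl (trivialiser s) (trivialiser_inv t) w = wcounit w"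
  proof (induction w)
    case (Cons g w)
    obtain i j where g: "g = (i, j)" by force
    have 1: "(\<Sum>l\<in>UNIV. conv wspl (\<lambda>u. s ([(i, l)], u)) (\<lambda>v. t ([(l, j)], v)) u) = wcounit [(i, j)] * wcounit u" for u
    proof -
      have "conv wspl2 s t ([(i, j)], u) = wcounit [(i, j)] * wcounit u" unfolding st by simp
      then show ?thesis unfolding conv_pspl by (simp only: sum_wspl_Cons) (simp add: conv_def)
    qed
    have "conv wspl (trivialiser s) (trivialiser_inv t) (g # w) = (\<Sum>l\<in>UNIV.
        conv wspl (conv wspl (trivialiser s) (\<lambda>u. s ([(i, l)], u))) (conv wspl (\<lambda>v. t ([(l, j)], v)) (trivialiser_inv t)) w)"
      unfolding g conv_Cons trivialiser_Cons trivialiser_inv_Cons ..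
    also have "\<dots> = (\<Sum>l\<in>UNIV.
        conv wspl (trivialiser s) (conv wspl (conv wspl (\<lambda>u. s ([(i, l)], u)) (\<lambda>v. t ([(l, j)], v))) (trivialiser_inv t)) w)"
      unfolding W1.conv_assoc ..
    also have "\<dots> = conv wspl (trivialiser s) (conv wspl
        (\<lambda>u. \<Sum>l\<in>UNIV. conv wspl (\<lambda>u. s ([(i, l)], u)) (\<lambda>v. t ([(l, j)], v)) u) (trivialiser_inv t)) w"
      unfolding conv_sum_right[symmetric] by (intro arg_cong[of _ _ "\<lambda>f. conv wspl (trivialiser s) f w"] ext) (simp add: conv_sum_left)
    also have "\<dots> = wcounit [(i, j)] * conv wspl (trivialiser s) (conv wspl wcounit (trivialiser_inv t)) w"
      unfolding 1 by (simp only: conv_cmult_left[abs_def] conv_cmult_right)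
    finally show ?case using Cons by (simp add: g)
  qed simp
qed

lemma trivialiser_left_inverse:
  assumes ts: "conv wspl2 t s = tens wcounit wcounit"
  shows "conv wspl (trivialiser_inv t) (trivialiser s) = wcounit"
proof
  fix w show "conv wspl (trivialiser_inv t) (trivialiser s) w = wcounit w"
  proof (induction "length w" arbitrary: w)
    case (Suc n)
    then obtain i j w' where w: "w = (i, j) # w'" "length w' = n" by (metis length_Suc_conv surj_pair)
    have IH: "conv wspl (trivialiser_inv t) (trivialiser s) v = wcounit v" if "length v = n" for v using Suc.hyps(1) that by metis
    have 1: "(\<Sum>l\<in>UNIV. conv wspl (\<lambda>u. t ([(i, l)], u)) (\<lambda>v. s ([(l, j)], v)) u) = wcounit [(i, j)] * wcounit u" for u
    proof -
      have "conv wspl2 t s ([(i, j)], u) = wcounit [(i, j)] * wcounit u" unfolding ts by simp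
      then show ?thesis unfolding conv_pspl by (simp only: sum_wspl_Cons) (simp add: conv_def)
    qed
    have "conv wspl (trivialiser_inv t) (trivialiser s) w = (\<Sum>l\<in>UNIV.
        conv wspl (conv wspl (\<lambda>u. t ([(i, l)], u)) (trivialiser_inv t)) (conv wspl (trivialiser s) (\<lambda>v. s ([(l, j)], v))) w')"
      unfolding w conv_Cons trivialiser_Cons trivialiser_inv_Cons ..
    also have "\<dots> = (\<Sum>l\<in>UNIV.
        conv wspl (\<lambda>u. t ([(i, l)], u)) (conv wspl (conv wspl (trivialiser_inv t) (trivialiser s)) (\<lambda>v. s ([(l, j)], v))) w')"
      unfolding W1.conv_assoc ..
    also have "\<dots> = (\<Sum>l\<in>UNIV.
        conv wspl (\<lambda>u. t ([(i, l)], u)) (conv wspl wcounit (\<lambda>v. s ([(l, j)], v))) w')"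
      by (intro sum.cong refl conv_cong_length) (use w IH in auto)
    finally show ?case using 1[of w'] by (simp add: w)
  qed simp
qed

text \<open>
  Every cocycle on the free algebra is a coboundary. By induction on the first word, the cocycle
  condition for a letter and two words moves the first letter across.
\<close>

lemma trivialiser_multiplicative:
  assumes cocycle: "\<And>x y z. conv wspl2 s (\<lambda>(x, y). s (x @ y, z)) (x, y) = conv wspl2 s (\<lambda>(y, z). s (x, y @ z)) (y, z)"
    and unit: "\<And>y. s ([], y) = wcounit y"
  shows "pullback (trivialiser s) = conv wspl2 (tens (trivialiser s) (trivialiser s)) s"
proof (rule ext, clarify)
  let ?m = "trivialiser s"
  fix x y
  show "pullback ?m (x, y) = conv wspl2 (tens ?m ?m) s (x, y)"
  proof (induction "length x" arbitrary: x y)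
    case 0
    have "conv wspl2 (tens ?m ?m) s ([], y) = conv wspl ?m (\<lambda>v. s ([], v)) y"
      by (simp add: conv_pspl_slices(2))
    then show ?case using 0 unit by simp
  next
    case (Suc n)
    then obtain i j x' where x: "x = (i, j) # x'" "length x' = n" by (metis length_Suc_conv surj_pair)
    have IH: "pullback ?m (u, v) = conv wspl2 (tens ?m ?m) s (u, v)" if "length u = n" for u v
      using Suc.hyps(1) that by metis
    \<comment> \<open>both sides of the cocycle identity for the first letter, \<open>r\<close> and \<open>f\<close>\<close>
    define K where "K = (\<lambda>r f. \<Sum>l\<in>UNIV. conv wspl (\<lambda>u. s ([(i, l)], u)) (\<lambda>v. s ((l, j) # v, f)) r)"
    have K: "conv wspl2 s (pullback (\<lambda>v. s ([(i, j)], v))) (r, f) = K r f" for r f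
    proof -
      have "conv wspl2 s (pullback (\<lambda>v. s ([(i, j)], v))) (r, f) = conv wspl2 s (\<lambda>(x, y). s (x @ y, f)) ([(i, j)], r)"
        unfolding cocycle by (simp add: pullback_def[abs_def] case_prod_beta')
      then show ?thesis unfolding conv_pspl K_def by (simp only: sum_wspl_Cons) (simp add: conv_def)
    qed
    have "pullback ?m (x, y) = conv wspl ?m (\<lambda>v. s ([(i, j)], v)) (x' @ y)"
      by (simp add: x trivialiser_Cons)
    also have "\<dots> = conv wspl2 (pullback ?m) (pullback (\<lambda>v. s ([(i, j)], v))) (x', y)"
      unfolding conv_pullback by simp
    also have "\<dots> = conv wspl2 (conv wspl2 (tens ?m ?m) s) (pullback (\<lambda>v. s ([(i, j)], v))) (x', y)"
      unfolding conv_pspl[of _ _ "pullback ?m"] conv_pspl[of _ _ "conv wspl2 (tens ?m ?m) s"]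
      by (intro sum.cong refl) (use x(2) IH in \<open>auto dest!: wspl_length\<close>)
    also have "\<dots> = (\<Sum>(y1, y2)\<in>wspl y. ?m y1 * conv wspl ?m (\<lambda>r. K r y2) x')"
      unfolding W2.conv_assoc conv_pspl_slices(1) K ..
    also have "(\<lambda>f. conv wspl ?m (\<lambda>r. K r f) x') = (\<lambda>f. conv wspl ?m (\<lambda>x. s (x, f)) x)"
      unfolding K_def conv_sum_right x conv_Cons trivialiser_Cons W1.conv_assoc ..
    also have "(\<Sum>(y1, y2)\<in>wspl y. ?m y1 * conv wspl ?m (\<lambda>x. s (x, y2)) x) = conv wspl2 (tens ?m ?m) s (x, y)"
      by (rule conv_pspl_slices(1)[symmetric])
    finally show ?case .
  qed
qed

context root_of_unity
begin

lemma central_rescale: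
  assumes "central m" shows "central (rescale c m)"
  unfolding central_def
proof (intro allI impI)
  fix f assume "annih rels f"
  then show "conv wspl (rescale c m) f = conv wspl f (rescale c m)"
    using conv_rescale[of c m 1 f] conv_rescale[of 1 f c m] centralD[OF assms] by simp
qed

lemma central_inverse:
  "central m \<Longrightarrow> conv wspl mi m = wcounit \<Longrightarrow> conv wspl m mi = wcounit \<Longrightarrow> central mi"
  unfolding central_def using W1.commute_inverse by metis

text \<open>
  \<open>m \<otimes> m\<close> is the convolution of \<open>m \<otimes> \<epsilon>\<close> and \<open>\<epsilon> \<otimes> m\<close>, and each of these commutes with a form on the
  quotient because \<open>m\<close> commutes with its slices.
\<close>

lemma central_tens_commute:
  assumes "central m" "annih2 rels b"
  shows "conv wspl2 (tens m m) b = conv wspl2 b (tens m m)"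
proof -
  have 1: "conv wspl2 (tens m wcounit) b = conv wspl2 b (tens m wcounit)"
  proof (rule ext, clarify)
    fix x y
    have "conv wspl2 (tens m wcounit) b (x, y) = conv wspl wcounit (\<lambda>v. conv wspl m (\<lambda>x. b (x, v)) x) y"
      unfolding conv_pspl_slices(1) unfolding conv_def ..
    also have "\<dots> = conv wspl (\<lambda>v. conv wspl (\<lambda>x. b (x, v)) m x) wcounit y"
      using centralD[OF assms(1) annih2_slice(1)[OF assms(2)]] by simp
    also have "\<dots> = conv wspl2 b (tens m wcounit) (x, y)"
      unfolding conv_pspl_slices'(1) unfolding conv_def ..
    finally show "conv wspl2 (tens m wcounit) b (x, y) = conv wspl2 b (tens m wcounit) (x, y)" .
  qed
  have 2: "conv wspl2 (tens wcounit m) b = conv wspl2 b (tens wcounit m)"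
  proof (rule ext, clarify)
    fix x y
    have "conv wspl2 (tens wcounit m) b (x, y) = conv wspl wcounit (\<lambda>v. conv wspl m (\<lambda>y. b (v, y)) y) x"
      unfolding conv_pspl_slices(2) unfolding conv_def ..
    also have "\<dots> = conv wspl (\<lambda>v. conv wspl (\<lambda>y. b (v, y)) m y) wcounit x"
      using centralD[OF assms(1) annih2_slice(2)[OF assms(2)]] by simp
    also have "\<dots> = conv wspl2 b (tens wcounit m) (x, y)"
      unfolding conv_pspl_slices'(2) unfolding conv_def ..
    finally show "conv wspl2 (tens wcounit m) b (x, y) = conv wspl2 b (tens wcounit m) (x, y)" .
  qed
  have t: "tens m m = conv wspl2 (tens m wcounit) (tens wcounit m)" by (simp add: conv_tens)
  show ?thesis unfolding t by (metis 1 2 W2.conv_assoc)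
qed

text \<open>
  Laziness of \<open>s\<close>, used for a letter and a word, moves a functional on the quotient past \<open>S\<^sub>1\<^sub>,\<^sub>n\<close> in
  \<open>M\<^sub>n\<^sub>+\<^sub>1 = (1 \<otimes> M\<^sub>n) S\<^sub>1\<^sub>,\<^sub>n\<close>. Fixing the letter leaves a functional on the quotient, which commutes with
  \<open>M\<^sub>n\<close> by induction.
\<close>

lemma trivialiser_central:
  assumes lazy: "\<And>f. annih rels f \<Longrightarrow> conv wspl2 s (pullback f) = conv wspl2 (pullback f) s"
  shows "central (trivialiser s)"
proof -
  have "conv wspl (trivialiser s) f w = conv wspl f (trivialiser s) w" if "annih rels f" for f w
    using that
  proof (induction "length w" arbitrary: w f)
    case (Suc n)
    then obtain i j w' where w: "w = (i, j) # w'" "length w' = n" by (metis length_Suc_conv surj_pair)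
    have IH: "conv wspl (trivialiser s) (\<lambda>v. f (g # v)) v = conv wspl (\<lambda>v. f (g # v)) (trivialiser s) v" if "length v = n" for v g
      using Suc.hyps(1)[OF _ annih_Cons[OF Suc.prems]] that by simp
    have lz: "(\<Sum>l\<in>UNIV. conv wspl (\<lambda>u. s ([(i, l)], u)) (\<lambda>v. f ((l, j) # v)) u) =
        (\<Sum>l\<in>UNIV. conv wspl (\<lambda>v. f ((i, l) # v)) (\<lambda>u. s ([(l, j)], u)) u)" for u
    proof -
      have "conv wspl2 s (pullback f) ([(i, j)], u) = conv wspl2 (pullback f) s ([(i, j)], u)"
        using lazy[OF Suc.prems] by simp
      then show ?thesis unfolding conv_pspl by (simp only: sum_wspl_Cons) (simp add: conv_def)
    qed
    have "conv wspl (trivialiser s) f w = (\<Sum>l\<in>UNIV. conv wspl (trivialiser s) (conv wspl (\<lambda>u. s ([(i, l)], u)) (\<lambda>v. f ((l, j) # v))) w')"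
      unfolding w conv_Cons trivialiser_Cons W1.conv_assoc ..
    also have "\<dots> = (\<Sum>l\<in>UNIV. conv wspl (trivialiser s) (conv wspl (\<lambda>v. f ((i, l) # v)) (\<lambda>u. s ([(l, j)], u))) w')"
      unfolding conv_sum_right[symmetric] lz ..
    also have "\<dots> = (\<Sum>l\<in>UNIV. conv wspl (conv wspl (trivialiser s) (\<lambda>v. f ((i, l) # v))) (\<lambda>u. s ([(l, j)], u)) w')"
      unfolding W1.conv_assoc ..
    also have "\<dots> = (\<Sum>l\<in>UNIV. conv wspl (conv wspl (\<lambda>v. f ((i, l) # v)) (trivialiser s)) (\<lambda>u. s ([(l, j)], u)) w')"
      by (rule sum.cong[OF refl], rule conv_cong_length) (use w IH in auto)
    also have "\<dots> = conv wspl f (trivialiser s) w"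
      unfolding w conv_Cons trivialiser_Cons W1.conv_assoc ..
    finally show ?case .
  qed simp
  then show ?thesis unfolding central_def by blast
qed

text \<open>
  Lazy functionals and lazy cocycles on the quotient, each together with its convolution inverse, in
  terms of words.
\<close>

definition lazy_pair :: "(word \<Rightarrow> 'k) \<Rightarrow> (word \<Rightarrow> 'k) \<Rightarrow> bool" where
  "lazy_pair m n \<longleftrightarrow> annih rels m \<and> annih rels n \<and> central m \<and> central n \<and> m [] = 1 \<and> n [] = 1 \<and>
     conv wspl m n = wcounit \<and> conv wspl n m = wcounit"

definition lazy_cocycle_pair :: "(word \<times> word \<Rightarrow> 'k) \<Rightarrow> (word \<times> word \<Rightarrow> 'k) \<Rightarrow> bool" where
  "lazy_cocycle_pair s t \<longleftrightarrow> annih2 rels s \<and> annih2 rels t \<and>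
     conv wspl2 s t = tens wcounit wcounit \<and> conv wspl2 t s = tens wcounit wcounit \<and>
     (\<forall>x. s (x, []) = wcounit x \<and> s ([], x) = wcounit x) \<and>
     (\<forall>x y z. conv wspl2 s (\<lambda>(x, y). s (x @ y, z)) (x, y) = conv wspl2 s (\<lambda>(y, z). s (x, y @ z)) (y, z)) \<and>
     (\<forall>f. annih rels f \<longrightarrow> conv wspl2 s (pullback f) = conv wspl2 (pullback f) s)"

text \<open>
  The coboundary \<open>\<partial>(m)\<close>, where \<open>n\<close> is the inverse of \<open>m\<close>.
\<close>

definition boundary :: "(word \<Rightarrow> 'k) \<Rightarrow> (word \<Rightarrow> 'k) \<Rightarrow> word \<times> word \<Rightarrow> 'k" where
  "boundary m n = conv wspl2 (tens m m) (pullback n)"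

text \<open>
  The trivialiser of \<open>s\<close> is central, and after rescaling it and its inverse descend to the quotient.
  Both the rescaled functional and its inverse are multiplicative, the first with respect to \<open>s\<close> and
  the second with respect to the inverse of \<open>s\<close>, so the descent criteria apply to both.
\<close>

theorem lazy_cocycle_is_boundary:
  assumes s: "lazy_cocycle_pair s t" and sqrt: "\<And>x :: 'k. \<exists>c. c ^ 2 = x"
  shows "\<exists>m n. lazy_pair m n \<and> s = boundary m n"
proof -
  from s have s: "annih2 rels s" "annih2 rels t"
    "conv wspl2 s t = tens wcounit wcounit" "conv wspl2 t s = tens wcounit wcounit"
    "\<And>x. s ([], x) = wcounit x"
    "\<And>x y z. conv wspl2 s (\<lambda>(x, y). s (x @ y, z)) (x, y) = conv wspl2 s (\<lambda>(y, z). s (x, y @ z)) (y, z)"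
    "\<And>f. annih rels f \<Longrightarrow> conv wspl2 s (pullback f) = conv wspl2 (pullback f) s"
    unfolding lazy_cocycle_pair_def by blast+
  note mult = trivialiser_multiplicative[of s, OF s(6,5)]
  note inv = trivialiser_right_inverse[OF s(3)] trivialiser_left_inverse[OF s(4)]
  note cen = trivialiser_central[OF s(7)]
  note ceni = central_inverse[OF cen inv(2,1)]
  have "qdet (trivialiser s) * qdet (trivialiser_inv t) = 1"
    using qdet_conv[OF cen ceni] qdet_wcounit inv by simp
  then have nz: "qdet (trivialiser s) \<noteq> 0" by auto
  \<comment> \<open>rescaling by \<open>c\<close> multiplies the eigenvalue on the quantum determinant by \<open>c\<^sup>2\<close>\<close>
  obtain c where c: "c ^ 2 = inverse (qdet (trivialiser s))" using sqrt by blast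
  have qdet_resc: "qdet (rescale d f) = d ^ 2 * qdet f" for d f
    by (simp add: qdet_def rescale_def power2_eq_square algebra_simps)
  have good: "qdet (rescale d (trivialiser s)) = 1" if "d ^ 2 = c ^ 2" for d
    unfolding qdet_resc that c using nz by simp
  have sq: "rescale c (trivialiser s) (replicate N xa) ^ 2 = 1"
    by (rule central_power_square[OF multiplicative_rescale[OF mult] s(1) central_rescale[OF cen] good _ s(5)])
      (simp_all add: rescale_def)
  \<comment> \<open>the remaining sign is corrected by \<open>- c\<close>, as \<open>N\<close> is odd\<close>
  define d where "d = (if rescale c (trivialiser s) (replicate N xa) = 1 then c else - c)"
  have d2: "d ^ 2 = c ^ 2" by (simp add: d_def)
  then have d0: "d \<noteq> 0" using c nz by auto
  define n where "n = rescale d (trivialiser s)"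
  define m where "m = rescale (inverse d) (trivialiser_inv t)"
  have nN: "n (replicate N xa) = 1"
    using sq oddN by (auto simp: n_def d_def rescale_def power2_eq_1_iff)
  have nm: "conv wspl n m = wcounit" "conv wspl m n = wcounit"
    using d0 by (simp_all add: n_def m_def conv_rescale inv)
  have cn: "central n" "central m"
    unfolding n_def m_def using cen ceni by (simp_all add: central_rescale)
  have n: "pullback n = conv wspl2 (tens n n) s" "qdet n = 1" "n [] = 1" "m [] = 1"
    using multiplicative_rescale[OF mult] good[OF d2] by (simp_all add: n_def m_def rescale_def[of _ _ "[]"])
  have an: "annih rels n"
    by (rule central_annih_rels[OF n(1) s(1) cn(1) n(2,3) nN])
  have tt: "conv wspl2 (tens n n) (tens m m) = tens wcounit wcounit" "conv wspl2 (tens m m) (tens n n) = tens wcounit wcounit"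
    by (simp_all add: conv_tens nm)
  have "pullback m = conv wspl2 t (tens m m)"
  proof (rule W2.inverse_unique)
    show "conv wspl2 (pullback m) (pullback n) = tens wcounit wcounit"
      by (simp add: conv_pullback nm)
    show "conv wspl2 (pullback n) (conv wspl2 t (tens m m)) = tens wcounit wcounit"
      unfolding n(1) by (metis W2.conv_assoc W2.conv_unit_right s(3) tt(1))
  qed
  then have pm: "pullback m = conv wspl2 (tens m m) t"
    using central_tens_commute[OF cn(2) s(2)] by simp
  have qm: "qdet m = 1" using qdet_conv[OF cn] nm n(2) qdet_wcounit by simp
  have mq: "annih (SLq2_rels q) m"
    by (rule central_annih_SLq2[OF pm s(2) cn(2) qm n(4)])
  have "conv wspl n m (replicate N xa) = m (replicate N xa)"
    unfolding conv_power_N[OF annih_relsD[OF an] mq] using nN annih_rels_pow0[OF an, of I1 I2] by (simp add: sum_idx)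
  then have "m (replicate N xa) = 1" by (simp add: nm wcounit_replicate)
  then have am: "annih rels m"
    by (rule central_annih_rels[OF pm s(2) cn(2) qm n(4)])
  have "s = boundary m n"
    unfolding boundary_def n(1) by (metis W2.conv_assoc W2.conv_unit_left tt(2))
  then show ?thesis using an am cn nm n unfolding lazy_pair_def by blast
qed

section \<open>Coboundaries of lazy functionals\<close>

lemma lazy_pair_unit: "lazy_pair wcounit wcounit"
  using coideal_counit[OF coideal_rels] by (simp add: lazy_pair_def central_def)

lemma lazy_pair_sym: "lazy_pair m n \<Longrightarrow> lazy_pair n m"
  by (auto simp: lazy_pair_def)

lemma central_conv: "central f \<Longrightarrow> central g \<Longrightarrow> central (conv wspl f g)"
  unfolding central_def by (metis W1.conv_assoc)

lemma lazy_pair_conv: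
  assumes "lazy_pair m n" "lazy_pair m' n'"
  shows "lazy_pair (conv wspl m m') (conv wspl n n')"
proof -
  have c: "conv wspl m m' = conv wspl m' m" "conv wspl n n' = conv wspl n' n"
    using assms centralD unfolding lazy_pair_def by blast+
  have "conv wspl (conv wspl m' m) (conv wspl n n') = wcounit"
    "conv wspl (conv wspl n' n) (conv wspl m m') = wcounit"
    using assms unfolding lazy_pair_def by (metis W1.conv_assoc W1.conv_unit_left)+
  then show ?thesis
    using assms c unfolding lazy_pair_def
    by (simp add: annih_conv[OF coideal_rels] central_conv)
qed

lemma central_tens_commute_pullback:
  assumes "lazy_pair m n" "annih rels f"
  shows "conv wspl2 (tens m m) (pullback f) = conv wspl2 (pullback f) (tens m m)"
  using assms central_tens_commute annih2_pullback unfolding lazy_pair_def by blast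

text \<open>
  The factor \<open>m' \<otimes> m'\<close> commutes with the pullback of \<open>n\<close>, which is a form on the quotient.
\<close>

lemma boundary_conv:
  assumes "lazy_pair m n" "lazy_pair m' n'"
  shows "conv wspl2 (boundary m n) (boundary m' n') = boundary (conv wspl m m') (conv wspl n n')"
proof -
  have "conv wspl2 (tens m' m') (pullback n) = conv wspl2 (pullback n) (tens m' m')"
    using central_tens_commute_pullback[OF assms(2)] assms(1) unfolding lazy_pair_def by blast
  then have "conv wspl2 (boundary m n) (boundary m' n') =
      conv wspl2 (conv wspl2 (tens m m) (tens m' m')) (conv wspl2 (pullback n) (pullback n'))"
    unfolding boundary_def by (metis W2.conv_assoc)
  then show ?thesis by (simp add: boundary_def conv_tens conv_pullback)
qed

lemma boundary_unit: "boundary wcounit wcounit = tens wcounit wcounit"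
  by (simp add: boundary_def)

text \<open>
  Either side equals \<open>\<Sum> m(x\<^sub>1) m(y\<^sub>1) m(z\<^sub>1) n(x\<^sub>2 y\<^sub>2 z\<^sub>2)\<close>, which is symmetric with respect to the two ways of
  bracketing: the inner factor \<open>n\<close> of the first form cancels the factor \<open>m\<close> of the second.
\<close>

lemma boundary_cocycle:
  assumes mn: "conv wspl n m = wcounit"
  shows "conv wspl2 (boundary m n) (\<lambda>(x, y). boundary m n (x @ y, z)) (x, y) =
         conv wspl2 (boundary m n) (\<lambda>(y, z). boundary m n (x, y @ z)) (y, z)"
proof -
  have can: "conv wspl n (conv wspl m f) = f" for f
    by (simp add: W1.conv_assoc[symmetric] mn)
  have 1: "conv wspl n (\<lambda>u. boundary m n (u, z)) = (\<lambda>u. \<Sum>(z1, z2)\<in>wspl z. m z1 * n (u @ z2))"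
    unfolding boundary_def conv_pspl_slices(1) case_prod_beta
    by (rule ext) (simp add: conv_sum_right conv_cmult_right can)
  have 2: "conv wspl n (\<lambda>v. boundary m n (x, v)) = (\<lambda>v. \<Sum>(x1, x2)\<in>wspl x. m x1 * n (x2 @ v))"
    unfolding boundary_def conv_pspl_slices(2) case_prod_beta
    by (rule ext) (simp add: conv_sum_right conv_cmult_right can)
  have "conv wspl2 (boundary m n) (\<lambda>(x, y). boundary m n (x @ y, z)) (x, y) =
      conv wspl2 (boundary m n) (pullback (\<lambda>u. boundary m n (u, z))) (x, y)"
    by (simp add: pullback_def[abs_def] case_prod_beta')
  also have "\<dots> = conv wspl2 (tens m m) (pullback (\<lambda>u. \<Sum>(z1, z2)\<in>wspl z. m z1 * n (u @ z2))) (x, y)"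
    unfolding boundary_def[of m n, symmetric] 1[symmetric] conv_pullback[symmetric] W2.conv_assoc[symmetric] by (simp add: boundary_def)
  also have "\<dots> = (\<Sum>(x1, x2)\<in>wspl x. \<Sum>(y1, y2)\<in>wspl y. \<Sum>(z1, z2)\<in>wspl z. m x1 * m y1 * m z1 * n (x2 @ y2 @ z2))"
    unfolding conv_pspl by (simp add: sum_distrib_left case_prod_beta mult_ac)
  also have "\<dots> = (\<Sum>(y1, y2)\<in>wspl y. \<Sum>(z1, z2)\<in>wspl z. \<Sum>(x1, x2)\<in>wspl x. m x1 * m y1 * m z1 * n (x2 @ y2 @ z2))"
    unfolding case_prod_beta by (subst sum.swap, rule sum.cong[OF refl], rule sum.swap)
  also have "\<dots> = conv wspl2 (tens m m) (pullback (\<lambda>v. \<Sum>(x1, x2)\<in>wspl x. m x1 * n (x2 @ v))) (y, z)"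
    unfolding conv_pspl by (simp add: sum_distrib_left case_prod_beta mult_ac)
  also have "\<dots> = conv wspl2 (boundary m n) (pullback (\<lambda>v. boundary m n (x, v))) (y, z)"
    unfolding 2[symmetric] conv_pullback[symmetric] W2.conv_assoc[symmetric] by (simp add: boundary_def)
  also have "\<dots> = conv wspl2 (boundary m n) (\<lambda>(y, z). boundary m n (x, y @ z)) (y, z)"
    by (simp add: pullback_def[abs_def] case_prod_beta')
  finally show ?thesis .
qed

lemma boundary_is_lazy_cocycle:
  assumes mn: "lazy_pair m n"
  shows "lazy_cocycle_pair (boundary m n) (boundary n m)"
proof -
  have *: "annih rels m" "annih rels n" "central m" "central n" "m [] = 1" "n [] = 1"
    "conv wspl m n = wcounit" "conv wspl n m = wcounit"
    using mn by (auto simp: lazy_pair_def)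
  have 1: "annih2 rels (boundary m n)" "annih2 rels (boundary n m)"
    unfolding boundary_def by (intro annih2_conv coideal_rels annih2_tens annih2_pullback *)+
  have 2: "conv wspl2 (boundary m n) (boundary n m) = tens wcounit wcounit"
    "conv wspl2 (boundary n m) (boundary m n) = tens wcounit wcounit"
    using boundary_conv[OF mn lazy_pair_sym[OF mn]] boundary_conv[OF lazy_pair_sym[OF mn] mn]
    by (simp_all add: * boundary_unit)
  have 3: "boundary m n (x, []) = wcounit x" "boundary m n ([], x) = wcounit x" for x
    unfolding boundary_def by (simp add: conv_pspl_slices(1) *) (simp add: conv_pspl_slices(2) *)
  have 4: "conv wspl2 (boundary m n) (pullback f) = conv wspl2 (pullback f) (boundary m n)" if f: "annih rels f" for f
  proof -
    have "conv wspl2 (boundary m n) (pullback f) = conv wspl2 (tens m m) (pullback (conv wspl f n))"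
      unfolding boundary_def W2.conv_assoc conv_pullback using centralD[OF *(4) f] by simp
    also have "\<dots> = conv wspl2 (conv wspl2 (tens m m) (pullback f)) (pullback n)"
      unfolding W2.conv_assoc conv_pullback ..
    also have "\<dots> = conv wspl2 (pullback f) (boundary m n)"
      unfolding central_tens_commute_pullback[OF mn f] boundary_def W2.conv_assoc ..
    finally show ?thesis .
  qed
  show ?thesis
    unfolding lazy_cocycle_pair_def using 1 2 3 4 boundary_cocycle[OF *(8)] by blast
qed

end

section \<open>Tensors as functionals on bilinear forms\<close>

interpretation free_space: vector_space "\<lambda>c :: 'k::field. Poly_Mapping.map ((*) c) :: ('x \<Rightarrow>\<^sub>0 'k) \<Rightarrow> _"
  by standard (auto intro!: poly_mapping_eqI simp: lookup_add distrib_left distrib_right mult.assoc)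

interpretation free_space_functional: vector_space_pair
  "\<lambda>c :: 'k::field. Poly_Mapping.map ((*) c) :: ('x \<Rightarrow>\<^sub>0 'k) \<Rightarrow> _" "(*) :: 'k \<Rightarrow> 'k \<Rightarrow> 'k"
  by standard (auto simp: algebra_simps)

text \<open>
  A basis of the span of \<open>S\<close>, extended by \<open>x\<close>, carries a linear functional that is one at \<open>x\<close> and zero
  on \<open>S\<close>. Functionals on a free vector space are given by functions on its basis.
\<close>

lemma separating_functional:
  fixes x :: "'x \<Rightarrow>\<^sub>0 'k::field"
  assumes "x \<notin> free_space.span S"
  shows "\<exists>f. (\<forall>y\<in>S. lin y f = 0) \<and> lin x f = 1"
proof -
  obtain B where B: "B \<subseteq> S" "free_space.independent B" "S \<subseteq> free_space.span B"
    using free_space.maximal_independent_subset by blast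
  then have span: "free_space.span S = free_space.span B"
    by (metis free_space.span_mono free_space.span_span subset_antisym)
  then have "free_space.independent (insert x B)"
    using B assms by (simp add: free_space.independent_insertI)
  then obtain g where g: "Vector_Spaces.linear (\<lambda>c. Poly_Mapping.map ((*) c)) (*) g"
    "\<forall>y\<in>insert x B. g y = (if y = x then 1 else 0)"
    using free_space_functional.linear_independent_extend[of "insert x B" "\<lambda>y. if y = x then 1 else 0"] by blast
  interpret g: Vector_Spaces.linear "\<lambda>c :: 'k. Poly_Mapping.map ((*) c)" "(*)" g by fact
  have lin: "lin y (\<lambda>p. g (Poly_Mapping.single p 1)) = g y" for y
  proof -
    have "g y = g (\<Sum>p\<in>Poly_Mapping.keys y. Poly_Mapping.map ((*) (Poly_Mapping.lookup y p)) (Poly_Mapping.single p 1))"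
      by (subst poly_mapping_decompose) simp
    then show ?thesis by (simp add: g.sum g.scale lin_def del: map_single)
  qed
  have "x \<notin> B" using assms B free_space.span_base span by blast
  then have gB: "g y = 0" if "y \<in> B" for y using g(2) that by auto
  have gS: "g y = 0" if "y \<in> S" for y
  proof -
    have "y \<in> free_space.span B" using that B(3) by (rule rev_subsetD)
    with gB show ?thesis by (rule g.eq_0_on_span)
  qed
  have "g x = 1" using g(2) by simp
  then show ?thesis using gS by (intro exI[of _ "\<lambda>p. g (Poly_Mapping.single p 1)"]) (simp add: lin)
qed

lemma lin_span:
  assumes "\<And>y. y \<in> S \<Longrightarrow> lin y f = 0" "x \<in> free_space.span S"
  shows "lin x f = 0"
  using assms(2) by (induction rule: free_space.span_induct_alt) (simp_all add: assms(1))

definition bilin :: "('k::field, 'a, 'm) module_scheme \<Rightarrow> ('k, 'b, 'n) module_scheme \<Rightarrow> ('a \<times> 'b \<Rightarrow> 'k) \<Rightarrow> bool" where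
  "bilin V W f \<longleftrightarrow>
    (\<forall>v\<in>carrier V. \<forall>v'\<in>carrier V. \<forall>w\<in>carrier W. f (v \<oplus>\<^bsub>V\<^esub> v', w) = f (v, w) + f (v', w)) \<and>
    (\<forall>v\<in>carrier V. \<forall>w\<in>carrier W. \<forall>w'\<in>carrier W. f (v, w \<oplus>\<^bsub>W\<^esub> w') = f (v, w) + f (v, w')) \<and>
    (\<forall>c. \<forall>v\<in>carrier V. \<forall>w\<in>carrier W. f (c \<odot>\<^bsub>V\<^esub> v, w) = c * f (v, w)) \<and>
    (\<forall>c. \<forall>v\<in>carrier V. \<forall>w\<in>carrier W. f (v, c \<odot>\<^bsub>W\<^esub> w) = c * f (v, w))"

lemma bilin_iff: "bilin V W f \<longleftrightarrow> (\<forall>r\<in>bilinear_rels V W. lin r f = 0)"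
proof
  assume "bilin V W f"
  then show "\<forall>r\<in>bilinear_rels V W. lin r f = 0"
    unfolding bilin_def bilinear_rels_def by auto
next
  assume *: "\<forall>r\<in>bilinear_rels V W. lin r f = 0"
  show "bilin V W f"
    unfolding bilin_def
  proof (intro conjI ballI allI)
    fix v v' w assume "v \<in> carrier V" "v' \<in> carrier V" "w \<in> carrier W"
    then have "Poly_Mapping.single (v \<oplus>\<^bsub>V\<^esub> v', w) 1 - Poly_Mapping.single (v, w) 1 - Poly_Mapping.single (v', w) 1
        \<in> bilinear_rels V W" unfolding bilinear_rels_def by blast
    with * show "f (v \<oplus>\<^bsub>V\<^esub> v', w) = f (v, w) + f (v', w)" by (force simp: algebra_simps)
  next
    fix v w w' assume "v \<in> carrier V" "w \<in> carrier W" "w' \<in> carrier W"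
    then have "Poly_Mapping.single (v, w \<oplus>\<^bsub>W\<^esub> w') 1 - Poly_Mapping.single (v, w) 1 - Poly_Mapping.single (v, w') 1
        \<in> bilinear_rels V W" unfolding bilinear_rels_def by blast
    with * show "f (v, w \<oplus>\<^bsub>W\<^esub> w') = f (v, w) + f (v, w')" by (force simp: algebra_simps)
  next
    fix c v w assume "v \<in> carrier V" "w \<in> carrier W"
    then have "Poly_Mapping.single (c \<odot>\<^bsub>V\<^esub> v, w) 1 - Poly_Mapping.single (v, w) c \<in> bilinear_rels V W"
      unfolding bilinear_rels_def by blast
    with * show "f (c \<odot>\<^bsub>V\<^esub> v, w) = c * f (v, w)" by force
  next
    fix c v w assume "v \<in> carrier V" "w \<in> carrier W"
    then have "Poly_Mapping.single (v, c \<odot>\<^bsub>W\<^esub> w) 1 - Poly_Mapping.single (v, w) c \<in> bilinear_rels V W"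
      unfolding bilinear_rels_def by blast
    with * show "f (v, c \<odot>\<^bsub>W\<^esub> w) = c * f (v, w)" by force
  qed
qed

text \<open>
  Tensors are determined by their values on bilinear forms: a formal sum lies in the span of the
  bilinearity relations iff it is annihilated by all functionals that annihilate these relations,
  and such functionals are the bilinear forms.
\<close>

lemma in_tensor_class:
  "s \<in> tensor_class V W t \<longleftrightarrow> Poly_Mapping.keys s \<subseteq> carrier V \<times> carrier W \<and>
     (\<forall>f. bilin V W f \<longrightarrow> lin s f = lin t f)"
proof -
  have "s - t \<in> free_space.span (bilinear_rels V W) \<longleftrightarrow> (\<forall>f. bilin V W f \<longrightarrow> lin s f = lin t f)"
  proof
    assume "s - t \<in> free_space.span (bilinear_rels V W)"
    then show "\<forall>f. bilin V W f \<longrightarrow> lin s f = lin t f"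
      using lin_span[of "bilinear_rels V W" _ "s - t"] by (auto simp: bilin_iff)
  next
    assume *: "\<forall>f. bilin V W f \<longrightarrow> lin s f = lin t f"
    show "s - t \<in> free_space.span (bilinear_rels V W)"
    proof (rule ccontr)
      assume "s - t \<notin> free_space.span (bilinear_rels V W)"
      from separating_functional[OF this] obtain f where
        "\<forall>y\<in>bilinear_rels V W. lin y f = 0" "lin (s - t) f = 1" by blast
      then show False using * by (auto simp: bilin_iff[symmetric])
    qed
  qed
  then show ?thesis by (simp add: tensor_class_def)
qed

lemma tensor_class_eqI:
  assumes "\<And>f. bilin V W f \<Longrightarrow> lin s f = lin t f"
  shows "tensor_class V W s = tensor_class V W t"
  using assms by (auto simp: in_tensor_class)

lemma the_elem_image_const:
  assumes "x \<in> A" "\<And>y. y \<in> A \<Longrightarrow> f y = f x"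
  shows "the_elem (f ` A) = f x"
proof -
  have "f ` A = (\<lambda>_. f x) ` A" by (rule image_cong[OF refl assms(2)])
  also have "\<dots> = {f x}" using assms(1) by blast
  finally show ?thesis by simp
qed

lemma tensor_form_class:
  assumes "Poly_Mapping.keys t \<subseteq> carrier V \<times> carrier W" "bilin V W (\<lambda>p. f (fst p) (snd p))"
  shows "tensor_form (tensor_class V W t) f = lin t (\<lambda>p. f (fst p) (snd p))"
  unfolding tensor_form_def lin_def[symmetric]
  by (rule the_elem_image_const) (use assms in \<open>auto simp: in_tensor_class\<close>)

text \<open>
  The image of a formal sum of pairs, so that \<open>push f g t\<close> represents \<open>(f \<otimes> g)(t)\<close>.
\<close>

definition push :: "('a \<Rightarrow> 'c) \<Rightarrow> ('b \<Rightarrow> 'd) \<Rightarrow> ('a \<times> 'b \<Rightarrow>\<^sub>0 'k::field) \<Rightarrow> ('c \<times> 'd \<Rightarrow>\<^sub>0 'k)" where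
  "push f g t = (\<Sum>p\<in>Poly_Mapping.keys t. Poly_Mapping.single (f (fst p), g (snd p)) (Poly_Mapping.lookup t p))"

lemma lin_push [simp]: "lin (push f g t) h = lin t (\<lambda>p. h (f (fst p), g (snd p)))"
  by (simp add: push_def lin_sum) (simp add: lin_def)

lemma keys_push: "Poly_Mapping.keys (push f g t) \<subseteq> (\<lambda>p. (f (fst p), g (snd p))) ` Poly_Mapping.keys t"
  unfolding push_def by (rule order.trans[OF keys_sum]) auto

lemma tensor_map_class:
  assumes t: "Poly_Mapping.keys t \<subseteq> carrier V \<times> carrier V'"
    and fg: "\<And>h. bilin W W' h \<Longrightarrow> bilin V V' (\<lambda>p. h (f (fst p), g (snd p)))"
  shows "tensor_map W W' f g (tensor_class V V' t) = tensor_class W W' (push f g t)"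
  unfolding tensor_map_def push_def[symmetric]
proof (rule the_elem_image_const)
  show "t \<in> tensor_class V V' t" using t by (simp add: in_tensor_class)
  fix s assume "s \<in> tensor_class V V' t"
  then show "tensor_class W W' (push f g s) = tensor_class W W' (push f g t)"
    by (intro tensor_class_eqI) (simp add: in_tensor_class fg)
qed

definition cop :: "'k::field mat_free \<Rightarrow> ('k mat_free \<times> 'k mat_free \<Rightarrow>\<^sub>0 'k)" where
  "cop a = (\<Sum>w\<in>Poly_Mapping.keys a. Poly_Mapping.map ((*) (Poly_Mapping.lookup a w)) (comult_word (letters w)))"

lemma lin_tensor_mult: "lin (tensor_mult s t) f = lin s (\<lambda>a. lin t (\<lambda>b. f (fst a * fst b, snd a * snd b)))"
  unfolding tensor_mult_def lin_sum lin_single by (simp only: lin_def sum_distrib_left mult.assoc)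

lemma lin_comult_word: "lin (comult_word w) f = (\<Sum>(u, v)\<in>wspl w. f (wd u, wd v))"
proof (induction w arbitrary: f)
  case Nil then show ?case by (simp add: one_eq_wd)
next
  case (Cons g w)
  obtain i j where g: "g = (i, j)" by force
  show ?case
    unfolding g sum_wspl_Cons
    unfolding comult_word.simps lin_tensor_mult comult_gen_def lin_sum Cons gen_eq_wd UNIV_idx
    by simp
qed

lemma lin_cop: "lin (cop x) f = ev x (\<lambda>w. \<Sum>(u, v)\<in>wspl w. f (wd u, wd v))"
  unfolding cop_def by (simp add: lin_sum lin_comult_word) (simp add: lin_def)

lemma ring_mat_free: "ring (mat_free_bialgebra :: ('k::field, 'k mat_free) bialgebra)"
proof (rule ringI)
  show "abelian_group (mat_free_bialgebra :: ('k::field, 'k mat_free) bialgebra)"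
    by (rule abelian_groupI) (auto simp: mat_free_bialgebra_def add_ac intro: exI[of _ "- _"] left_minus)
  show "Group.monoid (mat_free_bialgebra :: ('k::field, 'k mat_free) bialgebra)"
    by (rule Group.monoidI) (auto simp: mat_free_bialgebra_def mult.assoc)
qed (auto simp: mat_free_bialgebra_def distrib_left distrib_right)

section \<open>Presented bialgebras and their quotients\<close>

lemma tensor_class_cong:
  assumes "carrier V = carrier V'" "ring.add V = ring.add V'" "smult V = smult V'"
  shows "tensor_class V V t = tensor_class V' V' t"
  unfolding tensor_class_def bilinear_rels_def assms ..

text \<open>
  A bialgebra presented by generators \<open>x\<^sub>i\<^sub>j\<close> and relations \<open>S\<close>, with projection \<open>p\<close> from the free
  bialgebra. The kernel of \<open>p\<close> is described by the functionals that vanish on it, which makes all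
  questions about the presented bialgebra questions about functions on words.
\<close>

locale presentation =
  fixes H :: "('k::field, 'a, 'm) bialgebra_scheme" and p :: "'k mat_free \<Rightarrow> 'a" and S :: "'k mat_free set"
  assumes carrier_eq: "carrier H = range p"
    and p_add: "p x \<oplus>\<^bsub>H\<^esub> p y = p (x + y)"
    and p_mult: "p x \<otimes>\<^bsub>H\<^esub> p y = p (x * y)"
    and p_one: "\<one>\<^bsub>H\<^esub> = p 1"
    and p_zero: "\<zero>\<^bsub>H\<^esub> = p 0"
    and p_smult: "c \<odot>\<^bsub>H\<^esub> p x = p (scal c * x)"
    and p_eq_iff: "p x = p y \<longleftrightarrow> (\<forall>f. annih S f \<longrightarrow> ev x f = ev y f)"
    and rels_coideal: "coideal S"
    and comult_p: "comult H (p x) = tensor_class H H (push p p (cop x))"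
    and counit_p: "counit H (p x) = ev x wcounit"

lemma presentation_free: "presentation (mat_free_bialgebra :: ('k::field, 'k mat_free) bialgebra) id {}"
proof
  fix x y :: "'k mat_free"
  have "x = y" if "\<forall>f. ev x f = ev y f"
  proof (rule poly_mapping_eqI)
    fix w
    have e: "letters v = letters w \<longleftrightarrow> v = w" for v :: "(idx \<times> idx) free_monoid"
      by (cases v; cases w) simp
    have l: "ev z (\<lambda>v. if v = letters w then 1 else 0) = Poly_Mapping.lookup z w" for z :: "'k mat_free"
      by (simp add: e lin_def in_keys_iff if_distrib cong: if_cong)
    show "Poly_Mapping.lookup x w = Poly_Mapping.lookup y w"
      using that[rule_format, of "\<lambda>v. if v = letters w then 1 else 0"] by (simp add: l)
  qed
  then show "(id x = id y) = (\<forall>f. annih {} f \<longrightarrow> ev x f = ev y f)"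
    by (auto simp: annih_def)
  show "comult mat_free_bialgebra (id x) = tensor_class mat_free_bialgebra mat_free_bialgebra (push id id (cop x))"
  proof -
    have "comult mat_free_bialgebra (id x) = tensor_class mat_free_module mat_free_module (cop x)"
      by (simp add: mat_free_bialgebra_def cop_def)
    also have "\<dots> = tensor_class mat_free_bialgebra mat_free_bialgebra (cop x)"
      by (rule tensor_class_cong) (simp_all add: mat_free_bialgebra_def mat_free_module_def)
    also have "\<dots> = tensor_class mat_free_bialgebra mat_free_bialgebra (push id id (cop x))"
      by (rule tensor_class_eqI) simp
    finally show ?thesis .
  qed
qed (auto simp: mat_free_bialgebra_def coideal_def annih_def lin_def)

context presentation
begin

lemma p_in_carrier [simp]: "p x \<in> carrier H"
  by (simp add: carrier_eq)

lemma p_cases: "A \<in> carrier H \<Longrightarrow> (\<And>x. A = p x \<Longrightarrow> P) \<Longrightarrow> P"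
  by (auto simp: carrier_eq)

lemma ring: "ring H"
proof -
  have "p \<in> ring_hom mat_free_bialgebra H"
    by (rule ring_hom_memI) (simp_all add: mat_free_bialgebra_def p_mult p_add p_one)
  from ring.ring_hom_imp_img_ring[OF ring_mat_free this]
  have "ring (H\<lparr>carrier := carrier H, ring.zero := \<zero>\<^bsub>H\<^esub>\<rparr>)"
    by (simp add: mat_free_bialgebra_def carrier_eq p_zero)
  then show ?thesis by simp
qed

sublocale ring H by (rule ring)

lemma minus: "p x \<ominus>\<^bsub>H\<^esub> p y = p (x - y)"
proof -
  have "p (- y) \<oplus>\<^bsub>H\<^esub> p y = \<zero>\<^bsub>H\<^esub>" by (simp add: p_add p_zero)
  then have "\<ominus>\<^bsub>H\<^esub> p y = p (- y)" by (intro minus_equality) auto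
  then show ?thesis by (simp add: a_minus_def p_add)
qed

lemma p_rel: "r \<in> S \<Longrightarrow> p (wd u * r * wd v) = p 0"
  unfolding p_eq_iff by (simp add: ev_sandwich annihD)

lemma annih_slice:
  assumes "\<And>x y. g (p x \<oplus>\<^bsub>H\<^esub> p y) = g (p x) + g (p y)" "\<And>c x. g (c \<odot>\<^bsub>H\<^esub> p x) = c * (g (p x) :: 'k)"
  shows "annih S (\<lambda>w. g (p (wd w)))" "g (p x) = ev x (\<lambda>w. g (p (wd w)))"
proof -
  have lin: "g (p (x + y)) = g (p x) + g (p y)" "g (p (scal c * x)) = c * g (p x)" for x y c
    using assms(1)[of x y] assms(2)[of c x] unfolding p_add p_smult by simp_all
  show "g (p x) = ev x (\<lambda>w. g (p (wd w)))"
    by (rule linear_eq_ev[of "\<lambda>x. g (p x)", OF lin])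
  have "g (p 0) = 0" using lin(2)[of 0 0] by simp
  then show "annih S (\<lambda>w. g (p (wd w)))"
    by (intro annih_linear[of "\<lambda>x. g (p x)", OF lin]) (simp add: p_rel)
qed

lemma annih2_bilin:
  assumes "bilin H H h"
  shows "annih2 S (\<lambda>z. h (p (wd (fst z)), p (wd (snd z))))"
  unfolding annih2_def fst_conv snd_conv
  using annih_slice(1)[of "\<lambda>a. h (a, p (wd _))"] annih_slice(1)[of "\<lambda>a. h (p (wd _), a)"] assms
  by (simp add: bilin_def)

end

text \<open>
  Dividing a presented bialgebra by the ideal generated by further relations presents the quotient, if
  all relations together generate a coideal. The ideal \<open>I\<close> is identified through its annihilator. One
  inclusion holds because the elements annihilated by all functionals on the intended quotient
  form an ideal that contains the relations. For the other, an element outside \<open>I\<close> is separated from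
  the subspace \<open>I\<close> by a functional, which then annihilates all relations. The comultiplication does
  not depend on the representative because tensors are tested by bilinear forms and the relations
  generate a coideal.
\<close>

lemma (in presentation) quotient:
  assumes SR: "coideal (S \<union> R)"
  defines "I \<equiv> Idl\<^bsub>H\<^esub> (p ` R)"
  shows "presentation (quot_bialgebra H I) (\<lambda>x. I +>\<^bsub>H\<^esub> p x) (S \<union> R)"
proof -
  have RI: "p ` R \<subseteq> I" unfolding I_def by (rule genideal_self) (auto simp: carrier_eq)
  have idl: "ideal I H" unfolding I_def by (rule genideal_ideal) (auto simp: carrier_eq)
  interpret I: ideal I H by fact
  \<comment> \<open>the candidate for \<open>I\<close>, as the common zeros of the functionals on the intended quotient\<close>
  define K where "K = p ` {z. \<forall>f. annih (S \<union> R) f \<longrightarrow> ev z f = 0}"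
  have Kmem: "p z \<in> K \<longleftrightarrow> (\<forall>f. annih (S \<union> R) f \<longrightarrow> ev z f = 0)" for z
  proof
    assume "p z \<in> K"
    then obtain z' where "p z = p z'" "\<forall>f. annih (S \<union> R) f \<longrightarrow> ev z' f = 0" by (auto simp: K_def)
    then show "\<forall>f. annih (S \<union> R) f \<longrightarrow> ev z f = 0" using p_eq_iff[of z z'] by (auto simp: annih_Un)
  qed (auto simp: K_def)
  have "ideal K H"
  proof (rule idealI[OF ring])
    show "subgroup K (add_monoid H)"
    proof (rule group.subgroupI[OF add.is_group])
      show "K \<subseteq> carrier (add_monoid H)" by (auto simp: K_def)
      show "K \<noteq> {}" using Kmem[of 0] by auto
      fix a assume "a \<in> K"
      then obtain z where z: "a = p z" "\<forall>f. annih (S \<union> R) f \<longrightarrow> ev z f = 0" by (auto simp: K_def)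
      have "\<ominus>\<^bsub>H\<^esub> p z = p (- z)" using minus[of 0 z] by (simp add: a_minus_def p_zero[symmetric])
      then show "inv\<^bsub>add_monoid H\<^esub> a \<in> K" using z Kmem[of "- z"] by (simp add: a_inv_def)
      fix b assume "b \<in> K"
      then obtain z' where z': "b = p z'" "\<forall>f. annih (S \<union> R) f \<longrightarrow> ev z' f = 0" by (auto simp: K_def)
      show "a \<otimes>\<^bsub>add_monoid H\<^esub> b \<in> K" using z z' Kmem[of "z + z'"] by (simp add: p_add)
    qed
  next
    fix a x assume "a \<in> K" "x \<in> carrier H"
    then obtain z y where z: "a = p z" "\<forall>f. annih (S \<union> R) f \<longrightarrow> ev z f = 0" "x = p y"
      by (auto simp: K_def carrier_eq)
    have "ev (y * z) f = 0" "ev (z * y) f = 0" if f: "annih (S \<union> R) f" for f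
    proof -
      have "ev z (\<lambda>v. f (u @ v)) = 0" "ev z (\<lambda>v. f (v @ u)) = 0" for u
        using z(2) annih_append_left[OF f] annih_append_right[OF f] by blast+
      moreover have "ev (z * y) f = ev y (\<lambda>u. ev z (\<lambda>v. f (v @ u)))" unfolding ev_mult by (rule lin_swap)
      ultimately show "ev (y * z) f = 0" "ev (z * y) f = 0" by (simp_all add: ev_mult lin_def[of y])
    qed
    then show "x \<otimes>\<^bsub>H\<^esub> a \<in> K" "a \<otimes>\<^bsub>H\<^esub> x \<in> K" using z by (simp_all add: p_mult Kmem)
  qed
  moreover have "p ` R \<subseteq> K" by (auto simp: Kmem intro: annihD0[of "S \<union> R"])
  ultimately have IK: "I \<subseteq> K" unfolding I_def by (rule genideal_minimal)
  have Imem: "p z \<in> I \<longleftrightarrow> (\<forall>f. annih (S \<union> R) f \<longrightarrow> ev z f = 0)" for z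
  proof
    assume "p z \<in> I"
    then show "\<forall>f. annih (S \<union> R) f \<longrightarrow> ev z f = 0" using IK Kmem by blast
  next
    assume *: "\<forall>f. annih (S \<union> R) f \<longrightarrow> ev z f = 0"
    show "p z \<in> I"
    proof (rule ccontr)
      assume "p z \<notin> I"
      \<comment> \<open>the preimage of \<open>I\<close> in the free algebra, where functionals can be separated\<close>
      define L where "L = {x. p x \<in> I}"
      have scal: "scal c * x \<in> L" if "x \<in> L" for c x
        using that I.I_l_closed[of "p x" "p (scal c)"] by (simp add: L_def p_mult)
      have "free_space.subspace L"
        unfolding free_space.subspace_def scale_eq_scal
        using scal I.zero_closed I.a_closed by (auto simp: L_def p_zero p_add[symmetric])
      then have "z \<notin> free_space.span L"
        using \<open>p z \<notin> I\<close> by (simp add: free_space.span_eq_iff[THEN iffD2] L_def)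
      from separating_functional[OF this] obtain g where g: "\<And>y. y \<in> L \<Longrightarrow> lin y g = 0" "lin z g = 1"
        by blast
      define f where "f = (\<lambda>w. g (Word w))"
      have evf: "ev x f = lin x g" for x by (simp add: f_def)
      have "wd u * r * wd v \<in> L" if "r \<in> S \<union> R" for u r v
      proof -
        have "p r \<in> I"
          using that RI p_rel[of r "[]" "[]"] I.zero_closed by (auto simp: one_eq_wd[symmetric] p_zero)
        then have "p (wd u) \<otimes>\<^bsub>H\<^esub> p r \<otimes>\<^bsub>H\<^esub> p (wd v) \<in> I"
          by (simp add: I.I_l_closed I.I_r_closed)
        then show ?thesis by (simp add: L_def p_mult)
      qed
      then have "annih (S \<union> R) f"
        unfolding annih_def using g(1) by (simp add: ev_sandwich[symmetric] evf)
      then show False using * g(2) evf by auto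
    qed
  qed
  let ?\<pi> = "\<lambda>x. I +>\<^bsub>H\<^esub> x" let ?p = "\<lambda>x. I +>\<^bsub>H\<^esub> p x"
  let ?Q = "quot_module H I" let ?B = "quot_bialgebra H I"
  have ker': "?p x = ?p y \<longleftrightarrow> (\<forall>f. annih (S \<union> R) f \<longrightarrow> ev x f = ev y f)" for x y
    using quotient_eq_iff_same_a_r_cos[OF idl, of "p x" "p y"] Imem[of "x - y"] by (simp add: minus)
  have coset: "A \<in> ?p x \<Longrightarrow> \<exists>y. A = p y \<and> ?p y = ?p x" for A x
    using I.a_Hcarr I.a_repr_independence'[of A "p x"] I.a_rcosets_carrier[of "?p x"]
    by (metis I.a_elemrcos_carrier p_cases p_in_carrier)
  have self: "p x \<in> ?p x" for x by (simp add: I.a_rcos_self)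
  have padd: "set_add H (?p x) (?p y) = ?p (x + y)" for x y by (simp add: I.a_rcos_sum p_add)
  have psmult: "(\<Union>a\<in>?p x. ?\<pi> (c \<odot>\<^bsub>H\<^esub> a)) = ?p (scal c * x)" for c x
  proof -
    have "?\<pi> (c \<odot>\<^bsub>H\<^esub> a) = ?p (scal c * x)" if a: "a \<in> ?p x" for a
    proof -
      obtain y where y: "a = p y" "?p y = ?p x" using coset[OF a] by blast
      then show ?thesis using ker'[of y x] ker'[of "scal c * y" "scal c * x"] by (simp add: p_smult)
    qed
    then show ?thesis using self[of x] by blast
  qed
  have carr: "carrier ?Q = range ?p"
    by (auto simp: quot_module_def FactRing_def A_RCOSETS_def' carrier_eq)
  have Qadd: "?p x \<oplus>\<^bsub>?Q\<^esub> ?p y = ?p (x + y)" for x y by (simp add: quot_module_def FactRing_def padd)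
  have Qsmult: "c \<odot>\<^bsub>?Q\<^esub> ?p x = ?p (scal c * x)" for c x by (simp add: quot_module_def psmult)
  have BQ: "carrier ?B = carrier ?Q" "ring.add ?B = ring.add ?Q" "module.smult ?B = module.smult ?Q"
    by (simp_all add: quot_bialgebra_def Let_def)
  have pull: "bilin H H (\<lambda>z. h (?\<pi> (fst z), ?\<pi> (snd z)))" if "bilin ?Q ?Q h" for h
    using that unfolding bilin_def carr carrier_eq by (simp add: p_add p_smult Qadd[symmetric] Qsmult[symmetric])
  have annih2_pull: "annih2 (S \<union> R) (\<lambda>z. h (?p (wd (fst z)), ?p (wd (snd z))))" if h: "bilin ?Q ?Q h" for h
  proof -
    have *: "annih (S \<union> R) (\<lambda>w. g (?p (wd w)))"
      if g: "\<And>x y. g (?p x \<oplus>\<^bsub>?Q\<^esub> ?p y) = g (?p x) + g (?p y)" "\<And>c x. g (c \<odot>\<^bsub>?Q\<^esub> ?p x) = c * (g (?p x) :: 'k)" for g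
    proof -
      have lin: "g (?p (x + y)) = g (?p x) + g (?p y)" "g (?p (scal c * x)) = c * g (?p x)" for x y c
        using g by (simp_all add: Qadd Qsmult)
      have "?p (wd u * r * wd v) = ?p 0" if "r \<in> S \<union> R" for u r v
        unfolding ker' using that by (simp add: ev_sandwich annihD)
      moreover have "g (?p 0) = 0" using lin(2)[of 0 0] by simp
      ultimately show ?thesis
        by (intro annih_linear[of "\<lambda>x. g (?p x)", OF lin]) simp
    qed
    show ?thesis
      unfolding annih2_def fst_conv snd_conv
      using *[of "\<lambda>a. h (a, ?p (wd _))"] *[of "\<lambda>a. h (?p (wd _), a)"] h
      by (simp add: bilin_def carr)
  qed
  have comult': "comult ?B (?p x) = tensor_class ?B ?B (push ?p ?p (cop x))" for x
  proof -
    have tm: "tensor_map ?Q ?Q ?\<pi> ?\<pi> (comult H (p y)) = tensor_class ?Q ?Q (push ?p ?p (cop y))" for y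
    proof -
      have k: "Poly_Mapping.keys (push p p (cop y)) \<subseteq> carrier H \<times> carrier H"
        using keys_push[of p p "cop y"] by auto
      have "tensor_map ?Q ?Q ?\<pi> ?\<pi> (comult H (p y)) = tensor_class ?Q ?Q (push ?\<pi> ?\<pi> (push p p (cop y)))"
        unfolding comult_p by (rule tensor_map_class[OF k]) (rule pull)
      also have "\<dots> = tensor_class ?Q ?Q (push ?p ?p (cop y))"
        by (rule tensor_class_eqI) simp
      finally show ?thesis .
    qed
    have "comult ?B (?p x) = the_elem ((\<lambda>A. tensor_map ?Q ?Q ?\<pi> ?\<pi> (comult H A)) ` (?p x))"
      by (simp add: quot_bialgebra_def Let_def)
    also have "\<dots> = tensor_map ?Q ?Q ?\<pi> ?\<pi> (comult H (p x))"
    proof (rule the_elem_image_const[OF self])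
      fix A assume "A \<in> ?p x"
      then obtain y where y: "A = p y" "?p y = ?p x" using coset by blast
      show "tensor_map ?Q ?Q ?\<pi> ?\<pi> (comult H A) = tensor_map ?Q ?Q ?\<pi> ?\<pi> (comult H (p x))"
        unfolding y(1) tm
      proof (rule tensor_class_eqI)
        fix h assume h: "bilin ?Q ?Q h"
        define F where "F = (\<lambda>w. \<Sum>(u, v)\<in>wspl w. h (?p (wd u), ?p (wd v)))"
        have "annih (S \<union> R) F"
          using coidealD[OF SR annih2_pull[OF h]] by (simp add: F_def case_prod_beta)
        then have "ev y F = ev x F" using y(2)[unfolded ker'] by blast
        then show "lin (push ?p ?p (cop y)) h = lin (push ?p ?p (cop x)) h"
          by (simp add: lin_cop F_def)
      qed
    qed
    also have "\<dots> = tensor_class ?B ?B (push ?p ?p (cop x))"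
      unfolding tm by (rule tensor_class_cong) (simp_all add: BQ)
    finally show ?thesis .
  qed
  have counit': "counit ?B (?p x) = ev x wcounit" for x
  proof -
    have "counit ?B (?p x) = the_elem (counit H ` (?p x))"
      by (simp add: quot_bialgebra_def Let_def)
    also have "\<dots> = counit H (p x)"
    proof (rule the_elem_image_const[OF self])
      fix A assume "A \<in> ?p x"
      then obtain y where y: "A = p y" "?p y = ?p x" using coset by blast
      then show "counit H A = counit H (p x)"
        using ker' coideal_counit[OF SR] by (simp add: counit_p)
    qed
    finally show ?thesis by (simp add: counit_p)
  qed
  show ?thesis
  proof
    show "?p x \<otimes>\<^bsub>?B\<^esub> ?p y = ?p (x * y)" for x y
      by (simp add: quot_bialgebra_def quot_module_def Let_def FactRing_def I.rcoset_mult_add p_mult)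
    show "\<one>\<^bsub>?B\<^esub> = ?p 1" "\<zero>\<^bsub>?B\<^esub> = ?p 0"
      using I.a_subset by (simp_all add: quot_bialgebra_def quot_module_def Let_def FactRing_def p_one p_zero[symmetric])
  qed (use SR ker' comult' counit' in \<open>simp_all add: BQ carr Qadd Qsmult\<close>)
qed

section \<open>Forms and Sweedler sums on a presented bialgebra\<close>

context presentation
begin

text \<open>
  Linearity on the carrier, without the extensionality that \<open>linear_forms\<close> demands: the slices of the
  forms in Sweedler sums are of this kind.
\<close>

definition linear_on :: "('a \<Rightarrow> 'k) \<Rightarrow> bool" where
  "linear_on g \<longleftrightarrow> (\<forall>x\<in>carrier H. \<forall>y\<in>carrier H. g (x \<oplus>\<^bsub>H\<^esub> y) = g x + g y) \<and>
     (\<forall>c. \<forall>x\<in>carrier H. g (c \<odot>\<^bsub>H\<^esub> x) = c * g x)"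

lemma linear_forms_iff: "\<mu> \<in> linear_forms H \<longleftrightarrow> \<mu> \<in> extensional (carrier H) \<and> linear_on \<mu>"
  by (auto simp: linear_forms_def linear_on_def)

lemma bilin_linear_on:
  "bilin H H h \<longleftrightarrow> (\<forall>w\<in>carrier H. linear_on (\<lambda>v. h (v, w)) \<and> linear_on (\<lambda>v. h (w, v)))"
  unfolding bilin_def linear_on_def by (intro iffI conjI ballI allI) simp_all

lemma bilinear_forms_iff: "b \<in> bilinear_forms H \<longleftrightarrow> b \<in> extensional (carrier H \<times> carrier H) \<and> bilin H H b"
  unfolding bilinear_forms_def bilin_def mem_Collect_eq by (intro iffI conjI ballI allI) simp_all

lemma smult_closed [simp]: "x \<in> carrier H \<Longrightarrow> c \<odot>\<^bsub>H\<^esub> x \<in> carrier H"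
  by (auto simp: carrier_eq p_smult)

lemma linear_on_cong:
  assumes "linear_on f" "\<And>x. x \<in> carrier H \<Longrightarrow> f x = g x"
  shows "linear_on g"
  unfolding linear_on_def
proof (intro conjI ballI allI)
  fix x y assume "x \<in> carrier H" "y \<in> carrier H"
  then show "g (x \<oplus>\<^bsub>H\<^esub> y) = g x + g y"
    using assms(1) unfolding linear_on_def by (metis assms(2) a_closed)
next
  fix c x assume "x \<in> carrier H"
  then show "g (c \<odot>\<^bsub>H\<^esub> x) = c * g x"
    using assms(1) unfolding linear_on_def by (metis assms(2) smult_closed)
qed

lemma linear_on_cmult:
  assumes "linear_on g"
  shows "linear_on (\<lambda>x. c * g x)"
  unfolding linear_on_def
proof (intro conjI ballI allI)
  fix x y assume "x \<in> carrier H" "y \<in> carrier H"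
  then have "g (x \<oplus>\<^bsub>H\<^esub> y) = g x + g y" using assms unfolding linear_on_def by blast
  then show "c * g (x \<oplus>\<^bsub>H\<^esub> y) = c * g x + c * g y" by (simp only: distrib_left)
next
  fix d x assume "x \<in> carrier H"
  then have "g (d \<odot>\<^bsub>H\<^esub> x) = d * g x" using assms unfolding linear_on_def by blast
  then show "c * g (d \<odot>\<^bsub>H\<^esub> x) = d * (c * g x)" by (simp only: mult.left_commute)
qed

lemma linear_on_mult_right: "linear_on g \<Longrightarrow> linear_on (\<lambda>x. g x * c)"
  using linear_on_cmult[of g c] by (simp add: mult.commute)

lemma linear_on_sum:
  assumes "\<And>i. i \<in> A \<Longrightarrow> linear_on (g i)"
  shows "linear_on (\<lambda>x. \<Sum>i\<in>A. g i x)"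
  unfolding linear_on_def
proof (intro conjI ballI allI)
  fix x y assume "x \<in> carrier H" "y \<in> carrier H"
  then have "g i (x \<oplus>\<^bsub>H\<^esub> y) = g i x + g i y" if "i \<in> A" for i
    using assms[OF that] unfolding linear_on_def by blast
  then show "(\<Sum>i\<in>A. g i (x \<oplus>\<^bsub>H\<^esub> y)) = (\<Sum>i\<in>A. g i x) + (\<Sum>i\<in>A. g i y)"
    by (simp add: sum.distrib)
next
  fix c x assume "x \<in> carrier H"
  then have "g i (c \<odot>\<^bsub>H\<^esub> x) = c * g i x" if "i \<in> A" for i
    using assms[OF that] unfolding linear_on_def by blast
  then show "(\<Sum>i\<in>A. g i (c \<odot>\<^bsub>H\<^esub> x)) = c * (\<Sum>i\<in>A. g i x)"
    by (simp add: sum_distrib_left)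
qed

lemma linear_on_lin: "(\<And>i. linear_on (g i)) \<Longrightarrow> linear_on (\<lambda>x. lin t (\<lambda>i. g i x))"
  unfolding lin_def by (intro linear_on_sum linear_on_cmult)

lemma linear_on_prod:
  assumes "linear_on g" "y \<in> carrier H"
  shows "linear_on (\<lambda>x. g (x \<otimes>\<^bsub>H\<^esub> y))" "linear_on (\<lambda>x. g (y \<otimes>\<^bsub>H\<^esub> x))"
proof -
  obtain b where y: "y = p b" using assms(2) by (rule p_cases)
  have *: "g (p (a + c)) = g (p a) + g (p c)" "g (p (scal d * a)) = d * g (p a)" for a c d
    unfolding p_add[symmetric] p_smult[symmetric] using assms(1) unfolding linear_on_def by simp_all
  have c: "b * (scal d * a) = scal d * (b * a)" for d a
    by (metis mult.assoc scal_commute)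
  show "linear_on (\<lambda>x. g (x \<otimes>\<^bsub>H\<^esub> y))" "linear_on (\<lambda>x. g (y \<otimes>\<^bsub>H\<^esub> x))"
    unfolding linear_on_def carrier_eq y
    by (simp_all add: p_add p_mult p_smult distrib_left distrib_right c mult.assoc *)
qed

lemma linear_on_ev:
  assumes "linear_on g"
  shows "annih S (\<lambda>w. g (p (wd w)))" "g (p x) = ev x (\<lambda>w. g (p (wd w)))"
proof -
  have "g (p x \<oplus>\<^bsub>H\<^esub> p y) = g (p x) + g (p y)" "g (c \<odot>\<^bsub>H\<^esub> p x) = c * g (p x)" for x y c
    using assms by (simp_all add: linear_on_def)
  then show "annih S (\<lambda>w. g (p (wd w)))" "g (p x) = ev x (\<lambda>w. g (p (wd w)))"
    by (rule annih_slice)+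
qed

text \<open>
  Forms on the bialgebra correspond to annihilating functions on words: \<open>word_form\<close> restricts a form
  to the images of words, and \<open>form_of\<close> extends linearly and descends along \<open>p\<close>, through an arbitrary
  preimage.
\<close>

definition word_form :: "('a \<Rightarrow> 'k) \<Rightarrow> word \<Rightarrow> 'k" where
  "word_form g w = g (p (wd w))"

definition word_form2 :: "('a \<times> 'a \<Rightarrow> 'k) \<Rightarrow> word \<times> word \<Rightarrow> 'k" where
  "word_form2 h z = h (p (wd (fst z)), p (wd (snd z)))"

definition form_of :: "(word \<Rightarrow> 'k) \<Rightarrow> 'a \<Rightarrow> 'k" where
  "form_of f = (\<lambda>A\<in>carrier H. ev (SOME x. p x = A) f)"

definition form2_of :: "(word \<times> word \<Rightarrow> 'k) \<Rightarrow> 'a \<times> 'a \<Rightarrow> 'k" where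
  "form2_of b = (\<lambda>(A, B)\<in>carrier H \<times> carrier H.
     ev (SOME x. p x = A) (\<lambda>u. ev (SOME y. p y = B) (\<lambda>v. b (u, v))))"

lemma some_p: "p (SOME y. p y = p x) = p x"
  by (rule someI[of "\<lambda>y. p y = p x"]) simp

lemma ev_some_p: "annih S f \<Longrightarrow> ev (SOME y. p y = p x) f = ev x f"
  using p_eq_iff[THEN iffD1, OF some_p] by blast

lemma form_of_p: "annih S f \<Longrightarrow> form_of f (p x) = ev x f"
  by (simp add: form_of_def ev_some_p)

lemma form2_of_p:
  assumes "annih2 S b"
  shows "form2_of b (p x, p y) = ev x (\<lambda>u. ev y (\<lambda>v. b (u, v)))"
proof -
  have "ev (SOME y'. p y' = p y) (\<lambda>v. b (u, v)) = ev y (\<lambda>v. b (u, v))" for u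
    by (rule ev_some_p[OF annih2_slice(2)[OF assms]])
  moreover have "annih S (\<lambda>u. ev y (\<lambda>v. b (u, v)))"
    unfolding lin_def by (intro annih_sum annih_cmult annih2_slice assms)
  then have "ev (SOME x'. p x' = p x) (\<lambda>u. ev y (\<lambda>v. b (u, v))) = ev x (\<lambda>u. ev y (\<lambda>v. b (u, v)))"
    by (rule ev_some_p)
  ultimately show ?thesis by (simp add: form2_of_def)
qed

lemma form_of_linear: "annih S f \<Longrightarrow> form_of f \<in> linear_forms H"
  unfolding linear_forms_iff linear_on_def carrier_eq
  by (simp add: p_add p_smult form_of_p) (simp add: form_of_def carrier_eq)

lemma form2_of_bilinear: "annih2 S b \<Longrightarrow> form2_of b \<in> bilinear_forms H"
  unfolding bilinear_forms_iff bilin_def carrier_eq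
  by (simp add: p_add p_smult form2_of_p lin_fun_add lin_fun_cmult) (simp add: form2_of_def carrier_eq)

lemma word_form_of [simp]: "annih S f \<Longrightarrow> word_form (form_of f) = f"
  by (rule ext) (simp add: word_form_def form_of_p)

lemma word_form2_of [simp]: "annih2 S b \<Longrightarrow> word_form2 (form2_of b) = b"
  by (rule ext) (simp add: word_form2_def form2_of_p)

lemma word_form_annih: "\<mu> \<in> linear_forms H \<Longrightarrow> annih S (word_form \<mu>)"
  using linear_on_ev(1)[of \<mu>] by (simp add: linear_forms_iff word_form_def[abs_def])

lemma word_form2_annih: "b \<in> bilinear_forms H \<Longrightarrow> annih2 S (word_form2 b)"
  using annih2_bilin[of b] by (simp add: bilinear_forms_iff word_form2_def[abs_def])

lemma linear_form_p: "\<mu> \<in> linear_forms H \<Longrightarrow> \<mu> (p x) = ev x (word_form \<mu>)"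
  unfolding word_form_def by (rule linear_on_ev(2)) (simp add: linear_forms_iff)

lemma bilinear_form_p:
  assumes "b \<in> bilinear_forms H"
  shows "b (p x, p y) = ev x (\<lambda>u. ev y (\<lambda>v. word_form2 b (u, v)))"
proof -
  have l: "linear_on (\<lambda>v. b (v, p c))" "linear_on (\<lambda>v. b (p c, v))" for c
    using assms unfolding bilinear_forms_iff bilin_linear_on by simp_all
  have "b (p x, p y) = ev x (\<lambda>u. b (p (wd u), p y))"
    by (rule linear_on_ev(2)[OF l(1)])
  also have "\<dots> = ev x (\<lambda>u. ev y (\<lambda>v. word_form2 b (u, v)))"
    unfolding word_form2_def fst_conv snd_conv by (rule lin_cong) (rule linear_on_ev(2)[OF l(2)])
  finally show ?thesis .
qed

lemma form_of_word_form [simp]: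
  assumes "\<mu> \<in> linear_forms H" shows "form_of (word_form \<mu>) = \<mu>"
proof (rule extensionalityI[of _ "carrier H"])
  fix A assume "A \<in> carrier H"
  then obtain x where "A = p x" by (rule p_cases)
  then show "form_of (word_form \<mu>) A = \<mu> A"
    using form_of_p[OF word_form_annih[OF assms]] linear_form_p[OF assms] by simp
qed (use assms in \<open>auto simp: linear_forms_iff form_of_def\<close>)

lemma form2_of_word_form2 [simp]:
  assumes "b \<in> bilinear_forms H" shows "form2_of (word_form2 b) = b"
proof (rule extensionalityI[of _ "carrier H \<times> carrier H"])
  fix Z assume "Z \<in> carrier H \<times> carrier H"
  then obtain x y where "Z = (p x, p y)" by (auto simp: carrier_eq)
  then show "form2_of (word_form2 b) Z = b Z"
    using form2_of_p[OF word_form2_annih[OF assms]] bilinear_form_p[OF assms] by simp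
qed (use assms in \<open>auto simp: bilinear_forms_iff form2_of_def\<close>)

text \<open>
  This separation property allows equations in the bialgebra, such as the laziness conditions, to be
  tested by linear forms.
\<close>

lemma eq_if_linear_forms_agree:
  assumes "A \<in> carrier H" "B \<in> carrier H" "\<And>\<psi>. \<psi> \<in> linear_forms H \<Longrightarrow> \<psi> A = \<psi> B"
  shows "A = B"
proof -
  obtain x y where xy: "A = p x" "B = p y" using assms(1,2) by (auto simp: carrier_eq)
  have "ev x f = ev y f" if f: "annih S f" for f
    using assms(3)[OF form_of_linear[OF f]] f by (simp add: xy form_of_p)
  then show ?thesis by (simp add: xy p_eq_iff)
qed

lemma keys_comult: "Poly_Mapping.keys (push p p (cop x)) \<subseteq> carrier H \<times> carrier H"
  using keys_push[of p p "cop x"] by auto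

lemma tensor_form_p:
  assumes "bilin H H (\<lambda>z. f (fst z) (snd z))"
  shows "tensor_form (comult H (p x)) f = ev x (\<lambda>w. \<Sum>(u, v)\<in>wspl w. f (p (wd u)) (p (wd v)))"
  unfolding comult_p by (simp add: tensor_form_class[OF keys_comult assms] lin_cop)

text \<open>
  A double Sweedler sum of scalars is a sum over decompositions of words. The inner sum has to be
  bilinear in the outer variables in order to be a function of the tensor \<open>\<Delta>(p x)\<close>.
\<close>

lemma tensor_form2_p:
  assumes 1: "\<And>x1 x2. x1 \<in> carrier H \<Longrightarrow> x2 \<in> carrier H \<Longrightarrow> bilin H H (\<lambda>z. f x1 x2 (fst z) (snd z))"
    and 2: "\<And>y1 y2. y1 \<in> carrier H \<Longrightarrow> y2 \<in> carrier H \<Longrightarrow> bilin H H (\<lambda>z. f (fst z) (snd z) y1 y2)"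
  shows "tensor_form (comult H (p x)) (\<lambda>x1 x2. tensor_form (comult H (p y)) (f x1 x2)) =
    ev x (\<lambda>w. \<Sum>(u, v)\<in>wspl w. ev y (\<lambda>w'. \<Sum>(u', v')\<in>wspl w'. f (p (wd u)) (p (wd v)) (p (wd u')) (p (wd v'))))"
proof -
  have in1: "tensor_form (comult H (p y)) (f x1 x2) =
      ev y (\<lambda>w'. \<Sum>(u', v')\<in>wspl w'. f x1 x2 (p (wd u')) (p (wd v')))"
    if "x1 \<in> carrier H" "x2 \<in> carrier H" for x1 x2
    by (rule tensor_form_p[OF 1[OF that]])
  have l: "linear_on (\<lambda>v. f v w y1 y2)" "linear_on (\<lambda>v. f w v y1 y2)"
    if "w \<in> carrier H" "y1 \<in> carrier H" "y2 \<in> carrier H" for w y1 y2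
    using 2[OF that(2,3)] that(1) unfolding bilin_linear_on by simp_all
  define G where "G = (\<lambda>a b. ev y (\<lambda>w'. \<Sum>z\<in>wspl w'. f a b (p (wd (fst z))) (p (wd (snd z)))))"
  have G: "tensor_form (comult H (p y)) (f a b) = G a b" if "a \<in> carrier H" "b \<in> carrier H" for a b
    unfolding in1[OF that] G_def case_prod_beta ..
  have "linear_on (\<lambda>v. tensor_form (comult H (p y)) (f v w))" "linear_on (\<lambda>v. tensor_form (comult H (p y)) (f w v))"
    if w: "w \<in> carrier H" for w
  proof -
    have l': "linear_on (\<lambda>v. G v w)" "linear_on (\<lambda>v. G w v)"
      unfolding G_def by (intro linear_on_lin linear_on_sum l w p_in_carrier)+
    show "linear_on (\<lambda>v. tensor_form (comult H (p y)) (f v w))" "linear_on (\<lambda>v. tensor_form (comult H (p y)) (f w v))"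
      by (rule linear_on_cong[OF l'(1)], simp add: G w) (rule linear_on_cong[OF l'(2)], simp add: G w)
  qed
  then have "bilin H H (\<lambda>z. tensor_form (comult H (p y)) (f (fst z) (snd z)))"
    unfolding bilin_linear_on fst_conv snd_conv by blast
  from tensor_form_p[OF this] show ?thesis by (simp add: in1)
qed

lemma linear_form_finsum:
  assumes "\<psi> \<in> linear_forms H" "finite K" "\<And>k. k \<in> K \<Longrightarrow> g k \<in> carrier H"
  shows "(\<Oplus>\<^bsub>H\<^esub>k\<in>K. g k) \<in> carrier H \<and> \<psi> (\<Oplus>\<^bsub>H\<^esub>k\<in>K. g k) = (\<Sum>k\<in>K. \<psi> (g k))"
  using assms(2,3)
proof (induction K rule: finite_induct)
  case empty
  have "\<psi> \<zero>\<^bsub>H\<^esub> = 0" using linear_form_p[OF assms(1), of 0] by (simp add: p_zero)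
  then show ?case by simp
next
  case (insert k K)
  then have "(\<Oplus>\<^bsub>H\<^esub>k\<in>insert k K. g k) = g k \<oplus>\<^bsub>H\<^esub> (\<Oplus>\<^bsub>H\<^esub>k\<in>K. g k)"
    by (intro finsum_insert) auto
  then show ?case using insert assms(1) by (simp add: linear_forms_def)
qed

lemma linear_form_smult: "\<psi> \<in> linear_forms H \<Longrightarrow> x \<in> carrier H \<Longrightarrow> \<psi> (c \<odot>\<^bsub>H\<^esub> x) = c * \<psi> x"
  by (simp add: linear_forms_def)

text \<open>
  Sweedler sums with values in the bialgebra are described by their images under linear forms. The
  value does not depend on the chosen representative of the tensor, since linear forms separate
  points.
\<close>

lemma tensor_lift_p:
  assumes f: "\<And>a b. a \<in> carrier H \<Longrightarrow> b \<in> carrier H \<Longrightarrow> f a b \<in> carrier H"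
    and bil: "\<And>\<psi>. \<psi> \<in> linear_forms H \<Longrightarrow> bilin H H (\<lambda>z. \<psi> (f (fst z) (snd z)))"
  shows "tensor_lift H (comult H (p x)) f \<in> carrier H"
    "\<psi> \<in> linear_forms H \<Longrightarrow> \<psi> (tensor_lift H (comult H (p x)) f) =
       ev x (\<lambda>w. \<Sum>(u, v)\<in>wspl w. \<psi> (f (p (wd u)) (p (wd v))))"
proof -
  define t where "t = push p p (cop x)"
  define V where "V = (\<lambda>s. \<Oplus>\<^bsub>H\<^esub>z\<in>Poly_Mapping.keys s. Poly_Mapping.lookup s z \<odot>\<^bsub>H\<^esub> f (fst z) (snd z))"
  have V: "V s \<in> carrier H \<and> \<psi> (V s) = lin s (\<lambda>z. \<psi> (f (fst z) (snd z)))"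
    if "Poly_Mapping.keys s \<subseteq> carrier H \<times> carrier H" "\<psi> \<in> linear_forms H" for s \<psi>
  proof -
    have k: "f (fst z) (snd z) \<in> carrier H" if "z \<in> Poly_Mapping.keys s" for z
      using f \<open>Poly_Mapping.keys s \<subseteq> _\<close> that by auto
    then show ?thesis
      using linear_form_finsum[OF that(2) finite_keys, of s "\<lambda>z. Poly_Mapping.lookup s z \<odot>\<^bsub>H\<^esub> f (fst z) (snd z)"]
      unfolding V_def lin_def by (simp add: linear_form_smult[OF that(2)] cong: sum.cong)
  qed
  have kt: "Poly_Mapping.keys t \<subseteq> carrier H \<times> carrier H" unfolding t_def by (rule keys_comult)
  have "annih S (\<lambda>w. 0)" by (simp add: annih_def lin_def)
  then obtain \<psi>0 where \<psi>0: "\<psi>0 \<in> linear_forms H" using form_of_linear by blast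
  have "tensor_lift H (comult H (p x)) f = V t"
    unfolding tensor_lift_def V_def[symmetric] comult_p t_def[symmetric]
  proof (rule the_elem_image_const)
    show "t \<in> tensor_class H H t" using kt by (simp add: in_tensor_class)
    fix s assume s: "s \<in> tensor_class H H t"
    then have ks: "Poly_Mapping.keys s \<subseteq> carrier H \<times> carrier H" by (simp add: in_tensor_class)
    show "V s = V t"
    proof (rule eq_if_linear_forms_agree)
      show "V s \<in> carrier H" "V t \<in> carrier H" using V[OF ks \<psi>0] V[OF kt \<psi>0] by simp_all
      fix \<psi> assume \<psi>: "\<psi> \<in> linear_forms H"
      show "\<psi> (V s) = \<psi> (V t)"
        using V[OF ks \<psi>] V[OF kt \<psi>] s bil[OF \<psi>] by (simp add: in_tensor_class)
    qed
  qed
  then show "tensor_lift H (comult H (p x)) f \<in> carrier H"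
    "\<psi> \<in> linear_forms H \<Longrightarrow> \<psi> (tensor_lift H (comult H (p x)) f) =
       ev x (\<lambda>w. \<Sum>(u, v)\<in>wspl w. \<psi> (f (p (wd u)) (p (wd v))))"
    using V[OF kt \<psi>0] V[OF kt, of \<psi>] by (simp_all add: t_def lin_cop)
qed

lemma tensor_lift2_p:
  assumes f: "\<And>a b c d. a \<in> carrier H \<Longrightarrow> b \<in> carrier H \<Longrightarrow> c \<in> carrier H \<Longrightarrow> d \<in> carrier H \<Longrightarrow> f a b c d \<in> carrier H"
    and 1: "\<And>\<psi> x1 x2. \<psi> \<in> linear_forms H \<Longrightarrow> x1 \<in> carrier H \<Longrightarrow> x2 \<in> carrier H \<Longrightarrow> bilin H H (\<lambda>z. \<psi> (f x1 x2 (fst z) (snd z)))"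
    and 2: "\<And>\<psi> y1 y2. \<psi> \<in> linear_forms H \<Longrightarrow> y1 \<in> carrier H \<Longrightarrow> y2 \<in> carrier H \<Longrightarrow> bilin H H (\<lambda>z. \<psi> (f (fst z) (snd z) y1 y2))"
  shows "tensor_lift H (comult H (p x)) (\<lambda>x1 x2. tensor_lift H (comult H (p y)) (f x1 x2)) \<in> carrier H" (is "?T \<in> _")
    and "\<psi> \<in> linear_forms H \<Longrightarrow> \<psi> (tensor_lift H (comult H (p x)) (\<lambda>x1 x2. tensor_lift H (comult H (p y)) (f x1 x2))) =
    ev x (\<lambda>w. \<Sum>(u, v)\<in>wspl w. ev y (\<lambda>w'. \<Sum>(u', v')\<in>wspl w'. \<psi> (f (p (wd u)) (p (wd v)) (p (wd u')) (p (wd v')))))"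
proof -
  have c: "tensor_lift H (comult H (p y)) (f x1 x2) \<in> carrier H" if "x1 \<in> carrier H" "x2 \<in> carrier H" for x1 x2
    using that by (intro tensor_lift_p f 1)
  have in1: "\<psi> (tensor_lift H (comult H (p y)) (f x1 x2)) =
      ev y (\<lambda>w'. \<Sum>(u', v')\<in>wspl w'. \<psi> (f x1 x2 (p (wd u')) (p (wd v'))))"
    if "\<psi> \<in> linear_forms H" "x1 \<in> carrier H" "x2 \<in> carrier H" for x1 x2 \<psi>
    using that by (intro tensor_lift_p f 1)
  have l: "linear_on (\<lambda>v. \<psi> (f v w y1 y2))" "linear_on (\<lambda>v. \<psi> (f w v y1 y2))"
    if "\<psi> \<in> linear_forms H" "w \<in> carrier H" "y1 \<in> carrier H" "y2 \<in> carrier H" for w y1 y2 \<psi>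
    using 2[OF that(1,3,4)] that(2) unfolding bilin_linear_on by simp_all
  define G where "G = (\<lambda>\<psi> a b. ev y (\<lambda>w'. \<Sum>z\<in>wspl w'. \<psi> (f a b (p (wd (fst z))) (p (wd (snd z))))))" for \<psi> :: "'a \<Rightarrow> 'k"
  have G: "\<psi> (tensor_lift H (comult H (p y)) (f a b)) = G \<psi> a b"
    if "\<psi> \<in> linear_forms H" "a \<in> carrier H" "b \<in> carrier H" for a b \<psi>
    unfolding in1[OF that] G_def case_prod_beta ..
  have lin: "linear_on (\<lambda>v. \<psi> (tensor_lift H (comult H (p y)) (f v w)))" "linear_on (\<lambda>v. \<psi> (tensor_lift H (comult H (p y)) (f w v)))"
    if w: "w \<in> carrier H" and \<psi>: "\<psi> \<in> linear_forms H" for w \<psi>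
  proof -
    have l': "linear_on (\<lambda>v. G \<psi> v w)" "linear_on (\<lambda>v. G \<psi> w v)"
      unfolding G_def by (intro linear_on_lin linear_on_sum l w \<psi> p_in_carrier)+
    show "linear_on (\<lambda>v. \<psi> (tensor_lift H (comult H (p y)) (f v w)))" "linear_on (\<lambda>v. \<psi> (tensor_lift H (comult H (p y)) (f w v)))"
      by (rule linear_on_cong[OF l'(1)], simp add: G w \<psi>) (rule linear_on_cong[OF l'(2)], simp add: G w \<psi>)
  qed
  have b: "bilin H H (\<lambda>z. \<psi> (tensor_lift H (comult H (p y)) (f (fst z) (snd z))))" if \<psi>: "\<psi> \<in> linear_forms H" for \<psi>
    unfolding bilin_linear_on fst_conv snd_conv using lin[OF _ \<psi>] by blast
  show "?T \<in> carrier H" by (rule tensor_lift_p(1)) (auto intro: c b)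
  show "\<psi> ?T = ev x (\<lambda>w. \<Sum>(u, v)\<in>wspl w. ev y (\<lambda>w'. \<Sum>(u', v')\<in>wspl w'. \<psi> (f (p (wd u)) (p (wd v)) (p (wd u')) (p (wd v')))))"
    if \<psi>: "\<psi> \<in> linear_forms H"
  proof -
    have "\<psi> ?T = ev x (\<lambda>w. \<Sum>(u, v)\<in>wspl w. \<psi> (tensor_lift H (comult H (p y)) (f (p (wd u)) (p (wd v)))))"
      by (rule tensor_lift_p(2)) (auto intro: c b \<psi>)
    then show ?thesis by (simp add: in1[OF \<psi>])
  qed
qed

end

section \<open>Lazy cohomology in terms of words\<close>

locale uq_presentation = root_of_unity q N + presentation H p "root_of_unity.rels q N"
  for q :: "'k::field" and N :: nat and H :: "('k, 'a, 'm) bialgebra_scheme" and p :: "'k mat_free \<Rightarrow> 'a"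
begin

lemma linear_form_on: "m \<in> linear_forms H \<Longrightarrow> linear_on m"
  by (simp add: linear_forms_iff)

lemma bilinear_form_on:
  assumes "b \<in> bilinear_forms H" "w \<in> carrier H"
  shows "linear_on (\<lambda>v. b (v, w))" "linear_on (\<lambda>v. b (w, v))"
  using assms by (simp_all add: bilinear_forms_iff bilin_linear_on)

lemma bilinI:
  assumes "\<And>w. w \<in> carrier H \<Longrightarrow> linear_on (\<lambda>v. h (v, w))" "\<And>w. w \<in> carrier H \<Longrightarrow> linear_on (\<lambda>v. h (w, v))"
  shows "bilin H H h"
  using assms by (simp add: bilin_linear_on)

lemma bilin_cong:
  assumes "bilin H H h" "\<And>a c. a \<in> carrier H \<Longrightarrow> c \<in> carrier H \<Longrightarrow> h (a, c) = h' (a, c)"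
  shows "bilin H H h'"
proof (rule bilinI)
  fix w assume w: "w \<in> carrier H"
  have l: "linear_on (\<lambda>v. h (v, w))" "linear_on (\<lambda>v. h (w, v))"
    using assms(1) w by (simp_all add: bilin_linear_on)
  show "linear_on (\<lambda>v. h' (v, w))" by (rule linear_on_cong[OF l(1)]) (rule assms(2)[OF _ w])
  show "linear_on (\<lambda>v. h' (w, v))" by (rule linear_on_cong[OF l(2)]) (rule assms(2)[OF w])
qed

lemma bilin_times:
  assumes "linear_on g" "linear_on h"
  shows "bilin H H (\<lambda>z. g (fst z) * h (snd z))" "bilin H H (\<lambda>z. g (snd z) * h (fst z))"
  by (rule bilinI; simp only: fst_conv snd_conv; intro linear_on_cmult linear_on_mult_right assms)+

lemma p_word_mult [simp]: "p (wd u) \<otimes>\<^bsub>H\<^esub> p (wd v) = p (wd (u @ v))"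
  by (simp add: p_mult)

lemma conv1_eq:
  assumes "m \<in> linear_forms H" "n \<in> linear_forms H"
  shows "conv1 H m n = form_of (conv wspl (word_form m) (word_form n))"
proof (rule extensionalityI[of _ "carrier H"])
  fix A assume "A \<in> carrier H"
  then obtain x where A: "A = p x" by (rule p_cases)
  have "bilin H H (\<lambda>z. m (fst z) * n (snd z))"
    by (intro bilin_times linear_form_on assms)
  from tensor_form_p[OF this, of x]
  have "conv1 H m n A = ev x (conv wspl (word_form m) (word_form n))"
    by (simp add: conv1_def A conv_def word_form_def)
  then show "conv1 H m n A = form_of (conv wspl (word_form m) (word_form n)) A"
    by (simp add: A form_of_p annih_conv[OF rels_coideal] word_form_annih assms)
qed (simp_all add: conv1_def form_of_def)

lemma unit1_eq: "unit1 H = form_of wcounit"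
proof (rule extensionalityI[of _ "carrier H"])
  fix A assume "A \<in> carrier H"
  then obtain x where A: "A = p x" by (rule p_cases)
  show "unit1 H A = form_of wcounit A"
    by (simp add: A unit1_def counit_p form_of_p coideal_counit[OF rels_coideal])
qed (simp_all add: unit1_def form_of_def)

lemma is_conv_inverse1_iff:
  assumes m: "m \<in> linear_forms H"
  shows "is_conv_inverse1 H m n \<longleftrightarrow> n \<in> linear_forms H \<and>
    conv wspl (word_form m) (word_form n) = wcounit \<and> conv wspl (word_form n) (word_form m) = wcounit"
proof -
  have "conv1 H a b = unit1 H \<longleftrightarrow> conv wspl (word_form a) (word_form b) = wcounit"
    if "a \<in> linear_forms H" "b \<in> linear_forms H" for a b
    unfolding conv1_eq[OF that] unit1_eq
    by (metis word_form_of annih_conv[OF rels_coideal] word_form_annih that coideal_counit[OF rels_coideal])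
  then show ?thesis using m unfolding is_conv_inverse1_def by blast
qed

text \<open>
  The inverse is unique, so that the definite description denotes the functional that comes from
  words.
\<close>

lemma conv_inverse1_eq:
  assumes m: "m \<in> linear_forms H" and n: "lazy_pair (word_form m) n"
  shows "conv_inverse1 H m = form_of n"
  unfolding conv_inverse1_def
proof (rule the_equality)
  have an: "annih rels n" and i: "conv wspl (word_form m) n = wcounit" "conv wspl n (word_form m) = wcounit"
    using n by (simp_all add: lazy_pair_def)
  show "is_conv_inverse1 H m (form_of n)"
    unfolding is_conv_inverse1_iff[OF m] by (simp add: form_of_linear an i)
  fix n' assume "is_conv_inverse1 H m n'"
  then have n': "n' \<in> linear_forms H" "conv wspl (word_form n') (word_form m) = wcounit"
    unfolding is_conv_inverse1_iff[OF m] by simp_all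
  have "word_form n' = n" by (rule W1.inverse_unique[OF n'(2) i(1)])
  then show "n' = form_of n" using form_of_word_form[OF n'(1)] by simp
qed

lemma conv2_ev:
  assumes "b \<in> bilinear_forms H" "c \<in> bilinear_forms H"
  shows "tensor_form (comult H (p x)) (\<lambda>x1 x2. tensor_form (comult H (p y)) (\<lambda>y1 y2. b (x1, y1) * c (x2, y2))) =
    ev x (\<lambda>w. ev y (\<lambda>w'. conv wspl2 (word_form2 b) (word_form2 c) (w, w')))"
proof -
  have 1: "bilin H H (\<lambda>z. b (u, fst z) * c (v, snd z))" "bilin H H (\<lambda>z. b (fst z, u) * c (snd z, v))"
    if "u \<in> carrier H" "v \<in> carrier H" for u v
    using bilin_times(1)[OF bilinear_form_on(2)[OF assms(1) that(1)] bilinear_form_on(2)[OF assms(2) that(2)]]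
      bilin_times(1)[OF bilinear_form_on(1)[OF assms(1) that(1)] bilinear_form_on(1)[OF assms(2) that(2)]] by simp_all
  show ?thesis
    using tensor_form2_p[where f = "\<lambda>x1 x2 y1 y2. b (x1, y1) * c (x2, y2)", OF 1(1) 1(2), of x y]
    by (simp add: sum_ev conv_pspl word_form2_def)
qed

lemma conv2_eq:
  assumes "b \<in> bilinear_forms H" "c \<in> bilinear_forms H"
  shows "conv2 H b c = form2_of (conv wspl2 (word_form2 b) (word_form2 c))"
proof (rule extensionalityI[of _ "carrier H \<times> carrier H"])
  fix Z assume "Z \<in> carrier H \<times> carrier H"
  then obtain x y where Z: "Z = (p x, p y)" by (auto simp: carrier_eq)
  show "conv2 H b c Z = form2_of (conv wspl2 (word_form2 b) (word_form2 c)) Z"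
    unfolding Z by (simp add: conv2_def conv2_ev[OF assms] form2_of_p annih2_conv[OF rels_coideal] word_form2_annih assms)
qed (simp_all add: conv2_def form2_of_def)

lemma annih2_unit: "annih2 rels (tens wcounit wcounit)"
  by (intro annih2_tens coideal_counit rels_coideal)

lemma unit2_eq: "unit2 H = form2_of (tens wcounit wcounit)"
proof (rule extensionalityI[of _ "carrier H \<times> carrier H"])
  fix Z assume "Z \<in> carrier H \<times> carrier H"
  then obtain x y where Z: "Z = (p x, p y)" by (auto simp: carrier_eq)
  show "unit2 H Z = form2_of (tens wcounit wcounit) Z"
    unfolding Z form2_of_p[OF annih2_unit] by (simp add: unit2_def counit_p lin_fun_cmult lin_fun_mult_right)
qed (simp_all add: unit2_def form2_of_def)

lemma conv2_unit_iff:
  assumes "b \<in> bilinear_forms H" "c \<in> bilinear_forms H"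
  shows "conv2 H b c = unit2 H \<longleftrightarrow> conv wspl2 (word_form2 b) (word_form2 c) = tens wcounit wcounit"
  unfolding conv2_eq[OF assms] unit2_eq
  by (metis word_form2_of annih2_conv[OF rels_coideal] word_form2_annih assms annih2_unit)

lemma conv_invertible2_iff:
  assumes b: "b \<in> bilinear_forms H"
  shows "conv_invertible2 H b \<longleftrightarrow> (\<exists>t. annih2 rels t \<and>
     conv wspl2 (word_form2 b) t = tens wcounit wcounit \<and> conv wspl2 t (word_form2 b) = tens wcounit wcounit)"
proof
  assume "conv_invertible2 H b"
  then obtain c where "c \<in> bilinear_forms H" "conv2 H b c = unit2 H" "conv2 H c b = unit2 H"
    by (auto simp: conv_invertible2_def)
  then show "\<exists>t. annih2 rels t \<and> conv wspl2 (word_form2 b) t = tens wcounit wcounit \<and>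
      conv wspl2 t (word_form2 b) = tens wcounit wcounit"
    using conv2_unit_iff b by (intro exI[of _ "word_form2 c"]) (simp add: word_form2_annih)
next
  assume "\<exists>t. annih2 rels t \<and> conv wspl2 (word_form2 b) t = tens wcounit wcounit \<and>
      conv wspl2 t (word_form2 b) = tens wcounit wcounit"
  then obtain t where t: "annih2 rels t" "conv wspl2 (word_form2 b) t = tens wcounit wcounit"
    "conv wspl2 t (word_form2 b) = tens wcounit wcounit" by blast
  have ft: "form2_of t \<in> bilinear_forms H" by (rule form2_of_bilinear[OF t(1)])
  show "conv_invertible2 H b"
    unfolding conv_invertible2_def
    by (rule bexI[OF _ ft]) (simp add: conv2_unit_iff b ft t)
qed

text \<open>
  Both sides of the cocycle condition at arbitrary elements are linear extensions of its sides at
  words. So it suffices to have the condition for words, and conversely.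
\<close>

lemma cocycle_left_ev:
  assumes b: "b \<in> bilinear_forms H"
  shows "tensor_form (comult H (p x)) (\<lambda>x1 x2. tensor_form (comult H (p y)) (\<lambda>y1 y2. b (x1, y1) * b (x2 \<otimes>\<^bsub>H\<^esub> y2, p z))) =
    ev x (\<lambda>xx. ev y (\<lambda>yy. ev z (\<lambda>zz. conv wspl2 (word_form2 b) (\<lambda>(x, y). word_form2 b (x @ y, zz)) (xx, yy))))"
proof -
  have e: "b (p (wd u), p z) = ev z (\<lambda>zz. word_form2 b (u, zz))" for u
    using bilinear_form_p[OF b, of "wd u" z] by simp
  have l: "linear_on (\<lambda>v. b (v \<otimes>\<^bsub>H\<^esub> w, p z))" "linear_on (\<lambda>v. b (w \<otimes>\<^bsub>H\<^esub> v, p z))" if "w \<in> carrier H" for w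
    using linear_on_prod[OF bilinear_form_on(1)[OF b p_in_carrier] that] by blast+
  have 1: "bilin H H (\<lambda>a. b (u, fst a) * b (v \<otimes>\<^bsub>H\<^esub> snd a, p z))" "bilin H H (\<lambda>a. b (fst a, u) * b (snd a \<otimes>\<^bsub>H\<^esub> v, p z))"
    if "u \<in> carrier H" "v \<in> carrier H" for u v
    using bilin_times(1)[OF bilinear_form_on(2)[OF b that(1)] l(2)[OF that(2)]]
      bilin_times(1)[OF bilinear_form_on(1)[OF b that(1)] l(1)[OF that(2)]] by simp_all
  show ?thesis
    using tensor_form2_p[where f = "\<lambda>x1 x2 y1 y2. b (x1, y1) * b (x2 \<otimes>\<^bsub>H\<^esub> y2, p z)", OF 1(1) 1(2), of x y]
    by (simp add: e lin_fun_cmult[symmetric] sum_ev conv_pspl) (simp add: word_form2_def)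
qed

lemma cocycle_right_ev:
  assumes b: "b \<in> bilinear_forms H"
  shows "tensor_form (comult H (p y)) (\<lambda>y1 y2. tensor_form (comult H (p z)) (\<lambda>z1 z2. b (y1, z1) * b (p x, y2 \<otimes>\<^bsub>H\<^esub> z2))) =
    ev x (\<lambda>xx. ev y (\<lambda>yy. ev z (\<lambda>zz. conv wspl2 (word_form2 b) (\<lambda>(y, z). word_form2 b (xx, y @ z)) (yy, zz))))"
proof -
  have e: "b (p x, p (wd u)) = ev x (\<lambda>xx. word_form2 b (xx, u))" for u
    using bilinear_form_p[OF b, of x "wd u"] by simp
  have l: "linear_on (\<lambda>v. b (p x, v \<otimes>\<^bsub>H\<^esub> w))" "linear_on (\<lambda>v. b (p x, w \<otimes>\<^bsub>H\<^esub> v))" if "w \<in> carrier H" for w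
    using linear_on_prod[OF bilinear_form_on(2)[OF b p_in_carrier] that] by blast+
  have 1: "bilin H H (\<lambda>a. b (u, fst a) * b (p x, v \<otimes>\<^bsub>H\<^esub> snd a))" "bilin H H (\<lambda>a. b (fst a, u) * b (p x, snd a \<otimes>\<^bsub>H\<^esub> v))"
    if "u \<in> carrier H" "v \<in> carrier H" for u v
    using bilin_times(1)[OF bilinear_form_on(2)[OF b that(1)] l(2)[OF that(2)]]
      bilin_times(1)[OF bilinear_form_on(1)[OF b that(1)] l(1)[OF that(2)]] by simp_all
  have "tensor_form (comult H (p y)) (\<lambda>y1 y2. tensor_form (comult H (p z)) (\<lambda>z1 z2. b (y1, z1) * b (p x, y2 \<otimes>\<^bsub>H\<^esub> z2))) =
     ev y (\<lambda>yy. ev z (\<lambda>zz. ev x (\<lambda>xx. conv wspl2 (word_form2 b) (\<lambda>(y, z). word_form2 b (xx, y @ z)) (yy, zz))))"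
    using tensor_form2_p[where f = "\<lambda>y1 y2 z1 z2. b (y1, z1) * b (p x, y2 \<otimes>\<^bsub>H\<^esub> z2)", OF 1(1) 1(2), of y z]
    by (simp add: e lin_fun_cmult[symmetric] sum_ev conv_pspl) (simp add: word_form2_def)
  also have "\<dots> = ev x (\<lambda>xx. ev y (\<lambda>yy. ev z (\<lambda>zz. conv wspl2 (word_form2 b) (\<lambda>(y, z). word_form2 b (xx, y @ z)) (yy, zz))))"
    by (subst (1 2) lin_swap) (rule refl)
  finally show ?thesis .
qed

text \<open>
  The two sides of the laziness condition, seen through a linear form \<open>f\<close>, are the convolutions of the
  cocycle with the pullback of \<open>f\<close> in the two orders.
\<close>

lemma lazy_ev:
  assumes b: "b \<in> bilinear_forms H" and f: "f \<in> linear_forms H"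
  defines "L \<equiv> \<lambda>x y. tensor_lift H (comult H (p x)) (\<lambda>x1 x2. tensor_lift H (comult H (p y)) (\<lambda>y1 y2. b (x1, y1) \<odot>\<^bsub>H\<^esub> (x2 \<otimes>\<^bsub>H\<^esub> y2)))"
    and "R \<equiv> \<lambda>x y. tensor_lift H (comult H (p x)) (\<lambda>x1 x2. tensor_lift H (comult H (p y)) (\<lambda>y1 y2. b (x2, y2) \<odot>\<^bsub>H\<^esub> (x1 \<otimes>\<^bsub>H\<^esub> y1)))"
  shows "L x y \<in> carrier H" "R x y \<in> carrier H"
    "f (L x y) = ev x (\<lambda>xx. ev y (\<lambda>yy. conv wspl2 (word_form2 b) (pullback (word_form f)) (xx, yy)))"
    "f (R x y) = ev x (\<lambda>xx. ev y (\<lambda>yy. conv wspl2 (pullback (word_form f)) (word_form2 b) (xx, yy)))"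
proof -
  have s: "f (c \<odot>\<^bsub>H\<^esub> (x \<otimes>\<^bsub>H\<^esub> y)) = c * f (x \<otimes>\<^bsub>H\<^esub> y)" if "x \<in> carrier H" "y \<in> carrier H" "f \<in> linear_forms H" for c x y f
    using that by (simp add: linear_form_smult)
  have bl: "bilin H H (\<lambda>z. f (b (x1, fst z) \<odot>\<^bsub>H\<^esub> (x2 \<otimes>\<^bsub>H\<^esub> snd z)))"
    "bilin H H (\<lambda>z. f (b (fst z, x1) \<odot>\<^bsub>H\<^esub> (snd z \<otimes>\<^bsub>H\<^esub> x2)))"
    "bilin H H (\<lambda>z. f (b (x2, snd z) \<odot>\<^bsub>H\<^esub> (x1 \<otimes>\<^bsub>H\<^esub> fst z)))"
    "bilin H H (\<lambda>z. f (b (snd z, x2) \<odot>\<^bsub>H\<^esub> (fst z \<otimes>\<^bsub>H\<^esub> x1)))"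
    if x: "x1 \<in> carrier H" "x2 \<in> carrier H" and f: "f \<in> linear_forms H" for x1 x2 f
  proof -
    have 1: "linear_on (\<lambda>v. f (v \<otimes>\<^bsub>H\<^esub> x2))" "linear_on (\<lambda>v. f (x2 \<otimes>\<^bsub>H\<^esub> v))" "linear_on (\<lambda>v. f (v \<otimes>\<^bsub>H\<^esub> x1))" "linear_on (\<lambda>v. f (x1 \<otimes>\<^bsub>H\<^esub> v))"
      using linear_on_prod[OF linear_form_on[OF f]] x by blast+
    note 2 = bilinear_form_on[OF b x(1)] bilinear_form_on[OF b x(2)]
    show "bilin H H (\<lambda>z. f (b (x1, fst z) \<odot>\<^bsub>H\<^esub> (x2 \<otimes>\<^bsub>H\<^esub> snd z)))"
      by (rule bilin_cong[OF bilin_times(1)[OF 2(2) 1(2)]]) (simp add: s x f)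
    show "bilin H H (\<lambda>z. f (b (fst z, x1) \<odot>\<^bsub>H\<^esub> (snd z \<otimes>\<^bsub>H\<^esub> x2)))"
      by (rule bilin_cong[OF bilin_times(1)[OF 2(1) 1(1)]]) (simp add: s x f)
    show "bilin H H (\<lambda>z. f (b (x2, snd z) \<odot>\<^bsub>H\<^esub> (x1 \<otimes>\<^bsub>H\<^esub> fst z)))"
      by (rule bilin_cong[OF bilin_times(2)[OF 2(4) 1(4)]]) (simp add: s x f)
    show "bilin H H (\<lambda>z. f (b (snd z, x2) \<odot>\<^bsub>H\<^esub> (fst z \<otimes>\<^bsub>H\<^esub> x1)))"
      by (rule bilin_cong[OF bilin_times(2)[OF 2(3) 1(3)]]) (simp add: s x f)
  qed
  show "L x y \<in> carrier H" unfolding L_def by (rule tensor_lift2_p(1)) (use bl in auto)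
  show "R x y \<in> carrier H" unfolding R_def by (rule tensor_lift2_p(1)) (use bl in auto)
  have "f (L x y) = ev x (\<lambda>w. \<Sum>(u, v)\<in>wspl w. ev y (\<lambda>w'. \<Sum>(u', v')\<in>wspl w'.
      f (b (p (wd u), p (wd u')) \<odot>\<^bsub>H\<^esub> (p (wd v) \<otimes>\<^bsub>H\<^esub> p (wd v')))))"
    unfolding L_def by (rule tensor_lift2_p(2)) (use bl f in auto)
  then show "f (L x y) = ev x (\<lambda>xx. ev y (\<lambda>yy. conv wspl2 (word_form2 b) (pullback (word_form f)) (xx, yy)))"
    by (simp add: linear_form_smult[OF f] sum_ev conv_pspl word_form2_def word_form_def)
  have "f (R x y) = ev x (\<lambda>w. \<Sum>(u, v)\<in>wspl w. ev y (\<lambda>w'. \<Sum>(u', v')\<in>wspl w'.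
      f (b (p (wd v), p (wd v')) \<odot>\<^bsub>H\<^esub> (p (wd u) \<otimes>\<^bsub>H\<^esub> p (wd u')))))"
    unfolding R_def by (rule tensor_lift2_p(2)) (use bl f in auto)
  then show "f (R x y) = ev x (\<lambda>xx. ev y (\<lambda>yy. conv wspl2 (pullback (word_form f)) (word_form2 b) (xx, yy)))"
    by (simp add: linear_form_smult[OF f] sum_ev conv_pspl word_form2_def word_form_def mult.commute)
qed

lemma lazy_functionals_iff:
  "m \<in> lazy_functionals H \<longleftrightarrow> m \<in> linear_forms H \<and> (\<exists>n. lazy_pair (word_form m) n)"
proof (cases "m \<in> linear_forms H")
  case True
  let ?L = "\<lambda>x. tensor_lift H (comult H (p x)) (\<lambda>x1 x2. m x1 \<odot>\<^bsub>H\<^esub> x2)"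
  let ?R = "\<lambda>x. tensor_lift H (comult H (p x)) (\<lambda>x1 x2. m x2 \<odot>\<^bsub>H\<^esub> x1)"
  have bl: "bilin H H (\<lambda>z. f (m (fst z) \<odot>\<^bsub>H\<^esub> snd z))" "bilin H H (\<lambda>z. f (m (snd z) \<odot>\<^bsub>H\<^esub> fst z))"
    if f: "f \<in> linear_forms H" for f
    by (rule bilin_cong[OF bilin_times(1)[OF linear_form_on[OF True] linear_form_on[OF f]]], simp add: linear_form_smult f)
      (rule bilin_cong[OF bilin_times(2)[OF linear_form_on[OF True] linear_form_on[OF f]]], simp add: linear_form_smult f)
  have cl: "?L x \<in> carrier H" "?R x \<in> carrier H" for x
    by (rule tensor_lift_p(1); use bl in simp)+
  have ev: "f (?L x) = ev x (conv wspl (word_form m) (word_form f))" "f (?R x) = ev x (conv wspl (word_form f) (word_form m))"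
    if f: "f \<in> linear_forms H" for f x
  proof -
    have "f (?L x) = ev x (\<lambda>w. \<Sum>(u, v)\<in>wspl w. f (m (p (wd u)) \<odot>\<^bsub>H\<^esub> p (wd v)))"
      by (rule tensor_lift_p(2)) (use bl f in auto)
    then show "f (?L x) = ev x (conv wspl (word_form m) (word_form f))"
      by (simp add: linear_form_smult[OF f] conv_def word_form_def)
    have "f (?R x) = ev x (\<lambda>w. \<Sum>(u, v)\<in>wspl w. f (m (p (wd v)) \<odot>\<^bsub>H\<^esub> p (wd u)))"
      by (rule tensor_lift_p(2)) (use bl f in auto)
    then show "f (?R x) = ev x (conv wspl (word_form f) (word_form m))"
      by (simp add: linear_form_smult[OF f] conv_def word_form_def mult.commute)
  qed
  have lazy: "(\<forall>x\<in>carrier H. tensor_lift H (comult H x) (\<lambda>x1 x2. m x1 \<odot>\<^bsub>H\<^esub> x2) =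
      tensor_lift H (comult H x) (\<lambda>x1 x2. m x2 \<odot>\<^bsub>H\<^esub> x1)) \<longleftrightarrow> central (word_form m)"
  proof
    assume *: "\<forall>x\<in>carrier H. tensor_lift H (comult H x) (\<lambda>x1 x2. m x1 \<odot>\<^bsub>H\<^esub> x2) =
      tensor_lift H (comult H x) (\<lambda>x1 x2. m x2 \<odot>\<^bsub>H\<^esub> x1)"
    show "central (word_form m)"
      unfolding central_def
    proof (intro allI impI ext)
      fix f w assume f: "annih rels f"
      have "form_of f (?L (wd w)) = form_of f (?R (wd w))" using * by simp
      then show "conv wspl (word_form m) f w = conv wspl f (word_form m) w"
        unfolding ev[OF form_of_linear[OF f]] by (simp add: f)
    qed
  next
    assume c: "central (word_form m)"
    have "?L x = ?R x" for x
      by (rule eq_if_linear_forms_agree[OF cl]) (simp add: ev centralD[OF c word_form_annih])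
    then show "\<forall>x\<in>carrier H. tensor_lift H (comult H x) (\<lambda>x1 x2. m x1 \<odot>\<^bsub>H\<^esub> x2) =
      tensor_lift H (comult H x) (\<lambda>x1 x2. m x2 \<odot>\<^bsub>H\<^esub> x1)"
      by (simp add: carrier_eq)
  qed
  have one: "m \<one>\<^bsub>H\<^esub> = word_form m []"
    by (simp add: word_form_def p_one one_eq_wd)
  have inv: "(\<exists>n. is_conv_inverse1 H m n) \<longleftrightarrow> (\<exists>n. annih rels n \<and> conv wspl (word_form m) n = wcounit \<and>
      conv wspl n (word_form m) = wcounit)"
  proof
    assume "\<exists>n. is_conv_inverse1 H m n"
    then show "\<exists>n. annih rels n \<and> conv wspl (word_form m) n = wcounit \<and> conv wspl n (word_form m) = wcounit"
      unfolding is_conv_inverse1_iff[OF True] using word_form_annih by blast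
  next
    assume "\<exists>n. annih rels n \<and> conv wspl (word_form m) n = wcounit \<and> conv wspl n (word_form m) = wcounit"
    then obtain n where "annih rels n" "conv wspl (word_form m) n = wcounit" "conv wspl n (word_form m) = wcounit"
      by blast
    then have "is_conv_inverse1 H m (form_of n)"
      unfolding is_conv_inverse1_iff[OF True] by (simp add: form_of_linear)
    then show "\<exists>n. is_conv_inverse1 H m n" by blast
  qed
  have n1: "n [] = 1" if "word_form m [] = 1" "conv wspl (word_form m) n = wcounit" for n
    using fun_cong[OF that(2), of "[]"] that(1) by simp
  show ?thesis
    unfolding lazy_functionals_def mem_Collect_eq lazy one inv lazy_pair_def
    using True word_form_annih[OF True] n1 central_inverse by metis
qed (simp add: lazy_functionals_def)

lemma lazy_cocycles_iff:
  "b \<in> lazy_cocycles H \<longleftrightarrow> b \<in> bilinear_forms H \<and> (\<exists>t. lazy_cocycle_pair (word_form2 b) t)"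
proof (cases "b \<in> bilinear_forms H")
  case True
  let ?s = "word_form2 b"
  have norm_ev: "b (p x, \<one>\<^bsub>H\<^esub>) = ev x (\<lambda>u. ?s (u, []))" "b (\<one>\<^bsub>H\<^esub>, p x) = ev x (\<lambda>u. ?s ([], u))" for x
    using bilinear_form_p[OF True, of x 1] bilinear_form_p[OF True, of 1 x] by (simp_all add: p_one)
  have norm: "(\<forall>x\<in>carrier H. b (x, \<one>\<^bsub>H\<^esub>) = counit H x \<and> b (\<one>\<^bsub>H\<^esub>, x) = counit H x) \<longleftrightarrow>
      (\<forall>w. ?s (w, []) = wcounit w \<and> ?s ([], w) = wcounit w)"
  proof
    assume *: "\<forall>x\<in>carrier H. b (x, \<one>\<^bsub>H\<^esub>) = counit H x \<and> b (\<one>\<^bsub>H\<^esub>, x) = counit H x"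
    show "\<forall>w. ?s (w, []) = wcounit w \<and> ?s ([], w) = wcounit w"
    proof
      fix w show "?s (w, []) = wcounit w \<and> ?s ([], w) = wcounit w"
        using *[rule_format, OF p_in_carrier[of "wd w"]] unfolding norm_ev counit_p by simp
    qed
  qed (simp add: carrier_eq norm_ev counit_p)
  have cocycle: "(\<forall>x\<in>carrier H. \<forall>y\<in>carrier H. \<forall>z\<in>carrier H.
        tensor_form (comult H x) (\<lambda>x1 x2. tensor_form (comult H y) (\<lambda>y1 y2. b (x1, y1) * b (x2 \<otimes>\<^bsub>H\<^esub> y2, z))) =
        tensor_form (comult H y) (\<lambda>y1 y2. tensor_form (comult H z) (\<lambda>z1 z2. b (y1, z1) * b (x, y2 \<otimes>\<^bsub>H\<^esub> z2)))) \<longleftrightarrow>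
      (\<forall>x y z. conv wspl2 ?s (\<lambda>(x, y). ?s (x @ y, z)) (x, y) = conv wspl2 ?s (\<lambda>(y, z). ?s (x, y @ z)) (y, z))"
    (is "?A \<longleftrightarrow> ?B")
  proof
    assume A: ?A
    show ?B
    proof (intro allI)
      fix x y z
      show "conv wspl2 ?s (\<lambda>(x, y). ?s (x @ y, z)) (x, y) = conv wspl2 ?s (\<lambda>(y, z). ?s (x, y @ z)) (y, z)"
        using A[rule_format, OF p_in_carrier[of "wd x"] p_in_carrier[of "wd y"] p_in_carrier[of "wd z"]]
        unfolding cocycle_left_ev[OF True] cocycle_right_ev[OF True] by simp
    qed
  next
    assume B: ?B
    then show ?A
      unfolding carrier_eq by (intro ballI; elim rangeE; simp only: cocycle_left_ev[OF True] cocycle_right_ev[OF True])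
  qed
  have lazy: "(\<forall>x\<in>carrier H. \<forall>y\<in>carrier H.
       tensor_lift H (comult H x) (\<lambda>x1 x2. tensor_lift H (comult H y) (\<lambda>y1 y2. b (x1, y1) \<odot>\<^bsub>H\<^esub> (x2 \<otimes>\<^bsub>H\<^esub> y2))) =
       tensor_lift H (comult H x) (\<lambda>x1 x2. tensor_lift H (comult H y) (\<lambda>y1 y2. b (x2, y2) \<odot>\<^bsub>H\<^esub> (x1 \<otimes>\<^bsub>H\<^esub> y1)))) \<longleftrightarrow>
      (\<forall>f. annih rels f \<longrightarrow> conv wspl2 ?s (pullback f) = conv wspl2 (pullback f) ?s)" (is "?A \<longleftrightarrow> ?B")
  proof
    assume A: ?A
    show ?B
    proof (intro allI impI ext, clarify)
      fix f x y assume f: "annih rels f"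
      show "conv wspl2 ?s (pullback f) (x, y) = conv wspl2 (pullback f) ?s (x, y)"
        using arg_cong[OF A[rule_format, OF p_in_carrier[of "wd x"] p_in_carrier[of "wd y"]], of "form_of f"]
        unfolding lazy_ev(3,4)[OF True form_of_linear[OF f]] by (simp add: f)
    qed
  next
    assume B: ?B
    have fB: "conv wspl2 ?s (pullback (word_form f)) = conv wspl2 (pullback (word_form f)) ?s" if "f \<in> linear_forms H" for f
      using B word_form_annih[OF that] by blast
    have e: "form_of wcounit \<in> linear_forms H" by (intro form_of_linear coideal_counit rels_coideal)
    show ?A
      unfolding carrier_eq
      by (intro ballI; elim rangeE; hypsubst; rule eq_if_linear_forms_agree[OF lazy_ev(1,2)[OF True e]])
        (simp only: lazy_ev(3,4)[OF True] fB)
  qed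
  show ?thesis
    unfolding lazy_cocycles_def cocycles_def mem_Collect_eq conv_invertible2_iff[OF True] norm cocycle lazy
      lazy_cocycle_pair_def
    using True word_form2_annih[OF True] by blast
qed (simp add: lazy_cocycles_def cocycles_def)

lemma coboundary_eq:
  assumes m: "m \<in> linear_forms H" and n: "lazy_pair (word_form m) n"
  shows "coboundary H m = form2_of (boundary (word_form m) n)"
proof (rule extensionalityI[of _ "carrier H \<times> carrier H"])
  have an: "annih rels n" using n by (simp add: lazy_pair_def)
  have i: "conv_inverse1 H m = form_of n" by (rule conv_inverse1_eq[OF m n])
  have f: "form_of n \<in> linear_forms H" by (rule form_of_linear[OF an])
  have 1: "bilin H H (\<lambda>z. (m u * m (fst z)) * form_of n (v \<otimes>\<^bsub>H\<^esub> snd z))"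
    "bilin H H (\<lambda>z. (m (fst z) * m u) * form_of n (snd z \<otimes>\<^bsub>H\<^esub> v))"
    if "u \<in> carrier H" "v \<in> carrier H" for u v
    using bilin_times(1)[OF linear_on_cmult[OF linear_form_on[OF m], of "m u"] linear_on_prod(2)[OF linear_form_on[OF f] that(2)]]
      bilin_times(1)[OF linear_on_mult_right[OF linear_form_on[OF m], of "m u"] linear_on_prod(1)[OF linear_form_on[OF f] that(2)]]
    by simp_all
  have nw: "form_of n (p (wd w)) = n w" for w by (simp add: form_of_p[OF an])
  have ab: "annih2 rels (boundary (word_form m) n)"
    using boundary_is_lazy_cocycle[OF n] by (simp add: lazy_cocycle_pair_def)
  fix zz assume "zz \<in> carrier H \<times> carrier H"
  then obtain x y where zz: "zz = (p x, p y)" by (auto simp: carrier_eq)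
  have "coboundary H m zz = ev x (\<lambda>w. ev y (\<lambda>w'. boundary (word_form m) n (w, w')))"
    using tensor_form2_p[where f = "\<lambda>x1 x2 y1 y2. m x1 * m y1 * form_of n (x2 \<otimes>\<^bsub>H\<^esub> y2)", OF 1(1) 1(2), of x y]
    by (simp add: zz coboundary_def i nw sum_ev boundary_def conv_pspl word_form_def)
  then show "coboundary H m zz = form2_of (boundary (word_form m) n) zz"
    by (simp add: zz form2_of_p[OF ab])
qed (simp_all add: coboundary_def form2_of_def)

lemma boundary_bilinear: "lazy_pair m n \<Longrightarrow> form2_of (boundary m n) \<in> bilinear_forms H"
  using boundary_is_lazy_cocycle form2_of_bilinear unfolding lazy_cocycle_pair_def by blast

lemma word_form2_boundary: "lazy_pair m n \<Longrightarrow> word_form2 (form2_of (boundary m n)) = boundary m n"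
  using boundary_is_lazy_cocycle word_form2_of unfolding lazy_cocycle_pair_def by blast

lemma coboundaries_eq: "coboundary H ` lazy_functionals H = {form2_of (boundary m n) | m n. lazy_pair m n}"
proof (intro equalityI subsetI)
  fix b assume "b \<in> coboundary H ` lazy_functionals H"
  then obtain m n where "b = coboundary H m" "m \<in> linear_forms H" "lazy_pair (word_form m) n"
    by (auto simp: lazy_functionals_iff)
  then show "b \<in> {form2_of (boundary m n) | m n. lazy_pair m n}"
    using coboundary_eq by blast
next
  fix b assume "b \<in> {form2_of (boundary m n) | m n. lazy_pair m n}"
  then obtain m n where b: "b = form2_of (boundary m n)" and mn: "lazy_pair m n" by blast
  have am: "annih rels m" using mn by (simp add: lazy_pair_def)
  have "form_of m \<in> lazy_functionals H" "b = coboundary H (form_of m)"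
    using mn coboundary_eq[OF form_of_linear[OF am]] by (auto simp: lazy_functionals_iff form_of_linear am b)
  then show "b \<in> coboundary H ` lazy_functionals H" by blast
qed

text \<open>
  The two inclusions are the triviality theorem for words and the fact that coboundaries of lazy
  functionals are lazy cocycles.
\<close>

lemma lazy_cocycles_eq:
  assumes sqrt: "\<And>x :: 'k. \<exists>c. c ^ 2 = x"
  shows "lazy_cocycles H = {form2_of (boundary m n) | m n. lazy_pair m n}"
proof (intro equalityI subsetI)
  fix b assume "b \<in> lazy_cocycles H"
  then obtain t where b: "b \<in> bilinear_forms H" "lazy_cocycle_pair (word_form2 b) t"
    by (auto simp: lazy_cocycles_iff)
  then obtain m n where mn: "lazy_pair m n" "word_form2 b = boundary m n"
    using lazy_cocycle_is_boundary[OF b(2) sqrt] by blast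
  then show "b \<in> {form2_of (boundary m n) | m n. lazy_pair m n}"
    using form2_of_word_form2[OF b(1)] by auto
next
  fix b assume "b \<in> {form2_of (boundary m n) | m n. lazy_pair m n}"
  then obtain m n where "b = form2_of (boundary m n)" "lazy_pair m n" by blast
  then show "b \<in> lazy_cocycles H"
    unfolding lazy_cocycles_iff by (metis boundary_bilinear boundary_is_lazy_cocycle word_form2_boundary)
qed

lemma conv2_boundary:
  assumes "lazy_pair m n" "lazy_pair m' n'"
  shows "conv2 H (form2_of (boundary m n)) (form2_of (boundary m' n')) = form2_of (boundary (conv wspl m m') (conv wspl n n'))"
  by (simp add: conv2_eq boundary_bilinear word_form2_boundary assms boundary_conv)

text \<open>
  As all lazy cocycles are coboundaries, the group laws follow from those of the lazy functionals.
\<close>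

lemma group_lazy_cocycles:
  assumes sqrt: "\<And>x :: 'k. \<exists>c. c ^ 2 = x"
  shows "group (lazy_cocycle_group H)"
proof (rule groupI)
  note Z = lazy_cocycles_eq[OF sqrt]
  have one: "unit2 H = form2_of (boundary wcounit wcounit)"
    by (simp add: unit2_eq boundary_unit)
  show "\<one>\<^bsub>lazy_cocycle_group H\<^esub> \<in> carrier (lazy_cocycle_group H)"
    using lazy_pair_unit by (auto simp: lazy_cocycle_group_def Z one)
  fix x assume "x \<in> carrier (lazy_cocycle_group H)"
  then obtain a a' where x: "x = form2_of (boundary a a')" "lazy_pair a a'"
    by (auto simp: lazy_cocycle_group_def Z)
  have aa: "conv wspl a' a = wcounit" "conv wspl a a' = wcounit" using x(2) by (simp_all add: lazy_pair_def)
  show "\<one>\<^bsub>lazy_cocycle_group H\<^esub> \<otimes>\<^bsub>lazy_cocycle_group H\<^esub> x = x"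
    by (simp add: lazy_cocycle_group_def one x(1) conv2_boundary[OF lazy_pair_unit x(2)])
  have "conv2 H (form2_of (boundary a' a)) x = unit2 H"
    by (simp add: one x(1) conv2_boundary[OF lazy_pair_sym[OF x(2)] x(2)] aa)
  then show "\<exists>y\<in>carrier (lazy_cocycle_group H). y \<otimes>\<^bsub>lazy_cocycle_group H\<^esub> x = \<one>\<^bsub>lazy_cocycle_group H\<^esub>"
    using lazy_pair_sym[OF x(2)] by (auto simp: lazy_cocycle_group_def Z)
  fix y assume "y \<in> carrier (lazy_cocycle_group H)"
  then obtain b b' where y: "y = form2_of (boundary b b')" "lazy_pair b b'"
    by (auto simp: lazy_cocycle_group_def Z)
  show "x \<otimes>\<^bsub>lazy_cocycle_group H\<^esub> y \<in> carrier (lazy_cocycle_group H)"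
    using lazy_pair_conv[OF x(2) y(2)] by (auto simp: lazy_cocycle_group_def Z x(1) y(1) conv2_boundary[OF x(2) y(2)])
  fix z assume "z \<in> carrier (lazy_cocycle_group H)"
  then obtain c c' where z: "z = form2_of (boundary c c')" "lazy_pair c c'"
    by (auto simp: lazy_cocycle_group_def Z)
  show "x \<otimes>\<^bsub>lazy_cocycle_group H\<^esub> y \<otimes>\<^bsub>lazy_cocycle_group H\<^esub> z =
      x \<otimes>\<^bsub>lazy_cocycle_group H\<^esub> (y \<otimes>\<^bsub>lazy_cocycle_group H\<^esub> z)"
    by (simp add: lazy_cocycle_group_def x(1) y(1) z(1) conv2_boundary lazy_pair_conv x(2) y(2) z(2) W1.conv_assoc)
qed

text \<open>
  All lazy cocycles are coboundaries, so the lazy cohomology group is the quotient of a group by itself.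
\<close>

lemma trivial_lazy_cohomology:
  assumes sqrt: "\<And>x :: 'k. \<exists>c. c ^ 2 = x"
  shows "trivial_group (lazy_cohomology H)"
proof -
  let ?Z = "lazy_cocycle_group H"
  interpret Z: group ?Z by (rule group_lazy_cocycles[OF sqrt])
  have B: "coboundary H ` lazy_functionals H = carrier ?Z"
    by (simp add: coboundaries_eq lazy_cocycles_eq[OF sqrt] lazy_cocycle_group_def)
  have normal: "carrier ?Z \<lhd> ?Z"
    by (rule Z.normal_invI) (auto intro: Z.subgroup_self)
  have "group (?Z Mod carrier ?Z)" by (rule normal.factorgroup_is_group[OF normal])
  moreover have "carrier (?Z Mod carrier ?Z) = {\<one>\<^bsub>?Z Mod carrier ?Z\<^esub>}"
    using Z.coset_join2[OF _ Z.subgroup_self] by (auto simp: FactGroup_def RCOSETS_def)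
  ultimately show ?thesis
    unfolding lazy_cohomology_def B trivial_group_def by blast
qed

end

context root_of_unity
begin

section \<open>The lazy cohomology group of the dual of $u_q(sl(2))$\<close>

lemma presentation_O_SLq2:
  "presentation (O_SLq2 q) (\<lambda>x. (Idl\<^bsub>mat_free_bialgebra\<^esub> (SLq2_rels q)) +>\<^bsub>mat_free_bialgebra\<^esub> x) (SLq2_rels q)"
  using presentation.quotient[OF presentation_free, of "SLq2_rels q"] coideal_SLq2[OF q0]
  by (simp add: O_SLq2_def)

lemma frobenius_rels_eq:
  "frobenius_rels q N = (\<lambda>x. (Idl\<^bsub>mat_free_bialgebra\<^esub> (SLq2_rels q)) +>\<^bsub>mat_free_bialgebra\<^esub> x) ` pow_rels N"
proof -
  let ?p = "\<lambda>x. (Idl\<^bsub>mat_free_bialgebra\<^esub> (SLq2_rels q)) +>\<^bsub>mat_free_bialgebra\<^esub> x"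
  interpret O: presentation "O_SLq2 q" ?p "SLq2_rels q" by (rule presentation_O_SLq2)
  have pow: "?p x [^]\<^bsub>O_SLq2 q\<^esub> n = ?p (x ^ n)" for x and n :: nat
    by (induction n) (simp_all add: O.p_one O.p_mult power_commutes)
  have "SLq2_gen q i j [^]\<^bsub>O_SLq2 q\<^esub> N \<ominus>\<^bsub>O_SLq2 q\<^esub> (if i = j then \<one>\<^bsub>O_SLq2 q\<^esub> else \<zero>\<^bsub>O_SLq2 q\<^esub>) =
      ?p (gen i j ^ N - (if i = j then 1 else 0))" for i j
    unfolding SLq2_gen_def pow O.p_one O.p_zero by (cases "i = j") (simp_all add: O.minus)
  then show ?thesis unfolding frobenius_rels_def pow_rels_def by blast
qed

text \<open>
  The quotient is taken in two steps, first by the relations of \<open>SL\<^sub>q(2)\<close> and then by those for the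
  \<open>N\<close>-th powers. The coideal property is needed after each step.
\<close>

lemma presentation_uq:
  "\<exists>p. presentation (uq_sl2_dual q N) p rels"
proof -
  have "coideal (SLq2_rels q \<union> pow_rels N)" using coideal_rels by (simp add: rels_def)
  from presentation.quotient[OF presentation_O_SLq2 this] show ?thesis
    unfolding uq_sl2_dual_def frobenius_rels_eq rels_def by blast
qed

end

theorem corollary3p6:
  fixes q :: "'k::{alg_closed_field, field_char_0}" and N :: nat
  assumes "N > 1" and "odd N"
    and "q ^ N = 1" and "\<And>m. 0 < m \<Longrightarrow> m < N \<Longrightarrow> q ^ m \<noteq> 1"
  shows "trivial_group (lazy_cohomology (uq_sl2_dual q N))"
proof -
  interpret root_of_unity q N by standard (use assms in auto)
  obtain p where "presentation (uq_sl2_dual q N) p rels" using presentation_uq by blast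
  then interpret uq_presentation q N "uq_sl2_dual q N" p
    by (intro uq_presentation.intro root_of_unity_axioms)
  have "\<exists>c. c ^ 2 = x" for x :: 'k using nth_root_exists[of 2 x] by auto
  then show ?thesis by (rule trivial_lazy_cohomology)
qed

end
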